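(* Let $(u_n)$ be a sequence converging weakly to zero in $L^2(\mathbb R^m\times\mathbb R^d)$, let $(u_{n'})$ be a subsequence and $\mu\in L^2_{w^*}(\mathbb R^{2m};\mathcal M_b(\mathbb R^d\times \mathrm P))$ be such that for all $v\in L^2_c(\mathbb R^{2m})$, $\varphi_1,\varphi_2\in C_0(\mathbb R^d)$ and $\psi\in C(\mathrm P)$, $$\lim_{n'}\int_{\mathbb R^{2m}}\int_{\mathbb R^d}v(p,q)\bigl(\mathcal A_{\psi_{\mathrm P}}\,\varphi_1u_{n'}(\cdot,p)\bigr)(x)\,\overline{\varphi_2(x)u_{n'}(x,q)}\,dx\,dp\,dq=\int_{\mathbb R^{2m}}v(p,q)\,\langle\mu(p,q,\cdot,\cdot),\varphi_1\bar\varphi_2\otimes\psi\rangle\,dp\,dq .$$ Then $\mu$ has the form $$\mu(p,q,x,\xi)=f(p,q,x,\xi)\,\nu(x,\xi)$$ (that is, $\mu(p,q,\cdot)=f(p,q,\cdot)\,\nu$ for a.e. $(p,q)\in\mathbb R^{2m}$), where $\nu\in\mathcal M_b(\mathbb R^d\times \mathrm P)$ is a non-negative scalar Radon measure and $f\in L^2(\mathbb R^{2m};L^1(\mathbb R^d\times \mathrm P:\nu))$ satisfies $$\int_{\mathbb R^{2m}}\int_{\mathbb R^d\times \mathrm P}\rho(p)\bar\rho(q)\phi(x,\xi)f(p,q,x,\xi)\,d\nu(x,\xi)\,dp\,dq\ge 0$$ for any $\rho\in L^2_c(\mathbb R^m)$ and any $\phi\in C_0(\mathbb R^d\times \mathrm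 P)$ with $\phi\ge 0$.
   Context: Fix real numbers $\alpha_1,\dots,\alpha_d>0$, let $l$ be the smallest positive integer with $l\alpha_k>d$ for each $k$, and set $\mathrm P=\{\xi\in\mathbb R^d:\sum_{k=1}^d|\xi_k|^{l\alpha_k}=1\}$. The projection $\pi_{\mathrm P}:\mathbb R^d\setminus\{0\}\to \mathrm P$ is $(\pi_{\mathrm P}(\xi))_k=\xi_k\bigl(\sum_{j=1}^d|\xi_j|^{l\alpha_j}\bigr)^{-1/(l\alpha_k)}$. For $\psi\in C(\mathrm P)$ put $\psi_{\mathrm P}=\psi\circ\pi_{\mathrm P}$; $\mathcal A_{\psi_{\mathrm P}}$ is the Fourier multiplier operator on $L^2(\mathbb R^d)$ with symbol $\psi_{\mathrm P}$ ($\hat u(\xi)=\int e^{-2\pi ix\cdot\xi}u(x)\,dx$, $\widehat{\mathcal A_{\psi_{\mathrm P}}u}=\psi_{\mathrm P}\hat u$). $L^2_c$ denotes compactly supported $L^2$ functions, $C_0$ continuous functions vanishing at infinity, and $\mathcal M_b(\mathbb R^d\times \mathrm P)$ the bounded complex Radon measures, the dual of $C_0(\mathbb R^d\times \mathrm P)$. $L^2_{w^*}(\mathbb R^{2m};\mathcal M_b(\mathbb R^d\times \mathrm P))$ is the space of weakly-$*$ measurable $\mu:\mathbb R^{2m}\to\mathcal M_b(\mathbb R^d\times \mathrm P)$ with $\int_{\mathbb R^{2m}}\|\mu(p,q)\|^2\,dp\,dq<\infty$. $L^1(\mathbb R^d\times \mathrm P:\nu)$ is the $L^1$ space with respect to the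 measure $\nu$. *)

theory Defs
  imports "HOL-Analysis.Analysis"
begin

definition anis_l :: "('d::finite \<Rightarrow> real) \<Rightarrow> nat" where
  "anis_l \<alpha> = (LEAST l. l > 0 \<and> (\<forall>k. real l * \<alpha> k > real CARD('d)))"

definition anis_gauge :: "('d::finite \<Rightarrow> real) \<Rightarrow> real^'d \<Rightarrow> real" where
  "anis_gauge \<alpha> \<xi> = (\<Sum>k\<in>UNIV. \<bar>\<xi> $ k\<bar> powr (real (anis_l \<alpha>) * \<alpha> k))"

definition anis_P :: "('d::finite \<Rightarrow> real) \<Rightarrow> (real^'d) set" where
  "anis_P \<alpha> = {\<xi>. anis_gauge \<alpha> \<xi> = 1}"

text \<open>At the origin this returns the junk value 0; a single point does not matter for a multiplier
  symbol.\<close>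

definition anis_proj :: "('d::finite \<Rightarrow> real) \<Rightarrow> real^'d \<Rightarrow> real^'d" where
  "anis_proj \<alpha> \<xi> = (\<chi> k. \<xi> $ k * anis_gauge \<alpha> \<xi> powr (- 1 / (real (anis_l \<alpha>) * \<alpha> k)))"

text \<open>Elements of \<open>L\<^sup>2\<close> are handled through measurable representatives.\<close>

definition L2 :: "'a measure \<Rightarrow> ('a \<Rightarrow> complex) set" where
  "L2 M = {f \<in> borel_measurable M. integrable M (\<lambda>x. (cmod (f x))\<^sup>2)}"

definition L2c :: "'a::topological_space measure \<Rightarrow> ('a \<Rightarrow> complex) set" where
  "L2c M = {f \<in> L2 M. \<exists>K. compact K \<and> (AE x in M. x \<notin> K \<longrightarrow> f x = 0)}"

definition weakly_null_L2 :: "'a measure \<Rightarrow> (nat \<Rightarrow> 'a \<Rightarrow> complex) \<Rightarrow> bool" where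
  "weakly_null_L2 M u \<longleftrightarrow> (\<forall>n. u n \<in> L2 M) \<and>
     (\<forall>g\<in>L2 M. (\<lambda>n. LINT x|M. u n x * cnj (g x)) \<longlonglongrightarrow> 0)"

definition C0 :: "'a::topological_space set \<Rightarrow> ('a \<Rightarrow> 'b::real_normed_vector) set" where
  "C0 X = {\<phi>. continuous_on X \<phi> \<and>
     (\<forall>e>0. \<exists>K. compact K \<and> K \<subseteq> X \<and> (\<forall>x\<in>X - K. norm (\<phi> x) < e))}"

text \<open>\<open>L\<^sup>2(M; L\<^sup>1(\<nu>))\<close>, again through representatives, which are taken jointly measurable. For a
  \<open>\<sigma>\<close>-finite \<open>M\<close> and a finite Borel measure \<open>\<nu>\<close> on a separable metric space (so that \<open>L\<^sup>1(\<nu>)\<close> is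
  separable) these represent exactly the Bochner space.\<close>

definition L2_L1 :: "'a measure \<Rightarrow> 'b measure \<Rightarrow> ('a \<Rightarrow> 'b \<Rightarrow> complex) set" where
  "L2_L1 M \<nu> = {f. (\<lambda>(w, z). f w z) \<in> borel_measurable (M \<Otimes>\<^sub>M \<nu>) \<and>
     (\<integral>\<^sup>+ w. (\<integral>\<^sup>+ z. ennreal (cmod (f w z)) \<partial>\<nu>)\<^sup>2 \<partial>M) < \<infinity>}"

definition fourier_L1 :: "('a::euclidean_space \<Rightarrow> complex) \<Rightarrow> 'a \<Rightarrow> complex" where
  "fourier_L1 u \<xi> = (LINT x|lborel. exp (- 2 * of_real pi * \<i> * of_real (x \<bullet> \<xi>)) * u x)"

text \<open>\<open>w\<close> is the Fourier transform of \<open>u\<close> in the \<open>L\<^sup>2\<close> sense: the extension by continuity of the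
  integral formula from \<open>L\<^sup>1 \<inter> L\<^sup>2\<close>.\<close>

definition is_fourier_L2 :: "('a::euclidean_space \<Rightarrow> complex) \<Rightarrow> ('a \<Rightarrow> complex) \<Rightarrow> bool" where
  "is_fourier_L2 u w \<longleftrightarrow> u \<in> L2 lborel \<and> w \<in> L2 lborel \<and>
     (\<exists>s. (\<forall>k. integrable lborel (s k) \<and> s k \<in> L2 lborel) \<and>
        (\<lambda>k. \<integral>\<^sup>+ x. ennreal ((cmod (s k x - u x))\<^sup>2) \<partial>lborel) \<longlonglongrightarrow> 0 \<and>
        (\<lambda>k. \<integral>\<^sup>+ \<xi>. ennreal ((cmod (fourier_L1 (s k) \<xi> - w \<xi>))\<^sup>2) \<partial>lborel) \<longlonglongrightarrow> 0)"

text \<open>The operator with symbol \<open>\<sigma>\<close>. The result is determined almost everywhere, and \<open>SOME\<close> only picks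
  a representative.\<close>

definition fourier_multiplier ::
    "('a::euclidean_space \<Rightarrow> complex) \<Rightarrow> ('a \<Rightarrow> complex) \<Rightarrow> 'a \<Rightarrow> complex" where
  "fourier_multiplier \<sigma> u =
     (SOME w. \<exists>h. is_fourier_L2 u h \<and> is_fourier_L2 w (\<lambda>\<xi>. \<sigma> \<xi> * h \<xi>))"

text \<open>A complex measure is a countably additive complex set function; the argument \<open>M\<close> only
  provides the measurable space.\<close>

definition total_variation :: "'a measure \<Rightarrow> ('a set \<Rightarrow> complex) \<Rightarrow> ennreal" where
  "total_variation M \<kappa> =
     (SUP D\<in>{D. finite D \<and> D \<subseteq> sets M \<and> disjoint D}. \<Sum>A\<in>D. ennreal (cmod (\<kappa> A)))"

definition complex_measures :: "'a measure \<Rightarrow> ('a set \<Rightarrow> complex) set" where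
  "complex_measures M = {\<kappa>. total_variation M \<kappa> < \<infinity> \<and>
     (\<forall>A. range A \<subseteq> sets M \<longrightarrow> disjoint_family A \<longrightarrow> (\<lambda>n::nat. \<kappa> (A n)) sums \<kappa> (\<Union>n. A n))}"

text \<open>The positive variation in the Jordan decomposition of a signed measure \<open>s\<close>; \<open>ennreal\<close> truncates
  negative numbers to 0. The negative variation is the positive variation of \<open>-s\<close>.\<close>

definition pos_variation :: "'a measure \<Rightarrow> ('a set \<Rightarrow> real) \<Rightarrow> 'a measure" where
  "pos_variation M s =
     measure_of (space M) (sets M) (\<lambda>A. SUP B\<in>{B \<in> sets M. B \<subseteq> A}. ennreal (s B))"

definition signed_integral :: "'a measure \<Rightarrow> ('a set \<Rightarrow> real) \<Rightarrow> ('a \<Rightarrow> complex) \<Rightarrow> complex" where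
  "signed_integral M s \<phi> =
     (LINT z|pos_variation M s. \<phi> z) - (LINT z|pos_variation M (\<lambda>A. - s A). \<phi> z)"

definition cm_integral :: "'a measure \<Rightarrow> ('a set \<Rightarrow> complex) \<Rightarrow> ('a \<Rightarrow> complex) \<Rightarrow> complex" where
  "cm_integral M \<kappa> \<phi> =
     signed_integral M (\<lambda>A. Re (\<kappa> A)) \<phi> + \<i> * signed_integral M (\<lambda>A. Im (\<kappa> A)) \<phi>"

text \<open>The Borel space on \<open>X\<close>. The set \<open>\<real>\<^sup>d \<times> P\<close> is closed in a Euclidean space, so that every
  finite Borel measure on it is Radon: bounded complex Radon measures are just the elements of
  \<open>complex_measures (borel_on X)\<close>, and non-negative ones the finite measures on \<open>borel_on X\<close>.\<close>

abbreviation borel_on :: "'a::topological_space set \<Rightarrow> 'a measure" where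
  "borel_on X \<equiv> restrict_space borel X"

definition L2_wstar ::
    "'w measure \<Rightarrow> 'a::topological_space set \<Rightarrow> ('w \<Rightarrow> 'a set \<Rightarrow> complex) set" where
  "L2_wstar W X = {\<mu>. (\<forall>w. \<mu> w \<in> complex_measures (borel_on X)) \<and>
     (\<forall>\<phi>\<in>C0 X. (\<lambda>w. cm_integral (borel_on X) (\<mu> w) \<phi>) \<in> borel_measurable W) \<and>
     (\<integral>\<^sup>+ w. (total_variation (borel_on X) (\<mu> w))\<^sup>2 \<partial>W) < \<infinity>}"

end

theory Submission
  imports Defs "HOL-Probability.Probability"
begin

text \<open>
  Testing with \<open>\<phi>\<^sub>1 = \<phi>\<^sub>2\<close>, \<open>\<psi> \<ge> 0\<close> and \<open>v = \<rho> \<otimes> cnj \<rho>\<close>, Plancherel's theorem shows that \<open>A \<mapsto> \<mu>(\<cdot>, \<cdot>)(A)\<close> is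
  a measure with values in the positive Hilbert-Schmidt operators on \<open>L\<^sup>2(\<real>\<^sup>m)\<close>. A weakly null sequence is
  bounded, say by \<open>C\<close>, so all these operators have trace at most \<open>C\<^sup>2\<close>, and \<open>\<nu>(A)\<close> is the trace. It is
  obtained from an increasing sequence of finite-dimensional compressions. For a positive weight
  \<open>\<omega> \<in> L\<^sup>2\<close>, the complex measure \<open>\<omega>(p) \<omega>(q) \<mu>(p, q, \<cdot>) dp dq\<close> is absolutely continuous with respect to
  \<open>\<omega>(p)\<^sup>2 \<omega>(q)\<^sup>2 \<nu> dp dq\<close>, since on finite partitions the Hilbert-Schmidt norm of a positive matrix is
  bounded by its trace. The Radon-Nikodym derivative, multiplied by \<open>\<omega>(p) \<omega>(q)\<close>, is \<open>f\<close>.\<close>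

section \<open>Square integrable functions\<close>

text \<open>Lebesgue measure on \<open>\<real>^m\<close> is infinite, so \<mu>(p, q, .) dp dq need
  not be a finite measure; the weight \<omega> makes it one and, being positive, can be divided out
  again. The operators themselves are never built: only their forms and their entries between the
  functions \<omega> 1_I occur, where I runs through the cells of a refining sequence of finite
  partitions. Refinement increases the compressed trace by the Cauchy-Schwarz inequality for
  positive 2 by 2 matrices, so the trace is an increasing limit of measures. Its bound comes from
  localization: the average of u against \<omega> 1_I sees only u over I, and the squared norms of
  the restrictions of u to disjoint cells add up to at most that of u. The hypothesis tests \<mu>
  against continuous products only. Cells are therefore cut out by closed sets, whose indicators are
  limits of continuous functions, and what holds on all cells passes to Borel sets by approximation.
  There are countably many cells, which also merges the exceptional null sets of single Borel sets
  into one.\<close>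

definition l2n :: "'a measure \<Rightarrow> ('a \<Rightarrow> complex) \<Rightarrow> real" where
  "l2n M f = sqrt (LINT x|M. (cmod (f x))\<^sup>2)"

definition l2ip :: "'a measure \<Rightarrow> ('a \<Rightarrow> complex) \<Rightarrow> ('a \<Rightarrow> complex) \<Rightarrow> complex" where
  "l2ip M f g = (LINT x|M. f x * cnj (g x))"

lemma L2_measurable: "f \<in> L2 M \<Longrightarrow> f \<in> borel_measurable M"
  and L2_integrable: "f \<in> L2 M \<Longrightarrow> integrable M (\<lambda>x. (cmod (f x))\<^sup>2)"
  by (auto simp: L2_def)

lemma L2_I: "f \<in> borel_measurable M \<Longrightarrow> integrable M (\<lambda>x. (cmod (f x))\<^sup>2) \<Longrightarrow> f \<in> L2 M"
  by (auto simp: L2_def)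

lemma L2_bound:
  assumes "f \<in> L2 M" "g \<in> borel_measurable M" "AE x in M. cmod (g x) \<le> c * cmod (f x)"
  shows "g \<in> L2 M"
proof (rule L2_I)
  note [measurable] = assms(2) L2_measurable[OF assms(1)]
  show "integrable M (\<lambda>x. (cmod (g x))\<^sup>2)"
  proof (rule Bochner_Integration.integrable_bound)
    show "integrable M (\<lambda>x. c\<^sup>2 * (cmod (f x))\<^sup>2)"
      using L2_integrable[OF assms(1)] by auto
    show "AE x in M. norm ((cmod (g x))\<^sup>2) \<le> norm (c\<^sup>2 * (cmod (f x))\<^sup>2)"
      using assms(3)
    proof eventually_elim
      case (elim x)
      then have "(cmod (g x))\<^sup>2 \<le> (c * cmod (f x))\<^sup>2"
        by (intro power_mono) auto
      then show ?case by (simp add: power_mult_distrib)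
    qed
  qed measurable
qed fact

lemma L2_cmult: "f \<in> L2 M \<Longrightarrow> (\<lambda>x. c * f x) \<in> L2 M"
  by (rule L2_bound[where c="cmod c"]) (auto simp: norm_mult dest: L2_measurable)

lemma L2_uminus: "f \<in> L2 M \<Longrightarrow> (\<lambda>x. - f x) \<in> L2 M"
  by (rule L2_bound[where c=1]) (auto dest: L2_measurable)

lemma borel_measurable_cnj [measurable (raw)]:
  "f \<in> borel_measurable M \<Longrightarrow> (\<lambda>x. cnj (f x)) \<in> borel_measurable M"
  by (rule borel_measurable_continuous_on[of cnj]) (auto intro: continuous_intros)

lemma L2_cnj: "f \<in> L2 M \<Longrightarrow> (\<lambda>x. cnj (f x)) \<in> L2 M"
  by (rule L2_bound[where c=1]) (auto dest: L2_measurable)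

lemma L2_zero [simp]: "(\<lambda>x. 0) \<in> L2 M"
  by (auto simp: L2_def)

lemma L2_add:
  assumes "f \<in> L2 M" "g \<in> L2 M"
  shows "(\<lambda>x. f x + g x) \<in> L2 M"
proof (rule L2_I)
  note [measurable] = assms[THEN L2_measurable]
  show "integrable M (\<lambda>x. (cmod (f x + g x))\<^sup>2)"
  proof (rule Bochner_Integration.integrable_bound)
    show "integrable M (\<lambda>x. 2 * (cmod (f x))\<^sup>2 + 2 * (cmod (g x))\<^sup>2)"
      using assms[THEN L2_integrable] by auto
    have "(cmod (f x + g x))\<^sup>2 \<le> 2 * (cmod (f x))\<^sup>2 + 2 * (cmod (g x))\<^sup>2" for x
    proof -
      have "(cmod (f x + g x))\<^sup>2 \<le> (cmod (f x) + cmod (g x))\<^sup>2"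
        by (intro power_mono norm_triangle_ineq) auto
      also have "\<dots> \<le> 2 * (cmod (f x))\<^sup>2 + 2 * (cmod (g x))\<^sup>2"
        using zero_le_power2[of "cmod (f x) - cmod (g x)"]
        by (simp add: power2_eq_square algebra_simps)
      finally show ?thesis .
    qed
    then show "AE x in M. norm ((cmod (f x + g x))\<^sup>2) \<le> norm (2 * (cmod (f x))\<^sup>2 + 2 * (cmod (g x))\<^sup>2)"
      by auto
  qed measurable
qed (use assms[THEN L2_measurable] in auto)

lemma L2_diff: "f \<in> L2 M \<Longrightarrow> g \<in> L2 M \<Longrightarrow> (\<lambda>x. f x - g x) \<in> L2 M"
  using L2_add[OF _ L2_uminus, of f M g] by simp

lemma L2_sum: "(\<And>i. i \<in> I \<Longrightarrow> f i \<in> L2 M) \<Longrightarrow> (\<lambda>x. \<Sum>i\<in>I. f i x) \<in> L2 M"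
  by (induction I rule: infinite_finite_induct) (auto intro: L2_add)

lemma L2_mult_integrable:
  assumes "f \<in> L2 M" "g \<in> L2 M"
  shows "integrable M (\<lambda>x. f x * g x)"
proof (rule Bochner_Integration.integrable_bound)
  note [measurable] = assms[THEN L2_measurable]
  show "integrable M (\<lambda>x. (cmod (f x))\<^sup>2 + (cmod (g x))\<^sup>2)"
    using assms[THEN L2_integrable] by auto
  have "cmod (f x * g x) \<le> (cmod (f x))\<^sup>2 + (cmod (g x))\<^sup>2" for x
    using sum_squares_bound[of "cmod (f x)" "cmod (g x)"]
      mult_nonneg_nonneg[OF norm_ge_zero norm_ge_zero, of "f x" "g x"]
    unfolding norm_mult by linarith
  then show "AE x in M. norm (f x * g x) \<le> norm ((cmod (f x))\<^sup>2 + (cmod (g x))\<^sup>2)"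
    by auto
  show "(\<lambda>x. f x * g x) \<in> borel_measurable M" by measurable
qed

lemma l2ip_integrable: "f \<in> L2 M \<Longrightarrow> g \<in> L2 M \<Longrightarrow> integrable M (\<lambda>x. f x * cnj (g x))"
  by (intro L2_mult_integrable L2_cnj)

lemma l2n_nonneg [simp]: "0 \<le> l2n M f"
  by (simp add: l2n_def)

lemma l2n_sq: "(l2n M f)\<^sup>2 = (LINT x|M. (cmod (f x))\<^sup>2)"
  by (simp add: l2n_def)

lemma nn_integral_l2n:
  "f \<in> L2 M \<Longrightarrow> (\<integral>\<^sup>+x. ennreal ((cmod (f x))\<^sup>2) \<partial>M) = ennreal ((l2n M f)\<^sup>2)"
  by (simp add: l2n_sq nn_integral_eq_integral L2_integrable)

lemma L2_nnI:
  assumes "f \<in> borel_measurable M" "(\<integral>\<^sup>+x. ennreal ((cmod (f x))\<^sup>2) \<partial>M) < \<infinity>"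
  shows "f \<in> L2 M"
  using assms by (auto simp: L2_def integrable_iff_bounded norm_power)

lemma L2_nn_le:
  assumes "f \<in> borel_measurable M" "(\<integral>\<^sup>+x. ennreal ((cmod (f x))\<^sup>2) \<partial>M) \<le> ennreal (c\<^sup>2)" "0 \<le> c"
  shows "f \<in> L2 M" "l2n M f \<le> c"
proof -
  show f: "f \<in> L2 M"
    by (rule L2_nnI[OF assms(1)]) (use assms(2) in \<open>simp add: le_less_trans\<close>)
  then have "(l2n M f)\<^sup>2 \<le> c\<^sup>2"
    using assms(2) by (simp add: nn_integral_l2n)
  then show "l2n M f \<le> c"
    using assms(3) by (rule power2_le_imp_le)
qed

lemma l2_cauchy_schwarz_abs:
  assumes "f \<in> L2 M" "g \<in> L2 M"
  shows "(LINT x|M. cmod (f x) * cmod (g x)) \<le> l2n M f * l2n M g"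
proof -
  note [measurable] = assms[THEN L2_measurable]
  have int: "integrable M (\<lambda>x. cmod (f x) * cmod (g x))"
    using integrable_norm[OF L2_mult_integrable[OF assms]] by (simp add: norm_mult)
  let ?I = "LINT x|M. cmod (f x) * cmod (g x)"
  have "ennreal (?I\<^sup>2) = (\<integral>\<^sup>+x. ennreal (cmod (f x)) * ennreal (cmod (g x)) \<partial>M)\<^sup>2"
    using int by (simp add: nn_integral_eq_integral ennreal_mult[symmetric] ennreal_power)
  also have "\<dots> \<le> (\<integral>\<^sup>+x. (ennreal (cmod (f x)))\<^sup>2 \<partial>M) * (\<integral>\<^sup>+x. (ennreal (cmod (g x)))\<^sup>2 \<partial>M)"
    by (rule Cauchy_Schwarz_nn_integral) auto
  also have "\<dots> = ennreal ((l2n M f * l2n M g)\<^sup>2)"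
    using assms by (simp add: ennreal_power nn_integral_l2n ennreal_mult power_mult_distrib)
  finally have "?I\<^sup>2 \<le> (l2n M f * l2n M g)\<^sup>2"
    by simp
  then show ?thesis by (rule power2_le_imp_le) simp
qed

lemma l2_cauchy_schwarz:
  assumes "f \<in> L2 M" "g \<in> L2 M"
  shows "cmod (l2ip M f g) \<le> l2n M f * l2n M g"
proof -
  have "cmod (l2ip M f g) \<le> (LINT x|M. cmod (f x) * cmod (g x))"
    using integral_norm_bound[of M "\<lambda>x. f x * cnj (g x)"] by (simp add: l2ip_def norm_mult)
  with l2_cauchy_schwarz_abs[OF assms] show ?thesis by linarith
qed

lemma l2ip_self: "l2ip M f f = of_real ((l2n M f)\<^sup>2)"
proof -
  have "(\<lambda>x. f x * cnj (f x)) = (\<lambda>x. complex_of_real ((cmod (f x))\<^sup>2))"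
    by (simp add: fun_eq_iff complex_norm_square flip: of_real_power)
  then show ?thesis by (simp add: l2ip_def l2n_sq del: of_real_power)
qed

lemma l2ip_add_left: "f \<in> L2 M \<Longrightarrow> g \<in> L2 M \<Longrightarrow> h \<in> L2 M \<Longrightarrow>
    l2ip M (\<lambda>x. f x + g x) h = l2ip M f h + l2ip M g h"
  by (simp add: l2ip_def distrib_right l2ip_integrable)

lemma l2ip_diff_left: "f \<in> L2 M \<Longrightarrow> g \<in> L2 M \<Longrightarrow> h \<in> L2 M \<Longrightarrow>
    l2ip M (\<lambda>x. f x - g x) h = l2ip M f h - l2ip M g h"
  by (simp add: l2ip_def left_diff_distrib l2ip_integrable)

lemma l2ip_diff_right: "f \<in> L2 M \<Longrightarrow> g \<in> L2 M \<Longrightarrow> h \<in> L2 M \<Longrightarrow>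
    l2ip M h (\<lambda>x. f x - g x) = l2ip M h f - l2ip M h g"
  by (simp add: l2ip_def right_diff_distrib l2ip_integrable)

lemma l2ip_add_right: "f \<in> L2 M \<Longrightarrow> g \<in> L2 M \<Longrightarrow> h \<in> L2 M \<Longrightarrow>
    l2ip M h (\<lambda>x. f x + g x) = l2ip M h f + l2ip M h g"
  by (simp add: l2ip_def distrib_left l2ip_integrable)

lemma l2ip_cmult_right: "l2ip M h (\<lambda>x. c * f x) = cnj c * l2ip M h f"
  by (simp add: l2ip_def mult.left_commute)

lemma l2ip_commute: "l2ip M g f = cnj (l2ip M f g)"
proof -
  have "cnj (LINT x|M. f x * cnj (g x)) = (LINT x|M. cnj (f x * cnj (g x)))"
    by (simp only: Bochner_Integration.integral_cnj)
  then show ?thesis by (simp add: l2ip_def mult.commute)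
qed

lemma l2n_cmult: "l2n M (\<lambda>x. c * f x) = cmod c * l2n M f"
  by (simp add: l2n_def norm_mult power_mult_distrib real_sqrt_mult)

lemma l2n_cnj: "l2n M (\<lambda>x. cnj (f x)) = l2n M f"
  by (simp add: l2n_def)

lemma l2n_uminus: "l2n M (\<lambda>x. - f x) = l2n M f"
  by (simp add: l2n_def)

lemma l2n_minus_commute: "l2n M (\<lambda>x. f x - g x) = l2n M (\<lambda>x. g x - f x)"
  by (simp add: l2n_def norm_minus_commute)

text \<open>Expanding the square ties the norm to the inner product. The triangle inequality comes
  from it, and so does the passage from equal norms to equal inner products in
  \<open>fourier_parseval\<close>.\<close>

lemma l2n_sq_add:
  assumes "f \<in> L2 M" "g \<in> L2 M"
  shows "(l2n M (\<lambda>x. f x + g x))\<^sup>2 = (l2n M f)\<^sup>2 + (l2n M g)\<^sup>2 + 2 * Re (l2ip M f g)"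
proof -
  have "of_real ((l2n M (\<lambda>x. f x + g x))\<^sup>2) = l2ip M (\<lambda>x. f x + g x) (\<lambda>x. f x + g x)"
    by (simp only: l2ip_self)
  also have "\<dots> = l2ip M f f + l2ip M g g + (l2ip M f g + cnj (l2ip M f g))"
    using assms by (simp add: l2ip_add_left l2ip_add_right L2_add l2ip_commute[of M g f])
  finally have "complex_of_real ((l2n M (\<lambda>x. f x + g x))\<^sup>2) =
      of_real ((l2n M f)\<^sup>2 + (l2n M g)\<^sup>2 + 2 * Re (l2ip M f g))"
    by (simp add: l2ip_self complex_add_cnj)
  then show ?thesis by (simp only: of_real_eq_iff)
qed

lemma l2n_triangle:
  assumes "f \<in> L2 M" "g \<in> L2 M"
  shows "l2n M (\<lambda>x. f x + g x) \<le> l2n M f + l2n M g"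
proof (rule power2_le_imp_le)
  have "Re (l2ip M f g) \<le> l2n M f * l2n M g"
    using l2_cauchy_schwarz[OF assms] complex_Re_le_cmod order_trans by blast
  then show "(l2n M (\<lambda>x. f x + g x))\<^sup>2 \<le> (l2n M f + l2n M g)\<^sup>2"
    by (simp add: l2n_sq_add[OF assms] power2_sum)
qed simp

lemma l2n_triangle_diff:
  assumes "f \<in> L2 M" "g \<in> L2 M" "h \<in> L2 M"
  shows "l2n M (\<lambda>x. f x - h x) \<le> l2n M (\<lambda>x. f x - g x) + l2n M (\<lambda>x. g x - h x)"
  using l2n_triangle[OF L2_diff[OF assms(1,2)] L2_diff[OF assms(2,3)]] by simp

lemma l2n_diff_le:
  assumes "f \<in> L2 M" "g \<in> L2 M"
  shows "\<bar>l2n M f - l2n M g\<bar> \<le> l2n M (\<lambda>x. f x - g x)"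
  using l2n_triangle[OF L2_diff[OF assms] assms(2)] l2n_triangle[OF L2_diff[OF assms(2,1)] assms(1)]
  by (simp add: l2n_minus_commute[of M g f] abs_le_iff)

lemma l2n_cong_AE:
  assumes "f \<in> borel_measurable M" "g \<in> borel_measurable M" "AE x in M. f x = g x"
  shows "l2n M f = l2n M g"
proof -
  have "(LINT x|M. (cmod (f x))\<^sup>2) = (LINT x|M. (cmod (g x))\<^sup>2)"
    by (rule integral_cong_AE) (use assms in auto)
  then show ?thesis by (simp add: l2n_def)
qed

lemma l2n_zero_AE:
  assumes "f \<in> L2 M" "l2n M f = 0"
  shows "AE x in M. f x = 0"
  using assms integral_nonneg_eq_0_iff_AE[OF L2_integrable[OF assms(1)]]
  by (simp add: l2n_def)

lemma l2n_tendsto: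
  assumes "\<And>k. s k \<in> L2 M" "u \<in> L2 M" "(\<lambda>k. l2n M (\<lambda>x. s k x - u x)) \<longlonglongrightarrow> 0"
  shows "(\<lambda>k. l2n M (s k)) \<longlonglongrightarrow> l2n M u"
proof -
  have "(\<lambda>k. l2n M (s k) - l2n M u) \<longlonglongrightarrow> 0"
    by (rule Lim_null_comparison[OF _ assms(3)])
      (auto intro!: always_eventually l2n_diff_le assms)
  then show ?thesis by (simp add: LIM_zero_iff)
qed

lemma l2ip_tendsto:
  assumes "\<And>k. s k \<in> L2 M" "u \<in> L2 M" "(\<lambda>k. l2n M (\<lambda>x. s k x - u x)) \<longlonglongrightarrow> 0"
    and "\<And>k. t k \<in> L2 M" "w \<in> L2 M" "(\<lambda>k. l2n M (\<lambda>x. t k x - w x)) \<longlonglongrightarrow> 0"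
  shows "(\<lambda>k. l2ip M (s k) (t k)) \<longlonglongrightarrow> l2ip M u w"
proof -
  have "(\<lambda>k. l2ip M (s k) (t k) - l2ip M u w) \<longlonglongrightarrow> 0"
  proof (rule Lim_null_comparison)
    show "\<forall>\<^sub>F k in sequentially. norm (l2ip M (s k) (t k) - l2ip M u w) \<le>
        l2n M (\<lambda>x. s k x - u x) * l2n M (t k) + l2n M u * l2n M (\<lambda>x. t k x - w x)"
    proof (intro always_eventually allI)
      fix k
      have "l2ip M (s k) (t k) - l2ip M u w =
          l2ip M (\<lambda>x. s k x - u x) (t k) + l2ip M u (\<lambda>x. t k x - w x)"
        using assms by (simp add: l2ip_diff_left l2ip_diff_right)
      also have "norm \<dots> \<le> cmod (l2ip M (\<lambda>x. s k x - u x) (t k)) + cmod (l2ip M u (\<lambda>x. t k x - w x))"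
        by (rule norm_triangle_ineq)
      also have "\<dots> \<le> l2n M (\<lambda>x. s k x - u x) * l2n M (t k) + l2n M u * l2n M (\<lambda>x. t k x - w x)"
        using assms by (intro add_mono l2_cauchy_schwarz L2_diff) auto
      finally show "norm (l2ip M (s k) (t k) - l2ip M u w) \<le> \<dots>" .
    qed
    have "(\<lambda>k. l2n M (\<lambda>x. s k x - u x) * l2n M (t k) + l2n M u * l2n M (\<lambda>x. t k x - w x))
        \<longlonglongrightarrow> 0 * l2n M w + l2n M u * 0"
      using assms by (intro tendsto_intros l2n_tendsto) auto
    then show "(\<lambda>k. l2n M (\<lambda>x. s k x - u x) * l2n M (t k) + l2n M u * l2n M (\<lambda>x. t k x - w x)) \<longlonglongrightarrow> 0"
      by simp
  qed
  then show ?thesis by (simp add: LIM_zero_iff)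
qed

lemma nn_tendsto_iff_l2n:
  assumes "\<And>k. f k \<in> L2 M"
  shows "(\<lambda>k. \<integral>\<^sup>+x. ennreal ((cmod (f k x))\<^sup>2) \<partial>M) \<longlonglongrightarrow> 0 \<longleftrightarrow> (\<lambda>k. l2n M (f k)) \<longlonglongrightarrow> 0"
proof -
  have "(\<lambda>k. ennreal ((l2n M (f k))\<^sup>2)) \<longlonglongrightarrow> ennreal 0 \<longleftrightarrow> (\<lambda>k. (l2n M (f k))\<^sup>2) \<longlonglongrightarrow> 0"
    by (rule tendsto_ennreal_iff) auto
  also have "\<dots> \<longleftrightarrow> (\<lambda>k. l2n M (f k)) \<longlonglongrightarrow> 0"
  proof
    assume "(\<lambda>k. (l2n M (f k))\<^sup>2) \<longlonglongrightarrow> 0"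
    from tendsto_real_sqrt[OF this] show "(\<lambda>k. l2n M (f k)) \<longlonglongrightarrow> 0" by simp
  next
    assume "(\<lambda>k. l2n M (f k)) \<longlonglongrightarrow> 0"
    from tendsto_power[OF this, of 2] show "(\<lambda>k. (l2n M (f k))\<^sup>2) \<longlonglongrightarrow> 0" by simp
  qed
  finally show ?thesis by (simp add: nn_integral_l2n assms)
qed

lemma l2_dominated:
  assumes "\<And>k. s k \<in> borel_measurable M" "u \<in> borel_measurable M" "g \<in> L2 M"
    and "AE x in M. (\<lambda>k. s k x) \<longlonglongrightarrow> u x" "\<And>k. AE x in M. cmod (s k x) \<le> cmod (g x)"
  shows "\<And>k. s k \<in> L2 M" "u \<in> L2 M" "(\<lambda>k. l2n M (\<lambda>x. s k x - u x)) \<longlonglongrightarrow> 0"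
proof -
  note [measurable] = assms(1,2) L2_measurable[OF assms(3)]
  show s: "s k \<in> L2 M" for k
    by (rule L2_bound[where c=1, OF assms(3)]) (use assms in auto)
  have bd: "AE x in M. \<forall>k. cmod (s k x) \<le> cmod (g x)"
    using assms(5) by (simp add: AE_all_countable)
  have ub: "AE x in M. cmod (u x) \<le> cmod (g x)"
    using bd assms(4)
  proof eventually_elim
    case (elim x)
    then show ?case by (intro LIMSEQ_le_const2[OF tendsto_norm]) auto
  qed
  show u: "u \<in> L2 M"
    by (rule L2_bound[where c=1, OF assms(3)]) (use assms ub in auto)
  have "(\<lambda>k. LINT x|M. (cmod (s k x - u x))\<^sup>2) \<longlonglongrightarrow> (LINT x|M. 0)"
  proof (rule integral_dominated_convergence[where w="\<lambda>x. 4 * (cmod (g x))\<^sup>2"])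
    show "AE x in M. (\<lambda>k. (cmod (s k x - u x))\<^sup>2) \<longlonglongrightarrow> 0"
      using assms(4)
    proof eventually_elim
      case (elim x)
      then have "(\<lambda>k. (cmod (s k x - u x))\<^sup>2) \<longlonglongrightarrow> (cmod (u x - u x))\<^sup>2"
        by (intro tendsto_intros)
      then show ?case by simp
    qed
    show "AE x in M. norm ((cmod (s k x - u x))\<^sup>2) \<le> 4 * (cmod (g x))\<^sup>2" for k
      using bd ub
    proof eventually_elim
      case (elim x)
      then have "cmod (s k x - u x) \<le> 2 * cmod (g x)"
        using norm_triangle_ineq4[of "s k x" "u x"] by (smt (verit))
      then have "(cmod (s k x - u x))\<^sup>2 \<le> (2 * cmod (g x))\<^sup>2"
        by (intro power_mono) auto
      then show ?case by (simp add: power_mult_distrib)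
    qed
  qed (use L2_integrable[OF assms(3)] in auto)
  then have "(\<lambda>k. sqrt (LINT x|M. (cmod (s k x - u x))\<^sup>2)) \<longlonglongrightarrow> sqrt 0"
    by (intro tendsto_intros) simp
  then show "(\<lambda>k. l2n M (\<lambda>x. s k x - u x)) \<longlonglongrightarrow> 0"
    by (simp add: l2n_def)
qed

lemma l2n_sum_le:
  assumes "\<And>k. f k \<in> L2 M"
  shows "l2n M (\<lambda>x. \<Sum>k<n. f k x) \<le> (\<Sum>k<n::nat. l2n M (f k))"
proof (induction n)
  case (Suc n)
  have "l2n M (\<lambda>x. \<Sum>k<Suc n. f k x) \<le> l2n M (\<lambda>x. \<Sum>k<n. f k x) + l2n M (f n)"
    using l2n_triangle[OF L2_sum[of "{..<n}" f] assms[of n]] assms by simp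
  with Suc show ?case by simp
qed (simp add: l2n_def)

text \<open>The Riesz-Fischer argument with a rate: the sums \<open>S n\<close> of the absolute
  increments are bounded in L2, so monotone convergence makes their supremum finite almost
  everywhere, and there the sequence converges pointwise. The rate matters in
  \<open>weakly_null_bounded\<close>, where the tail of a series has to be estimated.\<close>

lemma l2_complete_geometric:
  fixes s :: "nat \<Rightarrow> 'a \<Rightarrow> complex"
  assumes s: "\<And>k. s k \<in> L2 M" and r: "0 < r" "r < 1" and C: "0 \<le> C"
    and d: "\<And>k. l2n M (\<lambda>x. s (Suc k) x - s k x) \<le> C * r ^ k"
  shows "\<exists>h\<in>L2 M. \<forall>k. l2n M (\<lambda>x. s k x - h x) \<le> C * r ^ k / (1 - r)"
proof -
  note [measurable] = s[THEN L2_measurable]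
  define a where "a = (\<lambda>k x. complex_of_real (cmod (s (Suc k) x - s k x)))"
  have a: "a k \<in> L2 M" for k
    unfolding a_def by (rule L2_bound[where c=1, OF L2_diff[OF s[of "Suc k"] s[of k]]]) auto
  have na: "l2n M (a k) \<le> C * r ^ k" for k
    using d[of k] by (simp add: a_def l2n_def)
  define B where "B = C / (1 - r)"
  have B0: "0 \<le> B" using C r by (simp add: B_def)
  have geo: "(\<Sum>k<n. C * r ^ k) \<le> B" for n
  proof -
    have "(\<Sum>k<n. r ^ k) \<le> 1 / (1 - r)"
      using r by (simp add: sum_gp_strict divide_right_mono)
    from mult_left_mono[OF this C] show ?thesis
      by (simp add: B_def sum_distrib_left[symmetric])
  qed
  define S where "S = (\<lambda>n x. \<Sum>k<n. cmod (s (Suc k) x - s k x))"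
  have [measurable]: "S n \<in> borel_measurable M" for n unfolding S_def by measurable
  have S0: "0 \<le> S n x" for n x by (auto simp: S_def intro: sum_nonneg)
  have SL: "(\<lambda>x. complex_of_real (S n x)) \<in> L2 M" and Sn: "l2n M (\<lambda>x. complex_of_real (S n x)) \<le> B" for n
  proof -
    have eq: "(\<lambda>x. complex_of_real (S n x)) = (\<lambda>x. \<Sum>k<n. a k x)"
      by (simp add: S_def a_def)
    show "(\<lambda>x. complex_of_real (S n x)) \<in> L2 M" unfolding eq by (intro L2_sum a)
    have "l2n M (\<lambda>x. \<Sum>k<n. a k x) \<le> (\<Sum>k<n. l2n M (a k))" by (rule l2n_sum_le[OF a])
    also have "\<dots> \<le> (\<Sum>k<n. C * r ^ k)" by (intro sum_mono na)
    also have "\<dots> \<le> B" by (rule geo)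
    finally show "l2n M (\<lambda>x. complex_of_real (S n x)) \<le> B" by (simp only: eq)
  qed
  have fin: "AE x in M. (SUP n. ennreal ((S n x)\<^sup>2)) \<noteq> \<infinity>"
  proof (rule nn_integral_PInf_AE)
    have "(\<integral>\<^sup>+x. (SUP n. ennreal ((S n x)\<^sup>2)) \<partial>M) = (SUP n. \<integral>\<^sup>+x. ennreal ((S n x)\<^sup>2) \<partial>M)"
    proof (rule nn_integral_monotone_convergence_SUP)
      show "incseq (\<lambda>n x. ennreal ((S n x)\<^sup>2))"
        by (intro incseq_SucI le_funI ennreal_leI power_mono) (auto simp: S_def sum_nonneg)
    qed measurable
    also have "\<dots> \<le> ennreal (B\<^sup>2)"
    proof (rule SUP_least)
      fix n
      have "(\<integral>\<^sup>+x. ennreal ((S n x)\<^sup>2) \<partial>M) = ennreal ((l2n M (\<lambda>x. complex_of_real (S n x)))\<^sup>2)"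
        using nn_integral_l2n[OF SL[of n]] by simp
      also have "\<dots> \<le> ennreal (B\<^sup>2)" by (intro ennreal_leI power_mono Sn) simp
      finally show "(\<integral>\<^sup>+x. ennreal ((S n x)\<^sup>2) \<partial>M) \<le> ennreal (B\<^sup>2)" .
    qed
    finally show "(\<integral>\<^sup>+x. (SUP n. ennreal ((S n x)\<^sup>2)) \<partial>M) \<noteq> \<infinity>"
      by (auto simp: top_unique)
  qed measurable
  have conv: "AE x in M. convergent (\<lambda>k. s k x)"
    using fin
  proof eventually_elim
    case (elim x)
    then obtain b where b: "0 \<le> b" "(SUP n. ennreal ((S n x)\<^sup>2)) = ennreal b"
      by (cases "SUP n. ennreal ((S n x)\<^sup>2)") auto
    have "(S n x)\<^sup>2 \<le> b" for n
    proof -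
      have "ennreal ((S n x)\<^sup>2) \<le> ennreal b" unfolding b(2)[symmetric] by (rule SUP_upper) simp
      then show ?thesis using b(1) by simp
    qed
    then have "S n x \<le> sqrt b" for n by (intro real_le_rsqrt) auto
    then have "summable (\<lambda>k. cmod (s (Suc k) x - s k x))"
      by (intro bounded_imp_summable[where B="sqrt b"])
        (auto simp: S_def lessThan_Suc_atMost[symmetric] simp del: sum.lessThan_Suc)
    then have "summable (\<lambda>k. s (Suc k) x - s k x)" by (rule summable_norm_cancel)
    then have "convergent (\<lambda>n. \<Sum>k<n. s (Suc k) x - s k x)" by (simp add: summable_iff_convergent)
    then have "convergent (\<lambda>n. s n x - s 0 x)"
      unfolding sum_lessThan_telescope[of "\<lambda>k. s k x"] .
    then obtain l where "(\<lambda>n. s n x - s 0 x) \<longlonglongrightarrow> l" by (auto simp: convergent_def)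
    then have "(\<lambda>n. s n x - s 0 x + s 0 x) \<longlonglongrightarrow> l + s 0 x" by (intro tendsto_intros)
    then show ?case by (auto simp: convergent_def)
  qed
  define h where "h = (\<lambda>x. lim (\<lambda>k. s k x))"
  have [measurable]: "h \<in> borel_measurable M" unfolding h_def by measurable
  have lim: "AE x in M. (\<lambda>k. s k x) \<longlonglongrightarrow> h x"
    using conv by eventually_elim (simp add: h_def convergent_LIMSEQ_iff)
  have sk: "l2n M (\<lambda>x. s k x - s (k + j) x) \<le> C * r ^ k / (1 - r)" for k j
  proof -
    have "l2n M (\<lambda>x. s (k + j) x - s k x) = l2n M (\<lambda>x. \<Sum>i<j. s (Suc (k + i)) x - s (k + i) x)"
      using sum_lessThan_telescope[of "\<lambda>i. s (k + i) _" j] by simp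
    also have "\<dots> \<le> (\<Sum>i<j. l2n M (\<lambda>x. s (Suc (k + i)) x - s (k + i) x))"
      by (rule l2n_sum_le) (intro L2_diff s)
    also have "\<dots> \<le> (\<Sum>i<j. C * r ^ (k + i))" by (intro sum_mono d)
    also have "\<dots> = r ^ k * (\<Sum>i<j. C * r ^ i)" by (simp add: sum_distrib_left power_add mult_ac)
    also have "\<dots> \<le> r ^ k * B" using r by (intro mult_left_mono geo) auto
    finally show ?thesis by (simp add: B_def l2n_minus_commute[of M "s k"] mult_ac)
  qed
  \<comment> \<open>Fatou in \<open>j\<close> turns the Cauchy estimate \<open>sk\<close> into an
    estimate for the limit; it also puts \<open>s k - h\<close>, and hence \<open>h\<close>, into
    L2.\<close>
  have hk: "(\<lambda>x. s k x - h x) \<in> L2 M \<and> l2n M (\<lambda>x. s k x - h x) \<le> C * r ^ k / (1 - r)" for k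
  proof -
    have "(\<integral>\<^sup>+x. ennreal ((cmod (s k x - h x))\<^sup>2) \<partial>M) =
        (\<integral>\<^sup>+x. liminf (\<lambda>j. ennreal ((cmod (s k x - s (k + j) x))\<^sup>2)) \<partial>M)"
    proof (rule nn_integral_cong_AE, use lim in eventually_elim)
      case (elim x)
      then have "(\<lambda>j. ennreal ((cmod (s k x - s (j + k) x))\<^sup>2)) \<longlonglongrightarrow> ennreal ((cmod (s k x - h x))\<^sup>2)"
        by (intro tendsto_ennrealI tendsto_intros LIMSEQ_ignore_initial_segment)
      then show ?case
        unfolding add.commute[of k] by (intro lim_imp_Liminf[symmetric]) auto
    qed
    also have "\<dots> \<le> liminf (\<lambda>j. \<integral>\<^sup>+x. ennreal ((cmod (s k x - s (k + j) x))\<^sup>2) \<partial>M)"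
      by (rule nn_integral_liminf) measurable
    also have "\<dots> \<le> ennreal ((C * r ^ k / (1 - r))\<^sup>2)"
    proof (rule order_trans[OF Liminf_le_Limsup Limsup_bounded])
      show "\<forall>\<^sub>F j in sequentially. (\<integral>\<^sup>+x. ennreal ((cmod (s k x - s (k + j) x))\<^sup>2) \<partial>M)
          \<le> ennreal ((C * r ^ k / (1 - r))\<^sup>2)"
        by (intro always_eventually allI)
          (auto simp: nn_integral_l2n[OF L2_diff[OF s s]] intro!: power_mono sk)
    qed simp
    finally show ?thesis
      using L2_nn_le[of "\<lambda>x. s k x - h x" M "C * r ^ k / (1 - r)"] C r by simp
  qed
  have "h \<in> L2 M"
    using L2_diff[OF s[of 0] conjunct1[OF hk[of 0]]] by simp
  with hk show ?thesis by blast
qed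

text \<open>Uniform boundedness by a gliding hump. If the norms were unbounded, indices
  \<open>N k\<close> with norms above \<open>4 ^ k\<close> would give a single \<open>h\<close> in
  L2 whose pairings with \<open>u (N k)\<close> grow at least like \<open>(4/3) ^ k\<close>,
  although \<open>l2ip M (u n) h\<close> converges. The terms of \<open>h\<close> are multiples of
  \<open>u (N k)\<close> of norm \<open>(1/3) ^ Suc k\<close>.\<close>

lemma weakly_null_bounded:
  assumes "weakly_null_L2 M u"
  shows "\<exists>C. \<forall>n. l2n M (u n) \<le> C"
proof (rule ccontr)
  assume "\<nexists>C. \<forall>n. l2n M (u n) \<le> C"
  then have "\<exists>n. l2n M (u n) > 4 ^ k" for k :: nat by (meson not_le)
  then obtain N where N: "\<And>k. l2n M (u (N k)) > 4 ^ k" by metis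
  have u: "\<And>n. u n \<in> L2 M" and w: "\<And>g. g \<in> L2 M \<Longrightarrow> (\<lambda>n. l2ip M (u n) g) \<longlonglongrightarrow> 0"
    using assms by (auto simp: weakly_null_L2_def l2ip_def)
  define c where "c k = (1/3) ^ Suc k / l2n M (u (N k))" for k
  define d where "d = (\<lambda>k x. complex_of_real (c k) * u (N k) x)"
  have Npos: "l2n M (u (N k)) > 0" for k
    using N[of k] by (meson less_trans zero_less_numeral zero_less_power)
  have cpos: "c k > 0" for k using Npos by (simp add: c_def)
  have d: "d k \<in> L2 M" for k unfolding d_def by (intro L2_cmult u)
  have nd: "l2n M (d k) = (1/3) ^ Suc k" for k
  proof -
    have "l2n M (d k) = c k * l2n M (u (N k))"
      using cpos[of k] unfolding d_def l2n_cmult by simp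
    then show ?thesis using Npos[of k] by (simp add: c_def)
  qed
  have ud: "l2ip M (u (N k)) (d k) = of_real ((1/3) ^ Suc k * l2n M (u (N k)))" for k
  proof -
    have "l2ip M (u (N k)) (d k) = of_real (c k * (l2n M (u (N k)))\<^sup>2)"
      unfolding d_def l2ip_cmult_right l2ip_self by simp
    also have "c k * (l2n M (u (N k)))\<^sup>2 = (1/3) ^ Suc k * l2n M (u (N k))"
      using Npos[of k] by (simp add: c_def power2_eq_square)
    finally show ?thesis .
  qed
  \<comment> \<open>The pairings of \<open>u (N k)\<close> with \<open>f + d k\<close> and
    \<open>f - d k\<close> differ by twice the pairing with \<open>d k\<close>. One of them is
    therefore at least as large in modulus as that with \<open>d k\<close>, whatever the earlier
    terms collected in \<open>f\<close> contribute.\<close>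
  define pick where "pick = (\<lambda>k f. if cmod (l2ip M (u (N k)) (\<lambda>x. f x + d k x)) \<ge> (1/3) ^ Suc k * l2n M (u (N k))
      then (\<lambda>x. f x + d k x) else (\<lambda>x. f x - d k x))"
  define s where "s = rec_nat (\<lambda>x. 0) pick"
  have s0: "s 0 = (\<lambda>x. 0)" and sS: "\<And>k. s (Suc k) = pick k (s k)"
    by (auto simp: s_def)
  have sL: "s k \<in> L2 M" for k
    by (induction k) (auto simp: s0 sS pick_def intro: L2_add L2_diff d)
  have big: "cmod (l2ip M (u (N k)) (s (Suc k))) \<ge> (1/3) ^ Suc k * l2n M (u (N k))" for k
  proof (cases "cmod (l2ip M (u (N k)) (\<lambda>x. s k x + d k x)) \<ge> (1/3) ^ Suc k * l2n M (u (N k))")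
    case True
    then show ?thesis by (simp add: sS pick_def)
  next
    case False
    let ?T = "l2ip M (u (N k))"
    have "2 * ?T (d k) = ?T (\<lambda>x. s k x + d k x) - ?T (\<lambda>x. s k x - d k x)"
      using sL d u by (simp add: l2ip_add_right l2ip_diff_right)
    then have "cmod (2 * ?T (d k)) \<le> cmod (?T (\<lambda>x. s k x + d k x)) + cmod (?T (\<lambda>x. s k x - d k x))"
      by (simp only: norm_triangle_ineq4)
    moreover have "cmod (2 * ?T (d k)) = 2 * ((1/3) ^ Suc k * l2n M (u (N k)))"
      using Npos[of k] by (simp only: ud norm_mult norm_of_real) simp
    ultimately have "(1/3) ^ Suc k * l2n M (u (N k)) \<le> cmod (?T (\<lambda>x. s k x - d k x))"
      using False by linarith
    with False show ?thesis by (simp add: sS pick_def)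
  qed
  have step: "l2n M (\<lambda>x. s (Suc k) x - s k x) \<le> 1/3 * (1/3) ^ k" for k
    using nd[of k] by (simp add: sS pick_def l2n_uminus)
  from l2_complete_geometric[OF sL _ _ _ step] obtain h where h: "h \<in> L2 M"
    and hk: "\<And>k. l2n M (\<lambda>x. s k x - h x) \<le> 1/3 * (1/3) ^ k / (1 - 1/3)" by auto
  \<comment> \<open>The terms after \<open>s (Suc k)\<close> have total norm at most
    \<open>(1/3) ^ k / 6\<close>, which is half of \<open>(1/3) ^ Suc k\<close>; they cancel at most
    half of the pairing secured in \<open>big\<close>. What remains is \<open>(1/3) ^ k / 6\<close>
    times a norm above \<open>4 ^ k\<close>.\<close>
  have low: "cmod (l2ip M (u (N k)) h) \<ge> (4/3) ^ k / 6" for k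
  proof -
    let ?T = "l2ip M (u (N k))"
    have "?T (s (Suc k)) = ?T (\<lambda>x. s (Suc k) x - h x) + ?T h"
      using sL h u by (simp add: l2ip_diff_right)
    then have "cmod (?T (s (Suc k))) \<le> cmod (?T (\<lambda>x. s (Suc k) x - h x)) + cmod (?T h)"
      by (simp only: norm_triangle_ineq)
    moreover have "cmod (?T (\<lambda>x. s (Suc k) x - h x)) \<le> l2n M (u (N k)) * (1/3 * (1/3) ^ Suc k / (1 - 1/3))"
      by (rule order_trans[OF l2_cauchy_schwarz[OF u L2_diff[OF sL h]] mult_left_mono[OF hk]]) simp
    moreover have "l2n M (u (N k)) * (1/3 * (1/3) ^ Suc k / (1 - 1/3)) = (1/3) ^ k / 6 * l2n M (u (N k))"
      by simp
    moreover have "(1/3) ^ Suc k * l2n M (u (N k)) = 2 * ((1/3) ^ k / 6 * l2n M (u (N k)))"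
      by simp
    ultimately have "cmod (?T h) \<ge> (1/3) ^ k / 6 * l2n M (u (N k))"
      using big[of k] by linarith
    moreover have "(1/3) ^ k / 6 * l2n M (u (N k)) \<ge> (1/3) ^ k / 6 * 4 ^ k"
      using N[of k] by (intro mult_left_mono) auto
    ultimately show ?thesis by (simp add: power_divide)
  qed
  from w[OF h] have "Bseq (\<lambda>n. l2ip M (u n) h)" by (rule convergent_imp_Bseq[OF convergentI])
  then obtain K where K: "\<And>n. cmod (l2ip M (u n) h) \<le> K" unfolding Bseq_def by auto
  obtain k where "(4/3::real) ^ k > 6 * K" using real_arch_pow[of "4/3" "6 * K"] by auto
  with low[of k] K[of "N k"] show False by simp
qed

section \<open>Continuous functions and translations in L2\<close>

lemma measurable_limit_of_continuous:
  fixes f :: "'a::euclidean_space \<Rightarrow> complex"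
  assumes "f \<in> borel_measurable borel"
  obtains g where "\<And>n::nat. continuous_on UNIV (g n)" "AE x in lborel. (\<lambda>n. g n x) \<longlonglongrightarrow> f x"
proof -
  have "f \<in> borel_measurable lebesgue"
    using assms by (simp add: measurable_completion)
  then have "f measurable_on UNIV"
    by (rule lebesgue_measurable_imp_measurable_on) simp
  then obtain N g where N: "negligible N" and g: "\<And>n. continuous_on UNIV (g n)"
    and lim: "\<And>x. x \<notin> N \<Longrightarrow> (\<lambda>n. g n x) \<longlonglongrightarrow> f x"
    by (auto simp: measurable_on_def)
  have "AE x in lebesgue. x \<notin> N"
    using N by (simp add: negligible_iff_null_sets AE_not_in)
  then have "AE x in lborel. x \<notin> N"
    by (simp add: AE_completion_iff)
  then have "AE x in lborel. (\<lambda>n. g n x) \<longlonglongrightarrow> f x"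
    by eventually_elim (rule lim)
  with g that show ?thesis by blast
qed

lemma indicator_ball_L2:
  "(\<lambda>x::'a::euclidean_space. complex_of_real (B * indicator (cball 0 R) x)) \<in> L2 lborel"
proof (rule L2_I)
  have "(\<lambda>x::'a. (cmod (complex_of_real (B * indicator (cball 0 R) x)))\<^sup>2) = (\<lambda>x. B\<^sup>2 * indicator (cball 0 R) x)"
    by (auto simp: fun_eq_iff indicator_def)
  moreover have "emeasure lborel (cball (0::'a) R) < \<infinity>"
    by (intro emeasure_bounded_finite) auto
  ultimately show "integrable lborel (\<lambda>x::'a. (cmod (complex_of_real (B * indicator (cball 0 R) x)))\<^sup>2)"
    by simp
next
  have [measurable]: "cball (0::'a) R \<in> sets borel" by simp
  show "(\<lambda>x::'a. complex_of_real (B * indicator (cball 0 R) x)) \<in> borel_measurable lborel" by measurable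
qed

lemma LIMSEQ_zero_less:
  fixes f :: "nat \<Rightarrow> real"
  assumes "f \<longlonglongrightarrow> 0" "0 < e"
  shows "\<exists>n. \<forall>m\<ge>n. f m < e"
  using order_tendstoD(2)[OF assms] by (auto simp: eventually_sequentially)

text \<open>After truncation in size and support, \<open>u\<close> is an almost everywhere limit of
  continuous functions, but these may be large or spread out. Clipping them radially at height
  \<open>K\<close> and multiplying by the cut-off \<open>cu\<close> does not change the limit,
  because both operations fix the values of the truncated function; dominated convergence then gives
  the limit in norm.\<close>

lemma continuous_compact_support_dense_L2:
  fixes u :: "'a::euclidean_space \<Rightarrow> complex"
  assumes u: "u \<in> L2 lborel" and e: "e > 0"
  obtains d B R where "continuous_on UNIV d" "\<And>x. cmod (d x) \<le> B" "\<And>x. norm x > R \<Longrightarrow> d x = 0"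
    "0 \<le> R" "d \<in> L2 lborel" "l2n lborel (\<lambda>x. d x - u x) < e"
proof -
  note [measurable] = L2_measurable[OF u, simplified]
  define v where "v = (\<lambda>k x. if norm x \<le> real k \<and> cmod (u x) \<le> real k then u x else 0)"
  have [measurable]: "v k \<in> borel_measurable borel" for k unfolding v_def by measurable
  have vL: "v k \<in> L2 lborel" for k
    by (rule L2_bound[where c=1, OF u]) (auto simp: v_def)
  have vu: "(\<lambda>k. l2n lborel (\<lambda>x. v k x - u x)) \<longlonglongrightarrow> 0"
  proof (rule l2_dominated(3)[OF _ _ u])
    show "AE x in lborel. (\<lambda>k. v k x) \<longlonglongrightarrow> u x"
    proof (intro AE_I2 tendsto_eventually)
      fix x
      obtain k where k: "max (norm x) (cmod (u x)) \<le> real k" using real_arch_simple by blast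
      show "\<forall>\<^sub>F k in sequentially. v k x = u x"
        using eventually_ge_at_top[of k] by eventually_elim (use k in \<open>auto simp: v_def\<close>)
    qed
  qed (auto simp: v_def)
  obtain k where k: "l2n lborel (\<lambda>x. v k x - u x) < e / 2"
    using LIMSEQ_zero_less[OF vu, of "e/2"] e by (metis half_gt_zero order_refl)
  obtain g where g: "\<And>n::nat. continuous_on UNIV (g n)" and glim: "AE x in lborel. (\<lambda>n. g n x) \<longlonglongrightarrow> v k x"
    using measurable_limit_of_continuous[of "v k"] by auto
  \<comment> \<open>One more than \<open>k\<close>, so that \<open>cu\<close> is equal to 1 on the
    whole ball of radius \<open>k\<close>.\<close>
  define K where "K = real k + 1"
  have K: "K > 0" by (simp add: K_def)
  define cl where "cl = (\<lambda>z::complex. of_real (K / max K (cmod z)) * z)"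
  define cu where "cu = (\<lambda>x::'a. max 0 (min 1 (K - norm x)))"
  define d where "d = (\<lambda>n x. of_real (cu x) * cl (g n x))"
  have cl_bound: "cmod (cl z) \<le> K" for z
    using K by (auto simp: cl_def norm_mult norm_divide max_def)
  have cl_cont: "continuous_on UNIV cl"
    unfolding cl_def using K by (intro continuous_intros) auto
  have cont: "continuous_on UNIV (d n)" for n
    unfolding d_def cu_def
    by (intro continuous_intros continuous_on_compose2[OF cl_cont g]) auto
  have cu01: "0 \<le> cu x" "cu x \<le> 1" for x by (auto simp: cu_def)
  have dB: "cmod (d n x) \<le> K" for n x
    using mult_mono[OF cu01(2) cl_bound[of "g n x"], of x] cu01[of x] by (simp add: d_def norm_mult)
  have d0: "d n x = 0" if "norm x > K" for n x
    using that by (simp add: d_def cu_def)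
  define G where "G = (\<lambda>x::'a. complex_of_real (K * indicator (cball 0 K) x))"
  have [measurable]: "d n \<in> borel_measurable borel" for n
    using cont by (rule borel_measurable_continuous_onI)
  have GL: "G \<in> L2 lborel" unfolding G_def by (rule indicator_ball_L2)
  have dG: "cmod (d n x) \<le> cmod (G x)" for n x
    using dB[of n x] d0[of x n] K by (cases "norm x > K") (auto simp: G_def indicator_def)
  have lim: "AE x in lborel. (\<lambda>n. d n x) \<longlonglongrightarrow> v k x"
    using glim
  proof eventually_elim
    case (elim x)
    have "(\<lambda>n. cl (g n x)) \<longlonglongrightarrow> cl (v k x)"
      using cl_cont elim by (auto simp: continuous_on_eq_continuous_at intro: isCont_tendsto_compose[of _ cl])
    then have "(\<lambda>n. d n x) \<longlonglongrightarrow> of_real (cu x) * cl (v k x)"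
      unfolding d_def by (intro tendsto_intros)
    moreover have "of_real (cu x) * cl (v k x) = v k x"
    proof (cases "norm x \<le> real k \<and> cmod (u x) \<le> real k")
      case True
      then have "cu x = 1" "max K (cmod (v k x)) = K" by (auto simp: cu_def K_def v_def)
      then show ?thesis using K by (simp add: cl_def)
    qed (auto simp: v_def cl_def)
    ultimately show ?case by simp
  qed
  have dL: "d n \<in> L2 lborel" for n
    by (rule L2_bound[where c=1, OF GL]) (use dG in auto)
  have dv: "(\<lambda>n. l2n lborel (\<lambda>x. d n x - v k x)) \<longlonglongrightarrow> 0"
    by (rule l2_dominated(3)[OF _ _ GL lim]) (use dG in auto)
  obtain n where n: "l2n lborel (\<lambda>x. d n x - v k x) < e / 2"
    using LIMSEQ_zero_less[OF dv, of "e/2"] e by (metis half_gt_zero order_refl)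
  have "l2n lborel (\<lambda>x. d n x - u x) < e"
    using l2n_triangle_diff[OF dL[of n] vL[of k] u] n k by simp
  then show ?thesis
    using that[of "d n" K K] cont dB d0 K dL by auto
qed

lemma lborel_integral_translate:
  fixes f :: "'a::euclidean_space \<Rightarrow> 'b::{banach,second_countable_topology}"
  assumes [measurable]: "f \<in> borel_measurable borel"
  shows "(LINT x|lborel. f (x - h)) = (LINT x|lborel. f x)"
    and "integrable lborel (\<lambda>x. f (x - h)) \<longleftrightarrow> integrable lborel f"
proof -
  have eq: "distr lborel borel ((+) (- h)) = lborel" by (rule lborel_distr_plus)
  have "(LINT x|distr lborel borel ((+) (- h)). f x) = (LINT x|lborel. f (- h + x))"
    by (rule integral_distr) auto
  then show "(LINT x|lborel. f (x - h)) = (LINT x|lborel. f x)" by (simp add: eq)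
  have "integrable (distr lborel borel ((+) (- h))) f \<longleftrightarrow> integrable lborel (\<lambda>x. f (- h + x))"
    by (rule integrable_distr_eq) auto
  then show "integrable lborel (\<lambda>x. f (x - h)) \<longleftrightarrow> integrable lborel f" by (simp add: eq)
qed

lemma L2_translate:
  fixes u :: "'a::euclidean_space \<Rightarrow> complex"
  assumes u: "u \<in> L2 lborel"
  shows "(\<lambda>x. u (x - h)) \<in> L2 lborel" "l2n lborel (\<lambda>x. u (x - h)) = l2n lborel u"
proof -
  note [measurable] = L2_measurable[OF u, simplified]
  show "(\<lambda>x. u (x - h)) \<in> L2 lborel"
    using lborel_integral_translate(2)[of "\<lambda>x. (cmod (u x))\<^sup>2" h] L2_integrable[OF u] by (auto intro!: L2_I)
  show "l2n lborel (\<lambda>x. u (x - h)) = l2n lborel u"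
    using lborel_integral_translate(1)[of "\<lambda>x. (cmod (u x))\<^sup>2" h] by (simp add: l2n_def)
qed

text \<open>Translation is isometric, so a close continuous function \<open>d\<close> of compact
  support can replace \<open>u\<close> at both ends; for \<open>d\<close> dominated convergence
  applies.\<close>

lemma L2_translate_weakly_continuous:
  fixes u :: "'a::euclidean_space \<Rightarrow> complex"
  assumes u: "u \<in> L2 lborel" and h: "h \<longlonglongrightarrow> 0"
  shows "(\<lambda>n. l2ip lborel u (\<lambda>x. u (x - h n))) \<longlonglongrightarrow> l2ip lborel u u"
proof -
  note [measurable] = L2_measurable[OF u, simplified]
  from h have "Bseq h" by (rule convergent_imp_Bseq[OF convergentI])
  then obtain H where H: "0 < H" "\<And>n. norm (h n) \<le> H" by (auto simp: Bseq_def)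
  show ?thesis
  proof (rule metric_LIMSEQ_I)
    fix e :: real assume e: "0 < e"
    \<comment> \<open>The factor 3 pays for the three distances from the translate of
      \<open>u\<close> through the translate of \<open>d\<close> and \<open>d\<close> to
      \<open>u\<close>; the summand 1 covers a vanishing norm of \<open>u\<close>.\<close>
    define e' where "e' = e / (3 * (l2n lborel u + 1))"
    have un: "l2n lborel u + 1 > 0" using l2n_nonneg[of lborel u] by linarith
    then have e': "e' > 0" using e by (simp add: e'_def)
    obtain d B R where d: "continuous_on UNIV d" "\<And>x. cmod (d x) \<le> B" "\<And>x. norm x > R \<Longrightarrow> d x = 0"
      "0 \<le> R" "d \<in> L2 lborel" "l2n lborel (\<lambda>x. d x - u x) < e'"
      using continuous_compact_support_dense_L2[OF u e'] by metis
    note [measurable] = L2_measurable[OF d(5), simplified]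
    have B: "0 \<le> B" using d(2)[of 0] norm_ge_zero order_trans by blast
    \<comment> \<open>Since \<open>norm (h n)\<close> is at most \<open>H\<close>, all translates of
      \<open>d\<close> vanish outside this one ball.\<close>
    define G where "G = (\<lambda>x::'a. complex_of_real (B * indicator (cball 0 (R + H)) x))"
    have GL: "G \<in> L2 lborel" unfolding G_def by (rule indicator_ball_L2)
    have dc: "(\<lambda>n. l2n lborel (\<lambda>x. d (x - h n) - d x)) \<longlonglongrightarrow> 0"
    proof (rule l2_dominated(3)[OF _ _ GL])
      show "AE x in lborel. (\<lambda>n. d (x - h n)) \<longlonglongrightarrow> d x"
      proof (rule AE_I2)
        fix x
        have "(\<lambda>n. x - h n) \<longlonglongrightarrow> x - 0" by (intro tendsto_intros h)
        then show "(\<lambda>n. d (x - h n)) \<longlonglongrightarrow> d x"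
          using d(1) by (auto simp: continuous_on_eq_continuous_at intro: isCont_tendsto_compose[of _ d])
      qed
      show "AE x in lborel. cmod (d (x - h n)) \<le> cmod (G x)" for n
      proof (rule AE_I2)
        fix x
        show "cmod (d (x - h n)) \<le> cmod (G x)"
        proof (cases "norm x \<le> R + H")
          case True
          then show ?thesis using d(2)[of "x - h n"] B by (auto simp: G_def)
        next
          case False
          then have "norm (x - h n) > R" using H(2)[of n] norm_triangle_ineq2[of x "h n"] by linarith
          then show ?thesis by (simp add: d(3))
        qed
      qed
    qed auto
    obtain n0 where n0: "\<And>n. n \<ge> n0 \<Longrightarrow> l2n lborel (\<lambda>x. d (x - h n) - d x) < e'"
      using LIMSEQ_zero_less[OF dc e'] by blast
    show "\<exists>no. \<forall>n\<ge>no. dist (l2ip lborel u (\<lambda>x. u (x - h n))) (l2ip lborel u u) < e"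
    proof (intro exI allI impI)
      fix n assume n: "n \<ge> n0"
      let ?t = "\<lambda>x. u (x - h n)" and ?s = "\<lambda>x. d (x - h n)"
      have tL: "?t \<in> L2 lborel" and sL: "?s \<in> L2 lborel" by (intro L2_translate u d)+
      have ts: "l2n lborel (\<lambda>x. ?t x - ?s x) < e'"
        using L2_translate(2)[OF L2_diff[OF d(5) u], of "h n"] d(6) by (simp add: l2n_minus_commute[of _ ?t])
      have "l2n lborel (\<lambda>x. ?t x - u x) \<le> l2n lborel (\<lambda>x. ?t x - ?s x) +
          (l2n lborel (\<lambda>x. ?s x - d x) + l2n lborel (\<lambda>x. d x - u x))"
        using l2n_triangle_diff[OF tL sL u] l2n_triangle_diff[OF sL d(5) u] by linarith
      also have "\<dots> < 3 * e'" using ts n0[OF n] d(6) by linarith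
      finally have tu: "l2n lborel (\<lambda>x. ?t x - u x) < 3 * e'" .
      have "dist (l2ip lborel u ?t) (l2ip lborel u u) = cmod (l2ip lborel u (\<lambda>x. ?t x - u x))"
        by (simp add: dist_norm l2ip_diff_right tL u)
      also have "\<dots> \<le> l2n lborel u * l2n lborel (\<lambda>x. ?t x - u x)"
        by (intro l2_cauchy_schwarz u L2_diff tL)
      also have "\<dots> \<le> l2n lborel u * (3 * e')" using tu by (intro mult_left_mono) auto
      also have "\<dots> < (l2n lborel u + 1) * (3 * e')" using e' by (simp add: algebra_simps)
      also have "\<dots> = e" unfolding e'_def using un by (simp add: divide_simps del: distrib_left_numeral)
      finally show "dist (l2ip lborel u ?t) (l2ip lborel u u) < e" .
    qed
  qed
qed

section \<open>The Fourier transform on \<open>L\<^sup>2\<close>\<close>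

definition fourier_char :: "real \<Rightarrow> complex" where
  "fourier_char t = exp (- 2 * of_real pi * \<i> * of_real t)"

lemma fourier_char_measurable [measurable]: "fourier_char \<in> borel_measurable borel"
  unfolding fourier_char_def by measurable

lemma norm_fourier_char [simp]: "cmod (fourier_char t) = 1"
  by (simp add: fourier_char_def norm_exp_eq_Re)

lemma cnj_fourier_char: "cnj (fourier_char t) = fourier_char (- t)"
  by (simp add: fourier_char_def exp_cnj)

lemma fourier_char_0 [simp]: "fourier_char 0 = 1"
  by (simp add: fourier_char_def)

lemma fourier_char_add: "fourier_char (s + t) = fourier_char s * fourier_char t"
  by (simp add: fourier_char_def exp_add[symmetric] algebra_simps)

lemma fourier_char_sum: "fourier_char (\<Sum>i\<in>I. f i) = (\<Prod>i\<in>I. fourier_char (f i))"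
  by (induction I rule: infinite_finite_induct) (auto simp: fourier_char_add)

lemma fourier_L1_char: "fourier_L1 u \<xi> = (LINT x|lborel. fourier_char (x \<bullet> \<xi>) * u x)"
  by (simp add: fourier_L1_def fourier_char_def)

text \<open>The substitution \<open>y = c * x\<close> reduces the integral to the characteristic
  function of the standard normal distribution at \<open>s = - 2 * pi * t / c\<close>.\<close>

lemma gauss_fourier_real:
  assumes c: "c > 0"
  shows "(LINT x|lborel. fourier_char (t * x) * of_real (exp (- (c * x)\<^sup>2 / 2))) =
      of_real (sqrt (2 * pi) / c * exp (- (2 * pi * t / c)\<^sup>2 / 2))"
    and "integrable lborel (\<lambda>x. fourier_char (t * x) * of_real (exp (- (c * x)\<^sup>2 / 2)))"
proof -
  define s where "s = - 2 * pi * t / c"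
  define f where "f = (\<lambda>y. std_normal_density y *\<^sub>R iexp (s * y))"
  have "char std_normal_distribution s = (LINT y|lborel. f y)"
    unfolding char_def f_def by (subst integral_density) auto
  then have "(LINT y|lborel. f y) = of_real (exp (- (s\<^sup>2) / 2))"
    by (simp add: char_std_normal_distribution)
  moreover have "(LINT y|lborel. f y) = \<bar>c\<bar> *\<^sub>R (LINT x|lborel. f (0 + c * x))"
    using c by (intro lborel_integral_real_affine) auto
  moreover have fe: "f (0 + c * x) = of_real (1 / sqrt (2 * pi)) *
      (fourier_char (t * x) * of_real (exp (- (c * x)\<^sup>2 / 2)))" for x
  proof -
    have "iexp (s * (c * x)) = fourier_char (t * x)"
      using c by (simp add: s_def fourier_char_def mult_ac)
    then show ?thesis
      by (simp add: f_def std_normal_density_def scaleR_conv_of_real)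
  qed
  ultimately have "of_real c * (of_real (1 / sqrt (2 * pi)) *
      (LINT x|lborel. fourier_char (t * x) * of_real (exp (- (c * x)\<^sup>2 / 2)))) = of_real (exp (- (s\<^sup>2) / 2))"
    using c by (simp add: scaleR_conv_of_real)
  then have "(LINT x|lborel. fourier_char (t * x) * of_real (exp (- (c * x)\<^sup>2 / 2))) =
      of_real (sqrt (2 * pi) / c) * of_real (exp (- (s\<^sup>2) / 2))"
    using c by (simp add: field_simps)
  then show 1: "(LINT x|lborel. fourier_char (t * x) * of_real (exp (- (c * x)\<^sup>2 / 2))) =
      of_real (sqrt (2 * pi) / c * exp (- (2 * pi * t / c)\<^sup>2 / 2))"
    by (simp only: s_def) (simp add: power_divide power_mult_distrib)
  \<comment> \<open>A non-integrable function has integral 0 by convention, whereas the value just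
    computed is positive.\<close>
  show "integrable lborel (\<lambda>x. fourier_char (t * x) * of_real (exp (- (c * x)\<^sup>2 / 2)))"
    by (rule ccontr) (use 1 c in \<open>simp add: not_integrable_integral_eq\<close>)
qed

definition gauss :: "real \<Rightarrow> 'a::euclidean_space \<Rightarrow> real" where
  "gauss c x = exp (- (c * norm x)\<^sup>2 / 2)"

lemma gauss_measurable [measurable]: "gauss c \<in> borel_measurable borel"
  unfolding gauss_def by measurable

lemma gauss_bounds: "0 < gauss c x" "gauss c x \<le> 1"
  by (auto simp: gauss_def)

lemma gauss_prod: "gauss c x = (\<Prod>b\<in>Basis. exp (- (c * (x \<bullet> b))\<^sup>2 / 2))"
proof -
  have "(norm x)\<^sup>2 = (\<Sum>b\<in>Basis. (x \<bullet> b)\<^sup>2)"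
    unfolding power2_norm_eq_inner by (subst euclidean_inner) (simp add: power2_eq_square)
  then have "- (c * norm x)\<^sup>2 / 2 = (\<Sum>b\<in>Basis. - (c * (x \<bullet> b))\<^sup>2 / 2)"
    by (simp add: power_mult_distrib sum_distrib_left sum_negf sum_divide_distrib)
  then show ?thesis by (simp add: gauss_def exp_sum)
qed

text \<open>Character and Gaussian both factor over the coordinates, and Lebesgue measure is the
  image of the product measure under \<open>?S\<close>.\<close>

lemma gauss_fourier:
  fixes x :: "'a::euclidean_space"
  assumes c: "c > 0"
  shows "(LINT \<xi>|lborel. fourier_char (x \<bullet> \<xi>) * of_real (gauss c \<xi>)) =
      of_real ((sqrt (2 * pi) / c) ^ DIM('a) * gauss (2 * pi / c) x)"
proof -
  interpret product_sigma_finite "\<lambda>b::'a. lborel :: real measure" ..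
  let ?f = "\<lambda>b y. fourier_char ((x \<bullet> b) * y) * complex_of_real (exp (- (c * y)\<^sup>2 / 2))"
  let ?S = "\<lambda>f. \<Sum>b\<in>Basis. f b *\<^sub>R (b::'a)"
  have S: "?S f \<bullet> b = f b" if "b \<in> Basis" for f b
    using that by (simp add: inner_sum_left inner_Basis if_distrib cong: if_cong)
  have *: "fourier_char (x \<bullet> ?S f) * of_real (gauss c (?S f)) = (\<Prod>b\<in>Basis. ?f b (f b))" for f
  proof -
    have "fourier_char (x \<bullet> ?S f) = (\<Prod>b\<in>Basis. fourier_char ((x \<bullet> b) * f b))"
      by (simp add: inner_sum_right mult.commute fourier_char_sum)
    moreover have "complex_of_real (gauss c (?S f)) = (\<Prod>b\<in>Basis. complex_of_real (exp (- (c * f b)\<^sup>2 / 2)))"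
      unfolding gauss_prod of_real_prod by (rule prod.cong) (auto simp: S)
    ultimately show ?thesis by (simp add: prod.distrib)
  qed
  have "(LINT \<xi>|lborel. fourier_char (x \<bullet> \<xi>) * of_real (gauss c \<xi>)) =
      (LINT f|(\<Pi>\<^sub>M b\<in>Basis. lborel). fourier_char (x \<bullet> ?S f) * of_real (gauss c (?S f)))"
    by (subst lborel_eq, subst integral_distr) auto
  also have "\<dots> = (\<Prod>b\<in>Basis. LINT y|lborel. ?f b y)"
    unfolding * by (rule product_integral_prod) (simp, rule gauss_fourier_real(2)[OF c])
  also have "\<dots> = (\<Prod>b\<in>Basis. of_real (sqrt (2 * pi) / c * exp (- (2 * pi / c * (x \<bullet> b))\<^sup>2 / 2)))"
    using c by (intro prod.cong refl) (subst gauss_fourier_real, auto)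
  also have "\<dots> = of_real ((sqrt (2 * pi) / c) ^ DIM('a) * gauss (2 * pi / c) x)"
    unfolding of_real_prod[symmetric] gauss_prod prod.distrib prod_constant by simp
  finally show ?thesis .
qed

lemma gauss_integrable:
  assumes c: "c > 0"
  shows "integrable lborel (gauss c :: 'a::euclidean_space \<Rightarrow> real)"
proof -
  have "(LINT \<xi>|lborel. complex_of_real (gauss c (\<xi>::'a))) \<noteq> 0"
    using gauss_fourier[OF c, of "0::'a"] c by (simp add: fourier_char_def gauss_def)
  then have "integrable lborel (\<lambda>\<xi>. complex_of_real (gauss c (\<xi>::'a)))"
    using not_integrable_integral_eq by blast
  then show ?thesis by (simp add: complex_of_real_integrable_eq)
qed

lemma integrable_pair_bound:
  fixes f :: "'a::euclidean_space \<times> 'b::euclidean_space \<Rightarrow> complex"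
  assumes [measurable]: "f \<in> borel_measurable (lborel \<Otimes>\<^sub>M lborel)"
    and g: "integrable lborel g" and h: "integrable lborel h"
    and b: "\<And>x y. cmod (f (x, y)) \<le> g x * h y"
  shows "integrable (lborel \<Otimes>\<^sub>M lborel) f"
proof (rule Bochner_Integration.integrable_bound)
  note [measurable] = borel_measurable_integrable[OF g, simplified] borel_measurable_integrable[OF h, simplified]
  show "integrable (lborel \<Otimes>\<^sub>M lborel) (\<lambda>z. g (fst z) * h (snd z))"
    by (rule lborel_pair.Fubini_integrable) (use g h in \<open>auto simp: abs_mult\<close>)
  show "AE z in lborel \<Otimes>\<^sub>M lborel. norm (f z) \<le> norm (g (fst z) * h (snd z))"
  proof (rule AE_I2)
    fix z show "norm (f z) \<le> norm (g (fst z) * h (snd z))"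
      using b[of "fst z" "snd z"] by simp
  qed
qed fact

lemma fourier_L1_measurable [measurable (raw)]:
  fixes u :: "'b \<Rightarrow> 'a::euclidean_space \<Rightarrow> complex"
  assumes [measurable]: "(\<lambda>(w, x). u w x) \<in> borel_measurable (M \<Otimes>\<^sub>M borel)" "g \<in> borel_measurable M"
  shows "(\<lambda>w. fourier_L1 (u w) (g w)) \<in> borel_measurable M"
proof -
  have [measurable]: "(\<lambda>(w, x). u w x) \<in> borel_measurable (M \<Otimes>\<^sub>M lborel)"
    using assms(1) by (subst measurable_cong_sets[OF sets_pair_measure_cong[OF refl sets_lborel] refl])
  show ?thesis unfolding fourier_L1_char by measurable
qed

lemma fourier_L1_bound: "cmod (fourier_L1 u \<xi>) \<le> (LINT x|lborel. cmod (u x))"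
  unfolding fourier_L1_char
  using integral_norm_bound[of lborel "\<lambda>x. fourier_char (x \<bullet> \<xi>) * u x"] by (simp add: norm_mult)

text \<open>Fubini, as the kernel is symmetric in its two arguments. Its extension to L2,
  \<open>fourier_mult_formula_L2\<close>, yields surjectivity of the transform.\<close>

lemma fourier_mult_formula:
  fixes f g :: "'a::euclidean_space \<Rightarrow> complex"
  assumes f: "integrable lborel f" and g: "integrable lborel g"
  shows "(LINT \<xi>|lborel. fourier_L1 f \<xi> * g \<xi>) = (LINT x|lborel. f x * fourier_L1 g x)"
proof -
  note [measurable] = borel_measurable_integrable[OF f, simplified] borel_measurable_integrable[OF g, simplified]
  have int: "integrable (lborel \<Otimes>\<^sub>M lborel) (\<lambda>(x, \<xi>). fourier_char (x \<bullet> \<xi>) * f x * g \<xi>)"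
    by (rule integrable_pair_bound[where g="\<lambda>x. cmod (f x)" and h="\<lambda>x. cmod (g x)"])
      (use f g in \<open>auto simp: norm_mult\<close>)
  have "(LINT \<xi>|lborel. fourier_L1 f \<xi> * g \<xi>) =
      (LINT \<xi>|lborel. LINT x|lborel. fourier_char (x \<bullet> \<xi>) * f x * g \<xi>)"
    by (simp add: fourier_L1_char)
  also have "\<dots> = (LINT x|lborel. LINT \<xi>|lborel. fourier_char (x \<bullet> \<xi>) * f x * g \<xi>)"
    by (rule lborel_pair.Fubini_integral[OF int])
  also have "\<dots> = (LINT x|lborel. LINT \<xi>|lborel. f x * (fourier_char (\<xi> \<bullet> x) * g \<xi>))"
    by (simp add: mult_ac inner_commute)
  also have "\<dots> = (LINT x|lborel. f x * fourier_L1 g x)"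
    by (simp add: fourier_L1_char)
  finally show ?thesis .
qed

lemma lborel_integral_affine:
  fixes F :: "'a::euclidean_space \<Rightarrow> complex"
  assumes [measurable]: "F \<in> borel_measurable borel" and c: "c \<noteq> 0"
  shows "(LINT y|lborel. F y) = (LINT t|lborel. (\<bar>c\<bar> ^ DIM('a)) *\<^sub>R F (x + c *\<^sub>R t))"
proof -
  let ?T = "\<lambda>t::'a. x + c *\<^sub>R t"
  have "(LINT y|lborel. F y) = (LINT y|density (distr lborel borel ?T) (\<lambda>_. ennreal (\<bar>c\<bar> ^ DIM('a))). F y)"
    by (rule arg_cong[OF lborel_affine[OF c, of x]])
  also have "\<dots> = (LINT y|distr lborel borel ?T. (\<bar>c\<bar> ^ DIM('a)) *\<^sub>R F y)"
    by (rule integral_density) auto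
  also have "\<dots> = (LINT t|lborel. (\<bar>c\<bar> ^ DIM('a)) *\<^sub>R F (?T t))"
    by (rule integral_distr) auto
  finally show ?thesis .
qed

text \<open>The Gaussian factor makes everything absolutely integrable. The multiplication formula
  moves the transform to \<open>g\<close>, the damped conjugate of the transform of
  \<open>s\<close>, and the transform of \<open>g\<close> is a Gaussian mean of translates of
  \<open>cnj s\<close>. The right-hand side is thus a mean of autocorrelations of \<open>s\<close>
  at the shifts \<open>c *\<^sub>R t\<close>, with a weight that does not depend on
  \<open>c\<close>, so that \<open>c\<close> can tend to 0.\<close>

lemma fourier_gauss_identity:
  fixes s :: "'a::euclidean_space \<Rightarrow> complex"
  assumes s: "integrable lborel s" and s2: "s \<in> L2 lborel" and c: "c > 0"
  shows "(LINT \<xi>|lborel. of_real (gauss c \<xi> * (cmod (fourier_L1 s \<xi>))\<^sup>2)) =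
    (LINT t|lborel. of_real (sqrt (2 * pi) ^ DIM('a) * gauss (2 * pi) t) * l2ip lborel s (\<lambda>x. s (x - c *\<^sub>R t)))"
proof -
  note [measurable] = borel_measurable_integrable[OF s, simplified]
  note gi = gauss_integrable[OF c, where 'a='a]
  define \<Phi> where "\<Phi> = (\<lambda>t::'a. sqrt (2 * pi) ^ DIM('a) * gauss (2 * pi) t)"
  have [measurable]: "\<Phi> \<in> borel_measurable borel" unfolding \<Phi>_def by measurable
  have \<Phi>i: "integrable lborel \<Phi>" unfolding \<Phi>_def by (intro integrable_mult_right gauss_integrable) auto
  have \<Phi>0: "0 \<le> \<Phi> t" for t using gauss_bounds(1)[of "2 * pi" t] by (simp add: \<Phi>_def)
  define g where "g = (\<lambda>\<xi>. of_real (gauss c \<xi>) * cnj (fourier_L1 s \<xi>))"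
  have [measurable]: "g \<in> borel_measurable borel" unfolding g_def by measurable
  have g: "integrable lborel g"
  proof (rule Bochner_Integration.integrable_bound)
    show "integrable lborel (\<lambda>\<xi>::'a. gauss c \<xi> * (LINT x|lborel. cmod (s x)))"
      using gi by auto
    have "cmod (g \<xi>) \<le> \<bar>gauss c \<xi>\<bar> * \<bar>LINT x|lborel. cmod (s x)\<bar>" for \<xi>
      unfolding g_def norm_mult norm_of_real complex_mod_cnj
      by (rule mult_left_mono[OF order_trans[OF fourier_L1_bound abs_ge_self]]) auto
    then show "AE \<xi> in lborel. norm (g \<xi>) \<le> norm (gauss c \<xi> * (LINT x|lborel. cmod (s x)))"
      by (simp add: abs_mult)
  qed measurable
  have gh: "fourier_L1 g x = (LINT t|lborel. of_real (\<Phi> t) * cnj (s (x - c *\<^sub>R t)))" for x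
  proof -
    have int: "integrable (lborel \<Otimes>\<^sub>M lborel)
        (\<lambda>(y, \<xi>). fourier_char ((x - y) \<bullet> \<xi>) * of_real (gauss c \<xi>) * cnj (s y))"
      by (rule integrable_pair_bound[where g="\<lambda>x. cmod (s x)" and h="gauss c"])
        (use s gi in \<open>auto simp: norm_mult abs_of_pos[OF gauss_bounds(1)] mult.commute\<close>)
    have conj: "cnj (fourier_L1 s \<xi>) = (LINT y|lborel. fourier_char (- (y \<bullet> \<xi>)) * cnj (s y))" for \<xi>
      unfolding fourier_L1_char Bochner_Integration.integral_cnj[symmetric]
      by (simp only: complex_cnj_mult cnj_fourier_char)
    have split: "fourier_char ((x - y) \<bullet> \<xi>) * of_real (gauss c \<xi>) * cnj (s y) =
        fourier_char (\<xi> \<bullet> x) * of_real (gauss c \<xi>) * (fourier_char (- (y \<bullet> \<xi>)) * cnj (s y))" for y \<xi>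
    proof -
      have "fourier_char ((x - y) \<bullet> \<xi>) = fourier_char (\<xi> \<bullet> x) * fourier_char (- (y \<bullet> \<xi>))"
        by (simp add: fourier_char_add[symmetric] inner_diff_right inner_commute)
      then show ?thesis by simp
    qed
    have "fourier_L1 g x = (LINT \<xi>|lborel. LINT y|lborel. fourier_char ((x - y) \<bullet> \<xi>) * of_real (gauss c \<xi>) * cnj (s y))"
      unfolding split integral_mult_right_zero conj[symmetric] fourier_L1_char[of g]
      by (simp only: g_def mult.assoc)
    also have "\<dots> = (LINT y|lborel. LINT \<xi>|lborel. fourier_char ((x - y) \<bullet> \<xi>) * of_real (gauss c \<xi>) * cnj (s y))"
      by (rule lborel_pair.Fubini_integral[OF int])
    also have "\<dots> = (LINT y|lborel. of_real ((sqrt (2 * pi) / c) ^ DIM('a) * gauss (2 * pi / c) (x - y)) * cnj (s y))"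
      by (simp only: integral_mult_left_zero gauss_fourier[OF c])
    \<comment> \<open>Substituting \<open>y = x - c *\<^sub>R t\<close> absorbs the power of
      \<open>c\<close> in front and frees the Gaussian of \<open>c\<close>.\<close>
    also have "\<dots> = (LINT t|lborel. (\<bar>- c\<bar> ^ DIM('a)) *\<^sub>R
        (of_real ((sqrt (2 * pi) / c) ^ DIM('a) * gauss (2 * pi / c) (x - (x + (- c) *\<^sub>R t))) * cnj (s (x + (- c) *\<^sub>R t))))"
      using c by (intro lborel_integral_affine) auto
    also have "\<dots> = (LINT t|lborel. of_real (\<Phi> t) * cnj (s (x - c *\<^sub>R t)))"
    proof (rule Bochner_Integration.integral_cong[OF refl])
      fix t :: 'a
      have "gauss (2 * pi / c) (c *\<^sub>R t) = gauss (2 * pi) t" using c by (simp add: gauss_def power_mult_distrib)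
      then show "(\<bar>- c\<bar> ^ DIM('a)) *\<^sub>R (of_real ((sqrt (2 * pi) / c) ^ DIM('a) *
          gauss (2 * pi / c) (x - (x + (- c) *\<^sub>R t))) * cnj (s (x + (- c) *\<^sub>R t))) =
          of_real (\<Phi> t) * cnj (s (x - c *\<^sub>R t))"
        using c by (simp add: \<Phi>_def scaleR_conv_of_real power_divide)
    qed
    finally show ?thesis .
  qed
  have cs: "(LINT x|lborel. cmod (s x) * cmod (s (x - c *\<^sub>R t))) \<le> l2n lborel s * l2n lborel s" for t
    using l2_cauchy_schwarz_abs[OF s2 L2_translate(1)[OF s2, of "c *\<^sub>R t"]] L2_translate(2)[OF s2, of "c *\<^sub>R t"] by simp
  have int: "integrable (lborel \<Otimes>\<^sub>M lborel) (\<lambda>(t, x). of_real (\<Phi> t) * (s x * cnj (s (x - c *\<^sub>R t))))"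
  proof (rule lborel_pair.Fubini_integrable)
    show "AE t in lborel. integrable lborel (\<lambda>x. case (t, x) of (t, x) \<Rightarrow> of_real (\<Phi> t) * (s x * cnj (s (x - c *\<^sub>R t))))"
      by (auto intro!: l2ip_integrable s2 L2_translate)
    show "integrable lborel (\<lambda>t. LINT x|lborel. norm (case (t, x) of (t, x) \<Rightarrow> of_real (\<Phi> t) * (s x * cnj (s (x - c *\<^sub>R t)))))"
    proof (rule Bochner_Integration.integrable_bound)
      show "integrable lborel (\<lambda>t. \<Phi> t * (l2n lborel s * l2n lborel s))" using \<Phi>i by auto
      show "AE t in lborel. norm (LINT x|lborel. norm (case (t, x) of (t, x) \<Rightarrow> of_real (\<Phi> t) * (s x * cnj (s (x - c *\<^sub>R t))))) \<le>
          norm (\<Phi> t * (l2n lborel s * l2n lborel s))"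
        using \<Phi>0 by (auto simp: norm_mult abs_mult intro!: mult_left_mono order_trans[OF cs])
    qed measurable
  qed measurable
  have "(LINT \<xi>|lborel. of_real (gauss c \<xi> * (cmod (fourier_L1 s \<xi>))\<^sup>2)) = (LINT \<xi>|lborel. fourier_L1 s \<xi> * g \<xi>)"
    by (intro Bochner_Integration.integral_cong refl)
      (simp add: g_def complex_norm_square[unfolded of_real_power] mult_ac)
  also have "\<dots> = (LINT x|lborel. s x * fourier_L1 g x)"
    by (rule fourier_mult_formula[OF s g])
  also have "\<dots> = (LINT x|lborel. LINT t|lborel. of_real (\<Phi> t) * (s x * cnj (s (x - c *\<^sub>R t))))"
    by (simp add: gh mult.left_commute flip: integral_mult_right_zero)
  also have "\<dots> = (LINT t|lborel. LINT x|lborel. of_real (\<Phi> t) * (s x * cnj (s (x - c *\<^sub>R t))))"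
    by (rule lborel_pair.Fubini_integral[OF int])
  also have "\<dots> = (LINT t|lborel. of_real (\<Phi> t) * l2ip lborel s (\<lambda>x. s (x - c *\<^sub>R t)))"
    by (simp add: l2ip_def)
  finally show ?thesis by (simp add: \<Phi>_def)
qed

text \<open>Let \<open>c\<close> tend to 0 in \<open>fourier_gauss_identity\<close>. The left-hand
  side increases to the integral of the squared transform; the right-hand side tends to the squared
  norm of \<open>s\<close>, because autocorrelations are continuous at 0 and the weight \<Phi> has
  total mass 1.\<close>

theorem plancherel_L1_L2:
  fixes s :: "'a::euclidean_space \<Rightarrow> complex"
  assumes s: "integrable lborel s" and s2: "s \<in> L2 lborel"
  shows "fourier_L1 s \<in> L2 lborel" "l2n lborel (fourier_L1 s) = l2n lborel s"
proof -
  note [measurable] = borel_measurable_integrable[OF s, simplified]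
  define \<Phi> where "\<Phi> = (\<lambda>t::'a. sqrt (2 * pi) ^ DIM('a) * gauss (2 * pi) t)"
  have [measurable]: "\<Phi> \<in> borel_measurable borel" unfolding \<Phi>_def by measurable
  have \<Phi>i: "integrable lborel \<Phi>" unfolding \<Phi>_def by (intro integrable_mult_right gauss_integrable) auto
  have \<Phi>0: "0 \<le> \<Phi> t" for t using gauss_bounds(1)[of "2 * pi" t] by (simp add: \<Phi>_def)
  have \<Phi>1: "(LINT t|lborel. complex_of_real (\<Phi> t)) = 1"
  proof -
    have "(LINT t|lborel. complex_of_real (gauss (2 * pi) (t::'a))) =
        of_real ((sqrt (2 * pi) / (2 * pi)) ^ DIM('a))"
      using gauss_fourier[of "2 * pi" "0::'a"] by (simp add: fourier_char_def gauss_def)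
    then have "(LINT t|lborel. complex_of_real (\<Phi> t)) =
        of_real (sqrt (2 * pi) ^ DIM('a) * (sqrt (2 * pi) / (2 * pi)) ^ DIM('a))"
      by (simp add: \<Phi>_def)
    also have "sqrt (2 * pi) ^ DIM('a) * (sqrt (2 * pi) / (2 * pi)) ^ DIM('a) = 1"
      by (simp flip: power_mult_distrib)
    finally show ?thesis by simp
  qed
  \<comment> \<open>A decreasing sequence makes \<open>gauss (c n)\<close> increase to 1. Monotone
    convergence then also shows that the transform is square integrable.\<close>
  define c where "c n = 1 / real (Suc n)" for n
  have c: "c n > 0" for n by (simp add: c_def)
  have c0: "c \<longlonglongrightarrow> 0" unfolding c_def by (rule LIMSEQ_Suc[OF lim_1_over_n])
  have cdec: "c (Suc n) \<le> c n" for n by (simp add: c_def field_simps)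
  let ?F = "\<lambda>n \<xi>. gauss (c n) \<xi> * (cmod (fourier_L1 s \<xi>))\<^sup>2"
  have Fi: "integrable lborel (?F n)" for n
  proof (rule Bochner_Integration.integrable_bound)
    show "integrable lborel (\<lambda>\<xi>::'a. gauss (c n) \<xi> * (LINT x|lborel. cmod (s x))\<^sup>2)"
      using gauss_integrable[OF c[of n]] by auto
    show "AE \<xi> in lborel. norm (?F n \<xi>) \<le> norm (gauss (c n) \<xi> * (LINT x|lborel. cmod (s x))\<^sup>2)"
      by (auto simp: abs_mult intro!: mult_left_mono power_mono fourier_L1_bound)
  qed measurable
  have "(\<lambda>n. LINT t|lborel. of_real (\<Phi> t) * l2ip lborel s (\<lambda>x. s (x - c n *\<^sub>R t))) \<longlonglongrightarrow>
      (LINT t|lborel. of_real (\<Phi> t) * l2ip lborel s s)"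
  proof (rule integral_dominated_convergence[where w="\<lambda>t. \<Phi> t * (l2n lborel s * l2n lborel s)"])
    show "AE t in lborel. (\<lambda>n. of_real (\<Phi> t) * l2ip lborel s (\<lambda>x. s (x - c n *\<^sub>R t))) \<longlonglongrightarrow> of_real (\<Phi> t) * l2ip lborel s s"
    proof (intro AE_I2 tendsto_intros L2_translate_weakly_continuous s2)
      fix t :: 'a
      have "(\<lambda>n. c n *\<^sub>R t) \<longlonglongrightarrow> 0 *\<^sub>R t" by (intro tendsto_intros c0)
      then show "(\<lambda>n. c n *\<^sub>R t) \<longlonglongrightarrow> 0" by simp
    qed
    show "AE t in lborel. norm (of_real (\<Phi> t) * l2ip lborel s (\<lambda>x. s (x - c n *\<^sub>R t))) \<le> \<Phi> t * (l2n lborel s * l2n lborel s)" for n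
    proof (rule AE_I2)
      fix t
      have "cmod (l2ip lborel s (\<lambda>x. s (x - c n *\<^sub>R t))) \<le> l2n lborel s * l2n lborel s"
        using l2_cauchy_schwarz[OF s2 L2_translate(1)[OF s2]] L2_translate(2)[OF s2] by metis
      then show "norm (of_real (\<Phi> t) * l2ip lborel s (\<lambda>x. s (x - c n *\<^sub>R t))) \<le> \<Phi> t * (l2n lborel s * l2n lborel s)"
        using \<Phi>0[of t] by (simp add: norm_mult mult_left_mono)
    qed
    show "(\<lambda>t. of_real (\<Phi> t) * l2ip lborel s (\<lambda>x. s (x - c n *\<^sub>R t))) \<in> borel_measurable lborel" for n
      unfolding l2ip_def by measurable
    show "integrable lborel (\<lambda>t. \<Phi> t * (l2n lborel s * l2n lborel s))" using \<Phi>i by auto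
  qed auto
  also have "(LINT t|lborel. of_real (\<Phi> t) * l2ip lborel s s) = of_real ((l2n lborel s)\<^sup>2)"
    unfolding integral_mult_left_zero \<Phi>1 l2ip_self by simp
  finally have "(\<lambda>n. complex_of_real (LINT \<xi>|lborel. ?F n \<xi>)) \<longlonglongrightarrow> of_real ((l2n lborel s)\<^sup>2)"
    unfolding \<Phi>_def fourier_gauss_identity[OF s s2 c, symmetric] integral_complex_of_real .
  then have lim: "(\<lambda>n. LINT \<xi>|lborel. ?F n \<xi>) \<longlonglongrightarrow> (l2n lborel s)\<^sup>2"
    by (simp only: tendsto_of_real_iff)
  have mono: "incseq (\<lambda>n \<xi>. ennreal (?F n \<xi>))"
  proof (intro incseq_SucI le_funI ennreal_leI mult_right_mono)
    fix n and \<xi> :: 'a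
    have "(c (Suc n) * norm \<xi>)\<^sup>2 \<le> (c n * norm \<xi>)\<^sup>2"
      using c[of "Suc n"] by (intro power_mono mult_right_mono cdec) auto
    then show "gauss (c n) \<xi> \<le> gauss (c (Suc n)) \<xi>" by (simp add: gauss_def)
  qed auto
  have sup: "(SUP n. ennreal (?F n \<xi>)) = ennreal ((cmod (fourier_L1 s \<xi>))\<^sup>2)" for \<xi>
  proof (rule LIMSEQ_unique)
    show "(\<lambda>n. ennreal (?F n \<xi>)) \<longlonglongrightarrow> (SUP n. ennreal (?F n \<xi>))"
      using mono by (intro LIMSEQ_SUP) (auto simp: incseq_def le_fun_def)
    have "(\<lambda>n. ?F n \<xi>) \<longlonglongrightarrow> exp (- (0 * norm \<xi>)\<^sup>2 / 2) * (cmod (fourier_L1 s \<xi>))\<^sup>2"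
      unfolding gauss_def by (intro tendsto_intros c0) auto
    then show "(\<lambda>n. ennreal (?F n \<xi>)) \<longlonglongrightarrow> ennreal ((cmod (fourier_L1 s \<xi>))\<^sup>2)"
      by (intro tendsto_ennrealI) simp
  qed
  have "(\<integral>\<^sup>+\<xi>. ennreal ((cmod (fourier_L1 s \<xi>))\<^sup>2) \<partial>lborel) = (SUP n. \<integral>\<^sup>+\<xi>. ennreal (?F n \<xi>) \<partial>lborel)"
    unfolding sup[symmetric] using mono by (intro nn_integral_monotone_convergence_SUP) auto
  also have "\<dots> = ennreal ((l2n lborel s)\<^sup>2)"
  proof (rule LIMSEQ_unique)
    show "(\<lambda>n. \<integral>\<^sup>+\<xi>. ennreal (?F n \<xi>) \<partial>lborel) \<longlonglongrightarrow> (SUP n. \<integral>\<^sup>+\<xi>. ennreal (?F n \<xi>) \<partial>lborel)"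
      using mono by (intro LIMSEQ_SUP) (auto simp: incseq_def le_fun_def intro!: nn_integral_mono)
    have "(\<integral>\<^sup>+\<xi>. ennreal (?F n \<xi>) \<partial>lborel) = ennreal (LINT \<xi>|lborel. ?F n \<xi>)" for n
      using Fi[of n] by (intro nn_integral_eq_integral) (auto simp: gauss_bounds less_imp_le)
    then show "(\<lambda>n. \<integral>\<^sup>+\<xi>. ennreal (?F n \<xi>) \<partial>lborel) \<longlonglongrightarrow> ennreal ((l2n lborel s)\<^sup>2)"
      using lim by (simp add: tendsto_ennrealI)
  qed
  finally have eq: "(\<integral>\<^sup>+\<xi>. ennreal ((cmod (fourier_L1 s \<xi>))\<^sup>2) \<partial>lborel) = ennreal ((l2n lborel s)\<^sup>2)" .
  show L: "fourier_L1 s \<in> L2 lborel"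
    by (rule L2_nnI) (use eq in auto)
  have "(l2n lborel (fourier_L1 s))\<^sup>2 = (l2n lborel s)\<^sup>2"
    using eq by (simp add: nn_integral_l2n[OF L])
  then show "l2n lborel (fourier_L1 s) = l2n lborel s" by (simp add: power2_eq_iff_nonneg)
qed

section \<open>Extension of the transform to L2\<close>

lemma fourier_L1_lincomb:
  fixes f g :: "'a::euclidean_space \<Rightarrow> complex"
  assumes "integrable lborel f" "integrable lborel g"
  shows "fourier_L1 (\<lambda>x. f x + c * g x) = (\<lambda>\<xi>. fourier_L1 f \<xi> + c * fourier_L1 g \<xi>)"
proof
  fix \<xi> :: 'a
  have int: "integrable lborel (\<lambda>x. fourier_char (x \<bullet> \<xi>) * h x)" if "integrable lborel h" for h
    by (rule Bochner_Integration.integrable_bound[OF that])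
      (use borel_measurable_integrable[OF that] in \<open>auto simp: norm_mult\<close>)
  have "fourier_L1 (\<lambda>x. f x + c * g x) \<xi> =
      (LINT x|lborel. fourier_char (x \<bullet> \<xi>) * f x + c * (fourier_char (x \<bullet> \<xi>) * g x))"
    by (simp add: fourier_L1_char algebra_simps)
  also have "\<dots> = fourier_L1 f \<xi> + c * fourier_L1 g \<xi>"
    using int[OF assms(1)] int[OF assms(2)] by (simp add: fourier_L1_char)
  finally show "fourier_L1 (\<lambda>x. f x + c * g x) \<xi> = fourier_L1 f \<xi> + c * fourier_L1 g \<xi>" .
qed

lemma is_fourier_L2_iff:
  "is_fourier_L2 u h \<longleftrightarrow> u \<in> L2 lborel \<and> h \<in> L2 lborel \<and>
     (\<exists>s. (\<forall>k. integrable lborel (s k) \<and> s k \<in> L2 lborel) \<and>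
        (\<lambda>k. l2n lborel (\<lambda>x. s k x - u x)) \<longlonglongrightarrow> 0 \<and>
        (\<lambda>k. l2n lborel (\<lambda>\<xi>. fourier_L1 (s k) \<xi> - h \<xi>)) \<longlonglongrightarrow> 0)"
proof -
  have "(\<lambda>k. \<integral>\<^sup>+x. ennreal ((cmod (s k x - u x))\<^sup>2) \<partial>lborel) \<longlonglongrightarrow> 0 \<longleftrightarrow>
        (\<lambda>k. l2n lborel (\<lambda>x. s k x - u x)) \<longlonglongrightarrow> 0"
    and "(\<lambda>k. \<integral>\<^sup>+\<xi>. ennreal ((cmod (fourier_L1 (s k) \<xi> - h \<xi>))\<^sup>2) \<partial>lborel) \<longlonglongrightarrow> 0 \<longleftrightarrow>
        (\<lambda>k. l2n lborel (\<lambda>\<xi>. fourier_L1 (s k) \<xi> - h \<xi>)) \<longlonglongrightarrow> 0"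
    if "u \<in> L2 lborel" "h \<in> L2 lborel" "\<forall>k. integrable lborel (s k) \<and> s k \<in> L2 lborel" for s :: "nat \<Rightarrow> 'a \<Rightarrow> complex"
    using that by (auto intro!: nn_tendsto_iff_l2n L2_diff plancherel_L1_L2(1))
  then show ?thesis unfolding is_fourier_L2_def by blast
qed

lemma is_fourier_L2_L1: "integrable lborel s \<Longrightarrow> s \<in> L2 lborel \<Longrightarrow> is_fourier_L2 s (fourier_L1 s)"
  unfolding is_fourier_L2_iff
  by (intro conjI plancherel_L1_L2(1) exI[of _ "\<lambda>_. s"]) (auto simp: l2n_def)

lemma is_fourier_L2_L2:
  assumes "is_fourier_L2 u h"
  shows "u \<in> L2 lborel" "h \<in> L2 lborel"
  using assms by (auto simp: is_fourier_L2_iff)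

lemma is_fourier_L2_norm:
  assumes "is_fourier_L2 u h"
  shows "l2n lborel h = l2n lborel u"
proof -
  obtain s where u: "u \<in> L2 lborel" and h: "h \<in> L2 lborel"
    and s: "\<And>k. integrable lborel (s k)" "\<And>k. s k \<in> L2 lborel"
    and l: "(\<lambda>k. l2n lborel (\<lambda>x. s k x - u x)) \<longlonglongrightarrow> 0" "(\<lambda>k. l2n lborel (\<lambda>\<xi>. fourier_L1 (s k) \<xi> - h \<xi>)) \<longlonglongrightarrow> 0"
    using assms unfolding is_fourier_L2_iff by blast
  have "(\<lambda>k. l2n lborel (fourier_L1 (s k))) \<longlonglongrightarrow> l2n lborel h"
    by (intro l2n_tendsto plancherel_L1_L2(1) s h l)
  moreover have "(\<lambda>k. l2n lborel (s k)) \<longlonglongrightarrow> l2n lborel u"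
    by (intro l2n_tendsto s u l)
  ultimately show ?thesis
    using plancherel_L1_L2(2)[OF s] LIMSEQ_unique by auto
qed

lemma is_fourier_L2_lincomb:
  assumes "is_fourier_L2 u h" "is_fourier_L2 w k"
  shows "is_fourier_L2 (\<lambda>x. u x + c * w x) (\<lambda>\<xi>. h \<xi> + c * k \<xi>)"
proof -
  obtain s where u: "u \<in> L2 lborel" and h: "h \<in> L2 lborel"
    and s: "\<And>k. integrable lborel (s k)" "\<And>k. s k \<in> L2 lborel"
    and ls: "(\<lambda>k. l2n lborel (\<lambda>x. s k x - u x)) \<longlonglongrightarrow> 0" "(\<lambda>k. l2n lborel (\<lambda>\<xi>. fourier_L1 (s k) \<xi> - h \<xi>)) \<longlonglongrightarrow> 0"
    using assms(1) unfolding is_fourier_L2_iff by blast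
  obtain t where w: "w \<in> L2 lborel" and k: "k \<in> L2 lborel"
    and t: "\<And>k. integrable lborel (t k)" "\<And>k. t k \<in> L2 lborel"
    and lt: "(\<lambda>k. l2n lborel (\<lambda>x. t k x - w x)) \<longlonglongrightarrow> 0" "(\<lambda>j. l2n lborel (\<lambda>\<xi>. fourier_L1 (t j) \<xi> - k \<xi>)) \<longlonglongrightarrow> 0"
    using assms(2) unfolding is_fourier_L2_iff by blast
  have lim: "(\<lambda>j. l2n lborel (\<lambda>x. (a j x + c * b j x) - (A x + c * B x))) \<longlonglongrightarrow> 0"
    if L: "\<And>j. a j \<in> L2 lborel" "\<And>j. b j \<in> L2 lborel" "A \<in> L2 lborel" "B \<in> L2 lborel"
      and l: "(\<lambda>j. l2n lborel (\<lambda>x. a j x - A x)) \<longlonglongrightarrow> 0" "(\<lambda>j. l2n lborel (\<lambda>x. b j x - B x)) \<longlonglongrightarrow> 0"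
    for a b :: "nat \<Rightarrow> 'a \<Rightarrow> complex" and A B
  proof (rule Lim_null_comparison)
    show "\<forall>\<^sub>F j in sequentially. norm (l2n lborel (\<lambda>x. (a j x + c * b j x) - (A x + c * B x))) \<le>
        l2n lborel (\<lambda>x. a j x - A x) + cmod c * l2n lborel (\<lambda>x. b j x - B x)"
    proof (intro always_eventually allI)
      fix j
      have "(\<lambda>x. (a j x + c * b j x) - (A x + c * B x)) = (\<lambda>x. (a j x - A x) + c * (b j x - B x))"
        by (simp add: algebra_simps)
      then show "norm (l2n lborel (\<lambda>x. (a j x + c * b j x) - (A x + c * B x))) \<le>
          l2n lborel (\<lambda>x. a j x - A x) + cmod c * l2n lborel (\<lambda>x. b j x - B x)"
        using l2n_triangle[OF L2_diff[OF L(1)[of j] L(3)] L2_cmult[OF L2_diff[OF L(2)[of j] L(4)], of c]]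
        by (simp add: l2n_cmult)
    qed
    have "(\<lambda>j. l2n lborel (\<lambda>x. a j x - A x) + cmod c * l2n lborel (\<lambda>x. b j x - B x)) \<longlonglongrightarrow> 0 + cmod c * 0"
      by (intro tendsto_intros l)
    then show "(\<lambda>j. l2n lborel (\<lambda>x. a j x - A x) + cmod c * l2n lborel (\<lambda>x. b j x - B x)) \<longlonglongrightarrow> 0" by simp
  qed
  show ?thesis unfolding is_fourier_L2_iff
  proof (intro conjI exI[of _ "\<lambda>j x. s j x + c * t j x"] allI)
    show "(\<lambda>j. l2n lborel (\<lambda>x. s j x + c * t j x - (u x + c * w x))) \<longlonglongrightarrow> 0"
      by (intro lim s t u w ls lt)
    show "(\<lambda>j. l2n lborel (\<lambda>\<xi>. fourier_L1 (\<lambda>x. s j x + c * t j x) \<xi> - (h \<xi> + c * k \<xi>))) \<longlonglongrightarrow> 0"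
      unfolding fourier_L1_lincomb[OF s(1) t(1)]
      by (intro lim plancherel_L1_L2(1) s t h k ls lt)
  qed (use s t u w h k in \<open>auto intro!: L2_add L2_cmult\<close>)
qed

text \<open>Polarization: isometry on \<open>u + c * w\<close> identifies the real parts after
  multiplication by \<open>cnj c\<close>, and the choices 1 and \<open>\<i>\<close> for
  \<open>c\<close> give real and imaginary part.\<close>

lemma fourier_parseval:
  assumes uh: "is_fourier_L2 u h" and wk: "is_fourier_L2 w k"
  shows "l2ip lborel h k = l2ip lborel u w"
proof -
  note L = is_fourier_L2_L2[OF uh] is_fourier_L2_L2[OF wk]
  have *: "Re (cnj c * l2ip lborel h k) = Re (cnj c * l2ip lborel u w)" for c
  proof -
    have "(l2n lborel (\<lambda>x. h x + c * k x))\<^sup>2 = (l2n lborel (\<lambda>x. u x + c * w x))\<^sup>2"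
      using is_fourier_L2_norm[OF is_fourier_L2_lincomb[OF uh wk, of c]] by simp
    then show ?thesis
      unfolding l2n_sq_add[OF L(2) L2_cmult[OF L(4)]] l2n_sq_add[OF L(1) L2_cmult[OF L(3)]]
      by (simp add: l2n_cmult is_fourier_L2_norm[OF uh] is_fourier_L2_norm[OF wk] l2ip_cmult_right)
  qed
  from *[of 1] *[of \<i>] show ?thesis by (simp add: complex_eq_iff)
qed

lemma is_fourier_L2_unique:
  assumes "is_fourier_L2 u h" "is_fourier_L2 u k"
  shows "AE \<xi> in lborel. h \<xi> = k \<xi>"
proof -
  have F: "is_fourier_L2 (\<lambda>x. 0) (\<lambda>\<xi>. h \<xi> - k \<xi>)"
    using is_fourier_L2_lincomb[OF assms, of "-1"] by simp
  then have "l2n lborel (\<lambda>\<xi>. h \<xi> - k \<xi>) = 0"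
    using is_fourier_L2_norm[OF F] by (simp add: l2n_def)
  from l2n_zero_AE[OF is_fourier_L2_L2(2)[OF F] this] show ?thesis by simp
qed

lemma is_fourier_L2_cong_AE:
  assumes "is_fourier_L2 u h" "k \<in> L2 lborel" "AE \<xi> in lborel. h \<xi> = k \<xi>"
  shows "is_fourier_L2 u k"
proof -
  note [measurable] = L2_measurable[OF is_fourier_L2_L2(2)[OF assms(1)], simplified] L2_measurable[OF assms(2), simplified]
  obtain s where s: "\<And>j. integrable lborel (s j)" "\<And>j. s j \<in> L2 lborel"
    and l: "(\<lambda>j. l2n lborel (\<lambda>x. s j x - u x)) \<longlonglongrightarrow> 0" "(\<lambda>j. l2n lborel (\<lambda>\<xi>. fourier_L1 (s j) \<xi> - h \<xi>)) \<longlonglongrightarrow> 0"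
    using assms(1) unfolding is_fourier_L2_iff by blast
  have "l2n lborel (\<lambda>\<xi>. fourier_L1 (s j) \<xi> - h \<xi>) = l2n lborel (\<lambda>\<xi>. fourier_L1 (s j) \<xi> - k \<xi>)" for j
  proof (rule l2n_cong_AE)
    note [measurable] = L2_measurable[OF plancherel_L1_L2(1)[OF s(1,2)[of j]], simplified]
    show "(\<lambda>\<xi>. fourier_L1 (s j) \<xi> - h \<xi>) \<in> borel_measurable lborel" "(\<lambda>\<xi>. fourier_L1 (s j) \<xi> - k \<xi>) \<in> borel_measurable lborel"
      by simp_all
  qed (use assms(3) in auto)
  with l(2) have "(\<lambda>j. l2n lborel (\<lambda>\<xi>. fourier_L1 (s j) \<xi> - k \<xi>)) \<longlonglongrightarrow> 0" by simp
  with s l(1) assms show ?thesis unfolding is_fourier_L2_iff by blast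
qed

definition ball_truncate :: "('a::euclidean_space \<Rightarrow> complex) \<Rightarrow> nat \<Rightarrow> 'a \<Rightarrow> complex" where
  "ball_truncate u N x = u x * indicator (cball 0 (real N)) x"

lemma L2_ball_truncate:
  fixes u :: "'a::euclidean_space \<Rightarrow> complex"
  assumes u: "u \<in> L2 lborel"
  shows "integrable lborel (ball_truncate u N)" "ball_truncate u N \<in> L2 lborel"
    "(\<lambda>N. l2n lborel (\<lambda>x. ball_truncate u N x - u x)) \<longlonglongrightarrow> 0"
proof -
  let ?s = "ball_truncate u"
  note [measurable] = L2_measurable[OF u, simplified]
  have ind: "(\<lambda>x::'a. complex_of_real (1 * indicator (cball 0 (real N)) x)) \<in> L2 lborel" for N
    by (rule indicator_ball_L2)
  have eq: "?s N = (\<lambda>x. u x * complex_of_real (1 * indicator (cball 0 (real N)) x))" for N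
    by (auto simp: ball_truncate_def indicator_def fun_eq_iff)
  show si: "integrable lborel (?s N)" for N
    unfolding eq by (rule L2_mult_integrable[OF u ind])
  have [measurable]: "?s N \<in> borel_measurable borel" for N
    using borel_measurable_integrable[OF si[of N]] by simp
  have bd: "AE x in lborel. cmod (?s N x) \<le> cmod (u x)" for N
    by (auto simp: ball_truncate_def indicator_def)
  have lim: "AE x in lborel. (\<lambda>N. ?s N x) \<longlonglongrightarrow> u x"
  proof (intro AE_I2 tendsto_eventually)
    fix x :: 'a
    obtain k where k: "norm x \<le> real k" using real_arch_simple by blast
    show "\<forall>\<^sub>F N in sequentially. ?s N x = u x"
      using eventually_ge_at_top[of k] by eventually_elim (use k in \<open>auto simp: ball_truncate_def\<close>)
  qed
  show "?s N \<in> L2 lborel" for N by (rule l2_dominated(1)[OF _ _ u lim bd]) auto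
  show "(\<lambda>N. l2n lborel (\<lambda>x. ?s N x - u x)) \<longlonglongrightarrow> 0" by (rule l2_dominated(3)[OF _ _ u lim bd]) auto
qed

text \<open>Restrictions of \<open>u\<close> to balls lie in both L1 and L2. A subsequence that
  converges at a geometric rate has, by isometry, transforms to which
  \<open>l2_complete_geometric\<close> applies.\<close>

lemma is_fourier_L2_exists:
  fixes u :: "'a::euclidean_space \<Rightarrow> complex"
  assumes u: "u \<in> L2 lborel"
  shows "\<exists>h. is_fourier_L2 u h"
proof -
  define s where "s = ball_truncate u"
  note sp = L2_ball_truncate[OF u, folded s_def]
  have "\<exists>N. l2n lborel (\<lambda>x. s N x - u x) < (1/2) ^ k" for k
  proof -
    have "(0::real) < (1/2) ^ k" by simp
    from LIMSEQ_zero_less[OF sp(3) this] show ?thesis by auto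
  qed
  then obtain N where N: "\<And>k. l2n lborel (\<lambda>x. s (N k) x - u x) < (1/2) ^ k" by metis
  define t where "t k = s (N k)" for k
  have t: "integrable lborel (t k)" "t k \<in> L2 lborel" for k using sp by (auto simp: t_def)
  have Fd: "l2n lborel (\<lambda>\<xi>. fourier_L1 (t i) \<xi> - fourier_L1 (t j) \<xi>) = l2n lborel (\<lambda>x. t i x - t j x)" for i j
    using is_fourier_L2_norm[OF is_fourier_L2_lincomb[OF is_fourier_L2_L1[OF t, of i] is_fourier_L2_L1[OF t, of j], of "-1"]]
    by simp
  have step: "l2n lborel (\<lambda>\<xi>. fourier_L1 (t (Suc k)) \<xi> - fourier_L1 (t k) \<xi>) \<le> 2 * (1/2) ^ k" for k
  proof -
    have "l2n lborel (\<lambda>x. t (Suc k) x - t k x) \<le>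
        l2n lborel (\<lambda>x. t (Suc k) x - u x) + l2n lborel (\<lambda>x. u x - t k x)"
      by (rule l2n_triangle_diff[OF t(2) u t(2)])
    also have "\<dots> \<le> (1/2) ^ Suc k + (1/2) ^ k"
      using N[of "Suc k"] N[of k] by (intro add_mono) (auto simp: t_def l2n_minus_commute[of _ u])
    also have "\<dots> \<le> 2 * (1/2) ^ k" by simp
    finally show ?thesis by (simp add: Fd)
  qed
  obtain h where h: "h \<in> L2 lborel"
    and hk: "\<And>k. l2n lborel (\<lambda>\<xi>. fourier_L1 (t k) \<xi> - h \<xi>) \<le> 2 * (1/2) ^ k / (1 - 1/2)"
    using l2_complete_geometric[OF plancherel_L1_L2(1)[OF t] _ _ _ step] by auto
  have pw: "(\<lambda>k. (1/2::real) ^ k) \<longlonglongrightarrow> 0" by (rule LIMSEQ_power_zero) simp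
  have "(\<lambda>k. l2n lborel (\<lambda>x. t k x - u x)) \<longlonglongrightarrow> 0"
    by (rule Lim_null_comparison[OF _ pw]) (use N in \<open>auto simp: t_def less_imp_le\<close>)
  moreover have "(\<lambda>k. l2n lborel (\<lambda>\<xi>. fourier_L1 (t k) \<xi> - h \<xi>)) \<longlonglongrightarrow> 0"
  proof (rule Lim_null_comparison)
    show "\<forall>\<^sub>F k in sequentially. norm (l2n lborel (\<lambda>\<xi>. fourier_L1 (t k) \<xi> - h \<xi>)) \<le> 4 * (1/2) ^ k"
      using hk by auto
    show "(\<lambda>k. 4 * (1/2::real) ^ k) \<longlonglongrightarrow> 0" using tendsto_mult_right[OF pw, of 4] by simp
  qed
  ultimately show ?thesis using u h t unfolding is_fourier_L2_iff by blast
qed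

text \<open>The explicit \<open>cnj\<close> cancels the conjugation built into \<open>l2ip\<close>:
  this is the bilinear identity between the integrals of \<open>h * b\<close> and
  \<open>a * k\<close>, obtained from \<open>fourier_mult_formula\<close> by continuity.\<close>

lemma fourier_mult_formula_L2:
  assumes "is_fourier_L2 a h" "is_fourier_L2 b k"
  shows "l2ip lborel h (\<lambda>x. cnj (b x)) = l2ip lborel a (\<lambda>x. cnj (k x))"
proof -
  obtain s where a: "a \<in> L2 lborel" and h: "h \<in> L2 lborel"
    and s: "\<And>j. integrable lborel (s j)" "\<And>j. s j \<in> L2 lborel"
    and ls: "(\<lambda>j. l2n lborel (\<lambda>x. s j x - a x)) \<longlonglongrightarrow> 0" "(\<lambda>j. l2n lborel (\<lambda>\<xi>. fourier_L1 (s j) \<xi> - h \<xi>)) \<longlonglongrightarrow> 0"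
    using assms(1) unfolding is_fourier_L2_iff by blast
  obtain t where b: "b \<in> L2 lborel" and k: "k \<in> L2 lborel"
    and t: "\<And>j. integrable lborel (t j)" "\<And>j. t j \<in> L2 lborel"
    and lt: "(\<lambda>j. l2n lborel (\<lambda>x. t j x - b x)) \<longlonglongrightarrow> 0" "(\<lambda>j. l2n lborel (\<lambda>\<xi>. fourier_L1 (t j) \<xi> - k \<xi>)) \<longlonglongrightarrow> 0"
    using assms(2) unfolding is_fourier_L2_iff by blast
  have cnj_lim: "(\<lambda>j. l2n lborel (\<lambda>x. cnj (f j x) - cnj (g x))) \<longlonglongrightarrow> 0"
    if "(\<lambda>j. l2n lborel (\<lambda>x. f j x - g x)) \<longlonglongrightarrow> 0" for f g
    using that by (simp add: l2n_cnj flip: complex_cnj_diff)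
  have "(\<lambda>j. l2ip lborel (fourier_L1 (s j)) (\<lambda>x. cnj (t j x))) \<longlonglongrightarrow> l2ip lborel h (\<lambda>x. cnj (b x))"
    by (intro l2ip_tendsto plancherel_L1_L2(1) s L2_cnj t h b ls lt cnj_lim)
  moreover have "(\<lambda>j. l2ip lborel (s j) (\<lambda>x. cnj (fourier_L1 (t j) x))) \<longlonglongrightarrow> l2ip lborel a (\<lambda>x. cnj (k x))"
    by (intro l2ip_tendsto plancherel_L1_L2(1) s L2_cnj t a k ls lt cnj_lim)
  moreover have "l2ip lborel (fourier_L1 (s j)) (\<lambda>x. cnj (t j x)) = l2ip lborel (s j) (\<lambda>x. cnj (fourier_L1 (t j) x))" for j
    using fourier_mult_formula[OF s(1)[of j] t(1)[of j]] by (simp add: l2ip_def)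
  ultimately show ?thesis using LIMSEQ_unique by simp
qed

text \<open>The adjoint of the isometry \<open>F\<close> is \<open>w \<mapsto> cnj (F (cnj w))\<close>, which is again isometric;
  hence \<open>F\<close> is onto and no inversion formula is needed.\<close>

lemma is_fourier_L2_surj:
  fixes w :: "'a::euclidean_space \<Rightarrow> complex"
  assumes w: "w \<in> L2 lborel"
  shows "\<exists>u. is_fourier_L2 u w"
proof -
  obtain k where k: "is_fourier_L2 (\<lambda>x. cnj (w x)) k"
    using is_fourier_L2_exists[OF L2_cnj[OF w]] by blast
  note kL = is_fourier_L2_L2(2)[OF k]
  obtain h where h: "is_fourier_L2 (\<lambda>x. cnj (k x)) h"
    using is_fourier_L2_exists[OF L2_cnj[OF kL]] by blast
  note hL = is_fourier_L2_L2(2)[OF h]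
  have "l2ip lborel h w = of_real ((l2n lborel w)\<^sup>2)"
    using fourier_mult_formula_L2[OF h k] is_fourier_L2_norm[OF k] l2ip_self[of lborel "\<lambda>x. cnj (k x)"]
    by (simp add: l2n_cnj)
  moreover have "l2n lborel h = l2n lborel w"
    using is_fourier_L2_norm[OF h] is_fourier_L2_norm[OF k] by (simp add: l2n_cnj)
  ultimately have "(l2n lborel (\<lambda>x. h x - w x))\<^sup>2 = 0"
    using l2n_sq_add[OF hL L2_cmult[OF w, of "-1"]] by (simp add: l2ip_cmult_right[of _ _ "-1", simplified] l2n_uminus)
  then have "AE x in lborel. h x = w x"
    using l2n_zero_AE[OF L2_diff[OF hL w]] by simp
  from is_fourier_L2_cong_AE[OF h w this] show ?thesis by blast
qed

definition fourier_L2 :: "('a::euclidean_space \<Rightarrow> complex) \<Rightarrow> 'a \<Rightarrow> complex" where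
  "fourier_L2 u = (SOME h. is_fourier_L2 u h)"

lemma fourier_L2: "u \<in> L2 lborel \<Longrightarrow> is_fourier_L2 u (fourier_L2 u)"
  unfolding fourier_L2_def by (rule someI_ex[OF is_fourier_L2_exists])

lemma L2_mult_bounded:
  assumes "f \<in> L2 M" "\<sigma> \<in> borel_measurable M" "\<And>x. cmod (\<sigma> x) \<le> B" "0 \<le> B"
  shows "(\<lambda>x. \<sigma> x * f x) \<in> L2 M" "l2n M (\<lambda>x. \<sigma> x * f x) \<le> B * l2n M f"
proof -
  note [measurable] = L2_measurable[OF assms(1)] assms(2)
  have le: "cmod (\<sigma> x * f x) \<le> B * cmod (f x)" for x
    unfolding norm_mult by (rule mult_right_mono[OF assms(3)]) simp
  show L: "(\<lambda>x. \<sigma> x * f x) \<in> L2 M"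
    by (rule L2_bound[where c=B, OF assms(1)]) (use le in auto)
  have "(l2n M (\<lambda>x. \<sigma> x * f x))\<^sup>2 \<le> (LINT x|M. B\<^sup>2 * (cmod (f x))\<^sup>2)"
    unfolding l2n_sq
  proof (rule integral_mono[OF L2_integrable[OF L]])
    show "(cmod (\<sigma> x * f x))\<^sup>2 \<le> B\<^sup>2 * (cmod (f x))\<^sup>2" for x
      using power_mono[OF le norm_ge_zero, of x 2] by (simp only: power_mult_distrib)
  qed (use L2_integrable[OF assms(1)] in auto)
  also have "\<dots> = (B * l2n M f)\<^sup>2" by (simp add: l2n_sq power_mult_distrib)
  finally show "l2n M (\<lambda>x. \<sigma> x * f x) \<le> B * l2n M f"
    by (rule power2_le_imp_le) (simp add: assms(4))
qed

section \<open>Fourier multipliers with non-negative bounded symbol\<close>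

locale bounded_symbol =
  fixes \<sigma> :: "'a::euclidean_space \<Rightarrow> real" and B :: real
  assumes meas [measurable]: "\<sigma> \<in> borel_measurable borel"
    and nonneg: "0 \<le> \<sigma> \<xi>" and bounded: "\<sigma> \<xi> \<le> B"
begin

abbreviation A :: "('a \<Rightarrow> complex) \<Rightarrow> 'a \<Rightarrow> complex" where
  "A \<equiv> fourier_multiplier (\<lambda>\<xi>. of_real (\<sigma> \<xi>))"

lemma B_nonneg: "0 \<le> B"
  using nonneg bounded order_trans by blast

lemma symbol_L2: "f \<in> L2 lborel \<Longrightarrow> (\<lambda>\<xi>. of_real (\<sigma> \<xi>) * f \<xi>) \<in> L2 lborel"
  "f \<in> L2 lborel \<Longrightarrow> l2n lborel (\<lambda>\<xi>. of_real (\<sigma> \<xi>) * f \<xi>) \<le> B * l2n lborel f"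
  using L2_mult_bounded[of f lborel "\<lambda>\<xi>. of_real (\<sigma> \<xi>)" B] nonneg bounded B_nonneg by auto

text \<open>The choice in \<open>fourier_multiplier\<close> is made from a nonempty set, since every
  square integrable function is a transform; uniqueness almost everywhere allows the transform of
  \<open>g\<close> to be taken as \<open>fourier_L2 g\<close>.\<close>

lemma fourier_A:
  assumes g: "g \<in> L2 lborel"
  shows "is_fourier_L2 (A g) (\<lambda>\<xi>. of_real (\<sigma> \<xi>) * fourier_L2 g \<xi>)"
proof -
  have "\<exists>w h. is_fourier_L2 g h \<and> is_fourier_L2 w (\<lambda>\<xi>. of_real (\<sigma> \<xi>) * h \<xi>)"
    using fourier_L2[OF g] is_fourier_L2_surj[OF symbol_L2(1)[OF is_fourier_L2_L2(2)[OF fourier_L2[OF g]]]] by blast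
  from someI_ex[OF this] obtain h where h: "is_fourier_L2 g h" "is_fourier_L2 (A g) (\<lambda>\<xi>. of_real (\<sigma> \<xi>) * h \<xi>)"
    unfolding fourier_multiplier_def by blast
  have "AE \<xi> in lborel. of_real (\<sigma> \<xi>) * h \<xi> = of_real (\<sigma> \<xi>) * fourier_L2 g \<xi>"
    using is_fourier_L2_unique[OF h(1) fourier_L2[OF g]] by auto
  from is_fourier_L2_cong_AE[OF h(2) symbol_L2(1) this] show ?thesis
    using is_fourier_L2_L2(2)[OF fourier_L2[OF g]] by blast
qed

lemma A_L2: "g \<in> L2 lborel \<Longrightarrow> A g \<in> L2 lborel"
  by (rule is_fourier_L2_L2(1)[OF fourier_A])

lemma l2ip_A:
  assumes "g \<in> L2 lborel" "k \<in> L2 lborel"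
  shows "l2ip lborel (A g) k = l2ip lborel (\<lambda>\<xi>. of_real (\<sigma> \<xi>) * fourier_L2 g \<xi>) (fourier_L2 k)"
  by (rule fourier_parseval[OF fourier_A fourier_L2, symmetric]) fact+

text \<open>On the Fourier side the two forms differ only in the factor that carries \<sigma>, and
  \<sigma> is real.\<close>

lemma A_selfadjoint:
  assumes "g \<in> L2 lborel" "k \<in> L2 lborel"
  shows "l2ip lborel (A g) k = l2ip lborel g (A k)"
proof -
  have "l2ip lborel g (A k) = l2ip lborel (fourier_L2 g) (\<lambda>\<xi>. of_real (\<sigma> \<xi>) * fourier_L2 k \<xi>)"
    by (rule fourier_parseval[OF fourier_L2 fourier_A, symmetric]) fact+
  then show ?thesis unfolding l2ip_A[OF assms] by (simp add: l2ip_def mult_ac)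
qed

lemma A_nonneg:
  assumes "g \<in> L2 lborel"
  shows "l2ip lborel (A g) g \<in> \<real>\<^sub>\<ge>\<^sub>0"
proof -
  have "l2ip lborel (A g) g = (LINT \<xi>|lborel. complex_of_real (\<sigma> \<xi> * (cmod (fourier_L2 g \<xi>))\<^sup>2))"
    unfolding l2ip_A[OF assms assms] unfolding l2ip_def
    by (intro Bochner_Integration.integral_cong refl) (simp add: complex_norm_square[unfolded of_real_power] mult_ac)
  also have "\<dots> = of_real (LINT \<xi>|lborel. \<sigma> \<xi> * (cmod (fourier_L2 g \<xi>))\<^sup>2)"
    by (rule integral_complex_of_real)
  finally show ?thesis
    by (simp add: nonneg integral_nonneg)
qed

lemma A_bound:
  assumes "g \<in> L2 lborel" "k \<in> L2 lborel"
  shows "cmod (l2ip lborel (A g) k) \<le> B * l2n lborel g * l2n lborel k"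
proof -
  note G = fourier_L2[OF assms(1)] note K = fourier_L2[OF assms(2)]
  have "cmod (l2ip lborel (A g) k) \<le> l2n lborel (\<lambda>\<xi>. of_real (\<sigma> \<xi>) * fourier_L2 g \<xi>) * l2n lborel (fourier_L2 k)"
    unfolding l2ip_A[OF assms] by (intro l2_cauchy_schwarz symbol_L2 is_fourier_L2_L2(2)[OF G] is_fourier_L2_L2(2)[OF K])
  also have "\<dots> \<le> B * l2n lborel (fourier_L2 g) * l2n lborel (fourier_L2 k)"
    by (intro mult_right_mono symbol_L2 is_fourier_L2_L2(2)[OF G]) simp
  finally show ?thesis by (simp add: is_fourier_L2_norm[OF G] is_fourier_L2_norm[OF K])
qed

text \<open>\<open>A (\<lambda>x. g (p, x))\<close> is chosen for each \<open>p\<close> separately,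
  so nothing is known about its joint measurability. The pairing does not depend on the choice: by
  Parseval it is an integral of transforms. Transforms of truncations to balls are integrals with a
  parameter, hence jointly measurable, and the pairing is a pointwise limit of theirs.\<close>

lemma kernel_measurable:
  fixes g :: "'p::euclidean_space \<times> 'a \<Rightarrow> complex"
  assumes [measurable]: "g \<in> borel_measurable borel" and gp: "\<And>p. (\<lambda>x. g (p, x)) \<in> L2 lborel"
  shows "(\<lambda>(p, q). l2ip lborel (A (\<lambda>x. g (p, x))) (\<lambda>x. g (q, x))) \<in> borel_measurable (borel \<Otimes>\<^sub>M borel)"
proof -
  have [measurable]: "g \<in> borel_measurable (borel \<Otimes>\<^sub>M borel)" using assms(1) by (simp add: borel_prod)
  have [measurable]: "cball (0::'a) r \<in> sets borel" for r by simp
  define s where "s = (\<lambda>N p. ball_truncate (\<lambda>x. g (p, x)) N)"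
  have sp: "integrable lborel (s N p)" "s N p \<in> L2 lborel"
    "(\<lambda>N. l2n lborel (\<lambda>x. s N p x - g (p, x))) \<longlonglongrightarrow> 0" for N p
    unfolding s_def by (rule L2_ball_truncate[OF gp])+
  have sm: "(\<lambda>(p, x). s N p x) \<in> borel_measurable (borel \<Otimes>\<^sub>M borel)" for N
    unfolding s_def ball_truncate_def by measurable
  define F where "F = (\<lambda>N p. fourier_L1 (s N p))"
  have FM: "(\<lambda>z. F N (fst z) (snd z)) \<in> borel_measurable (borel \<Otimes>\<^sub>M borel)" for N
    unfolding F_def
  proof (rule fourier_L1_measurable)
    have "(\<lambda>z. (fst (fst z), snd z)) \<in> (borel \<Otimes>\<^sub>M borel) \<Otimes>\<^sub>M borel \<rightarrow>\<^sub>M borel \<Otimes>\<^sub>M (borel :: 'a measure)"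
      by measurable
    from measurable_compose[OF this sm[of N]]
    show "(\<lambda>(w, x). s N (fst w) x) \<in> borel_measurable ((borel \<Otimes>\<^sub>M borel) \<Otimes>\<^sub>M borel)"
      by (simp add: case_prod_beta')
  qed measurable
  have Fl: "(\<lambda>N. l2n lborel (\<lambda>\<xi>. F N p \<xi> - fourier_L2 (\<lambda>x. g (p, x)) \<xi>)) \<longlonglongrightarrow> 0" for p
  proof -
    have "l2n lborel (\<lambda>\<xi>. F N p \<xi> - fourier_L2 (\<lambda>x. g (p, x)) \<xi>) = l2n lborel (\<lambda>x. s N p x - g (p, x))" for N
      using is_fourier_L2_norm[OF is_fourier_L2_lincomb[OF is_fourier_L2_L1[OF sp(1,2)] fourier_L2[OF gp], of N p "-1" p]]
      by (simp add: F_def)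
    with sp(3)[of p] show ?thesis by simp
  qed
  have FL: "F N p \<in> L2 lborel" for N p unfolding F_def by (intro plancherel_L1_L2(1) sp)
  have fL: "fourier_L2 (\<lambda>x. g (p, x)) \<in> L2 lborel" for p by (rule is_fourier_L2_L2(2)[OF fourier_L2[OF gp]])
  show ?thesis
  proof (rule borel_measurable_LIMSEQ_metric)
    show "(\<lambda>(p, q). l2ip lborel (\<lambda>\<xi>. of_real (\<sigma> \<xi>) * F N p \<xi>) (F N q)) \<in> borel_measurable (borel \<Otimes>\<^sub>M borel)" for N
    proof -
      have a: "(\<lambda>z. F N (fst (fst z)) (snd z)) \<in> borel_measurable ((borel \<Otimes>\<^sub>M borel) \<Otimes>\<^sub>M lborel)"
        and b: "(\<lambda>z. F N (snd (fst z)) (snd z)) \<in> borel_measurable ((borel \<Otimes>\<^sub>M borel) \<Otimes>\<^sub>M lborel)"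
      proof -
        have "(\<lambda>z. (fst (fst z), snd z)) \<in> (borel \<Otimes>\<^sub>M borel) \<Otimes>\<^sub>M lborel \<rightarrow>\<^sub>M borel \<Otimes>\<^sub>M (borel :: 'a measure)"
          by measurable
        from measurable_compose[OF this FM]
        show "(\<lambda>z. F N (fst (fst z)) (snd z)) \<in> borel_measurable ((borel \<Otimes>\<^sub>M borel) \<Otimes>\<^sub>M lborel)" by simp
        have "(\<lambda>z. (snd (fst z), snd z)) \<in> (borel \<Otimes>\<^sub>M borel) \<Otimes>\<^sub>M lborel \<rightarrow>\<^sub>M borel \<Otimes>\<^sub>M (borel :: 'a measure)"
          by measurable
        from measurable_compose[OF this FM]
        show "(\<lambda>z. F N (snd (fst z)) (snd z)) \<in> borel_measurable ((borel \<Otimes>\<^sub>M borel) \<Otimes>\<^sub>M lborel)" by simp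
      qed
      note [measurable] = a b
      show ?thesis unfolding l2ip_def case_prod_beta'
        by (rule lborel.borel_measurable_lebesgue_integral) (unfold case_prod_beta', measurable)
    qed
    show "(\<lambda>N. case z of (p, q) \<Rightarrow> l2ip lborel (\<lambda>\<xi>. of_real (\<sigma> \<xi>) * F N p \<xi>) (F N q)) \<longlonglongrightarrow>
        (case z of (p, q) \<Rightarrow> l2ip lborel (A (\<lambda>x. g (p, x))) (\<lambda>x. g (q, x)))" for z
    proof (cases z)
      case (Pair p q)
      have "(\<lambda>N. l2n lborel (\<lambda>\<xi>. of_real (\<sigma> \<xi>) * F N p \<xi> - of_real (\<sigma> \<xi>) * fourier_L2 (\<lambda>x. g (p, x)) \<xi>)) \<longlonglongrightarrow> 0"
      proof (rule Lim_null_comparison)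
        show "\<forall>\<^sub>F N in sequentially. norm (l2n lborel (\<lambda>\<xi>. of_real (\<sigma> \<xi>) * F N p \<xi> - of_real (\<sigma> \<xi>) * fourier_L2 (\<lambda>x. g (p, x)) \<xi>))
            \<le> B * l2n lborel (\<lambda>\<xi>. F N p \<xi> - fourier_L2 (\<lambda>x. g (p, x)) \<xi>)"
          using symbol_L2(2)[OF L2_diff[OF FL fL]] by (simp add: right_diff_distrib)
        show "(\<lambda>N. B * l2n lborel (\<lambda>\<xi>. F N p \<xi> - fourier_L2 (\<lambda>x. g (p, x)) \<xi>)) \<longlonglongrightarrow> 0"
          by (rule tendsto_mult_right_zero[OF Fl])
      qed
      from l2ip_tendsto[OF symbol_L2(1)[OF FL] symbol_L2(1)[OF fL] this FL fL Fl[of q]]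
      show ?thesis unfolding Pair by (simp add: l2ip_A[OF gp gp])
    qed
  qed
qed

end

section \<open>Averages of square integrable families\<close>

lemma L2_tensor:
  fixes f :: "'a::euclidean_space \<Rightarrow> complex" and k :: "'b::euclidean_space \<Rightarrow> complex"
  assumes f: "f \<in> L2 lborel" and k: "k \<in> L2 lborel"
  shows "(\<lambda>z. f (fst z) * k (snd z)) \<in> L2 lborel"
    and "l2n lborel (\<lambda>z. f (fst z) * k (snd z)) = l2n lborel f * l2n lborel k"
proof -
  note [measurable] = L2_measurable[OF f, simplified] L2_measurable[OF k, simplified]
  have m: "(\<lambda>z. f (fst z) * k (snd z)) \<in> borel_measurable (lborel \<Otimes>\<^sub>M lborel)" by measurable
  have nn: "(\<integral>\<^sup>+z. ennreal ((cmod (f (fst z) * k (snd z)))\<^sup>2) \<partial>(lborel \<Otimes>\<^sub>M lborel)) =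
      ennreal ((l2n lborel f * l2n lborel k)\<^sup>2)"
  proof -
    have "(\<integral>\<^sup>+z. ennreal ((cmod (f (fst z) * k (snd z)))\<^sup>2) \<partial>(lborel \<Otimes>\<^sub>M lborel)) =
        (\<integral>\<^sup>+x. \<integral>\<^sup>+y. ennreal ((cmod (f x))\<^sup>2) * ennreal ((cmod (k y))\<^sup>2) \<partial>lborel \<partial>lborel)"
      by (subst lborel.nn_integral_fst[symmetric])
        (auto simp: norm_mult power_mult_distrib ennreal_mult)
    also have "\<dots> = ennreal ((l2n lborel f)\<^sup>2) * ennreal ((l2n lborel k)\<^sup>2)"
      by (simp add: nn_integral_cmult nn_integral_multc nn_integral_l2n[OF f] nn_integral_l2n[OF k])
    finally show ?thesis by (simp add: ennreal_mult power_mult_distrib)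
  qed
  have L: "(\<lambda>z. f (fst z) * k (snd z)) \<in> L2 (lborel \<Otimes>\<^sub>M lborel)"
    by (rule L2_nnI[OF m]) (simp add: nn)
  then show "(\<lambda>z. f (fst z) * k (snd z)) \<in> L2 lborel" by (simp add: lborel_prod)
  have "(l2n (lborel \<Otimes>\<^sub>M lborel) (\<lambda>z. f (fst z) * k (snd z)))\<^sup>2 = (l2n lborel f * l2n lborel k)\<^sup>2"
    using nn by (simp add: nn_integral_l2n[OF L])
  then show "l2n lborel (\<lambda>z. f (fst z) * k (snd z)) = l2n lborel f * l2n lborel k"
    by (simp add: lborel_prod power2_eq_iff_nonneg)
qed

text \<open>Every section, not just almost every one, has to be square integrable, because the
  multiplier is applied to each of them.\<close>

locale L2_family =
  fixes g :: "'p::euclidean_space \<times> 'a::euclidean_space \<Rightarrow> complex"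
  assumes g_meas [measurable]: "g \<in> borel_measurable borel"
    and section_L2: "(\<lambda>x. g (p, x)) \<in> L2 lborel"
    and g_L2: "g \<in> L2 lborel"
begin

definition average :: "('p \<Rightarrow> complex) \<Rightarrow> 'a \<Rightarrow> complex" where
  "average \<rho> x = (LINT p|lborel. \<rho> p * g (p, x))"

lemma g_sq_integrable: "integrable (lborel \<Otimes>\<^sub>M lborel) (\<lambda>(p, x). (cmod (g (p, x)))\<^sup>2)"
  using L2_integrable[OF g_L2] by (simp add: lborel_prod case_prod_beta')

lemma section_norm_L2: "(\<lambda>p. complex_of_real (l2n lborel (\<lambda>x. g (p, x)))) \<in> L2 lborel"
proof (rule L2_I)
  show "integrable lborel (\<lambda>p. (cmod (complex_of_real (l2n lborel (\<lambda>x. g (p, x)))))\<^sup>2)"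
    using lborel_pair.integrable_fst[OF g_sq_integrable] by (simp add: l2n_sq)
qed (unfold l2n_def, measurable)

text \<open>Cauchy-Schwarz in \<open>p\<close> bounds the average at almost every \<open>x\<close>;
  integration over \<open>x\<close> leaves the full norm of \<open>g\<close>.\<close>

lemma average_L2:
  assumes \<rho>: "\<rho> \<in> L2 lborel"
  shows "average \<rho> \<in> L2 lborel" "l2n lborel (average \<rho>) \<le> l2n lborel \<rho> * l2n lborel g"
proof -
  note [measurable] = L2_measurable[OF \<rho>, simplified]
  have [measurable]: "average \<rho> \<in> borel_measurable borel"
    unfolding average_def by measurable
  have "AE x in lborel. integrable lborel (\<lambda>p. (cmod (g (p, x)))\<^sup>2)"
    using lborel_pair.AE_integrable_snd[OF g_sq_integrable] .
  then have bd: "AE x in lborel. (cmod (average \<rho> x))\<^sup>2 \<le> (l2n lborel \<rho>)\<^sup>2 * (LINT p|lborel. (cmod (g (p, x)))\<^sup>2)"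
  proof eventually_elim
    case (elim x)
    then have L: "(\<lambda>p. cnj (g (p, x))) \<in> L2 lborel"
      by (intro L2_cnj L2_I) auto
    have "cmod (average \<rho> x) \<le> l2n lborel \<rho> * l2n lborel (\<lambda>p. cnj (g (p, x)))"
      using l2_cauchy_schwarz[OF \<rho> L] by (simp add: l2ip_def average_def)
    then have "(cmod (average \<rho> x))\<^sup>2 \<le> (l2n lborel \<rho> * l2n lborel (\<lambda>p. cnj (g (p, x))))\<^sup>2"
      by (rule power_mono) simp
    then show ?case by (simp add: power_mult_distrib l2n_sq)
  qed
  have int: "integrable lborel (\<lambda>x. (l2n lborel \<rho>)\<^sup>2 * (LINT p|lborel. (cmod (g (p, x)))\<^sup>2))"
    using lborel_pair.integrable_snd[OF g_sq_integrable] by simp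
  show L: "average \<rho> \<in> L2 lborel"
    by (rule L2_I[OF _ Bochner_Integration.integrable_bound[OF int]]) (use bd in \<open>auto intro: order_trans\<close>)
  have "(l2n lborel (average \<rho>))\<^sup>2 \<le> (LINT x|lborel. (l2n lborel \<rho>)\<^sup>2 * (LINT p|lborel. (cmod (g (p, x)))\<^sup>2))"
    unfolding l2n_sq by (rule integral_mono_AE[OF L2_integrable[OF L] int[unfolded l2n_sq] bd[unfolded l2n_sq]])
  also have "\<dots> = (l2n lborel \<rho> * l2n lborel g)\<^sup>2"
    using lborel_pair.integral_snd[OF g_sq_integrable]
    by (simp add: power_mult_distrib l2n_sq[of _ g] lborel_prod case_prod_beta')
  finally show "l2n lborel (average \<rho>) \<le> l2n lborel \<rho> * l2n lborel g"
    by (rule power2_le_imp_le) simp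
qed

lemma average_pairing:
  assumes \<rho>: "\<rho> \<in> L2 lborel" and k: "k \<in> L2 lborel"
  shows "(LINT p|lborel. \<rho> p * l2ip lborel (\<lambda>x. g (p, x)) k) = l2ip lborel (average \<rho>) k"
proof -
  have int: "integrable (lborel \<Otimes>\<^sub>M lborel) (\<lambda>(p, x). \<rho> p * (g (p, x) * cnj (k x)))"
    using L2_mult_integrable[OF L2_tensor(1)[OF \<rho> L2_cnj[OF k]] g_L2]
    by (simp add: lborel_prod case_prod_beta' mult_ac)
  have "(LINT p|lborel. \<rho> p * l2ip lborel (\<lambda>x. g (p, x)) k) =
      (LINT p|lborel. LINT x|lborel. \<rho> p * (g (p, x) * cnj (k x)))"
    by (simp add: l2ip_def)
  also have "\<dots> = (LINT x|lborel. LINT p|lborel. \<rho> p * (g (p, x) * cnj (k x)))"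
    by (rule lborel_pair.Fubini_integral[OF int, symmetric])
  also have "\<dots> = l2ip lborel (average \<rho>) k"
    by (simp add: l2ip_def average_def flip: mult.assoc)
  finally show ?thesis .
qed

end

text \<open>The operator cannot simply be pulled out of an integral over \<open>p\<close>, as its
  values are chosen representatives. Self-adjointness therefore moves it to the factor that is fixed
  at the moment: first to the section at \<open>q\<close> while \<open>p\<close> is averaged, then
  to the average while \<open>q\<close> is averaged.\<close>

lemma (in bounded_symbol) kernel_average:
  assumes "L2_family g" and \<rho>: "\<rho> \<in> L2 lborel"
  shows "(LINT (p, q)|lborel. \<rho> p * cnj (\<rho> q) * l2ip lborel (A (\<lambda>x. g (p, x))) (\<lambda>x. g (q, x))) =
    l2ip lborel (A (L2_family.average g \<rho>)) (L2_family.average g \<rho>)"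
proof -
  interpret L2_family g by fact
  note [measurable] = L2_measurable[OF \<rho>, simplified] kernel_measurable[OF g_meas section_L2]
  define N where "N p = l2n lborel (\<lambda>x. g (p, x))" for p
  let ?G = "average \<rho>"
  have GL: "?G \<in> L2 lborel" by (rule average_L2[OF \<rho>])
  have N: "integrable lborel (\<lambda>p. cmod (\<rho> p) * N p)"
    using integrable_norm[OF L2_mult_integrable[OF \<rho> section_norm_L2]] by (simp add: norm_mult N_def)
  have int: "integrable (lborel \<Otimes>\<^sub>M lborel)
      (\<lambda>(p, q). \<rho> p * cnj (\<rho> q) * l2ip lborel (A (\<lambda>x. g (p, x))) (\<lambda>x. g (q, x)))"
  proof (rule integrable_pair_bound)
    show "integrable lborel (\<lambda>p. B * (cmod (\<rho> p) * N p))" using N by simp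
    fix p q
    have "cmod (l2ip lborel (A (\<lambda>x. g (p, x))) (\<lambda>x. g (q, x))) \<le> B * N p * N q"
      unfolding N_def by (rule A_bound[OF section_L2 section_L2])
    then have "cmod (\<rho> p) * cmod (\<rho> q) * cmod (l2ip lborel (A (\<lambda>x. g (p, x))) (\<lambda>x. g (q, x))) \<le>
        cmod (\<rho> p) * cmod (\<rho> q) * (B * N p * N q)"
      by (rule mult_left_mono) simp
    then show "cmod (case (p, q) of (p, q) \<Rightarrow> \<rho> p * cnj (\<rho> q) * l2ip lborel (A (\<lambda>x. g (p, x))) (\<lambda>x. g (q, x))) \<le>
        B * (cmod (\<rho> p) * N p) * (cmod (\<rho> q) * N q)"
      by (simp add: norm_mult mult_ac)
  qed (use N in measurable)
  have "(LINT (p, q)|lborel. \<rho> p * cnj (\<rho> q) * l2ip lborel (A (\<lambda>x. g (p, x))) (\<lambda>x. g (q, x))) =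
      (LINT q|lborel. LINT p|lborel. \<rho> p * cnj (\<rho> q) * l2ip lborel (A (\<lambda>x. g (p, x))) (\<lambda>x. g (q, x)))"
    using lborel_pair.integral_snd[OF int] by (simp add: lborel_prod)
  also have "\<dots> = (LINT q|lborel. cnj (\<rho> q * l2ip lborel (\<lambda>x. g (q, x)) (A ?G)))"
  proof (rule Bochner_Integration.integral_cong[OF refl])
    fix q
    have "(LINT p|lborel. \<rho> p * cnj (\<rho> q) * l2ip lborel (A (\<lambda>x. g (p, x))) (\<lambda>x. g (q, x))) =
        (LINT p|lborel. cnj (\<rho> q) * (\<rho> p * l2ip lborel (\<lambda>x. g (p, x)) (A (\<lambda>x. g (q, x)))))"
      by (simp add: A_selfadjoint[OF section_L2 section_L2] mult_ac)
    also have "\<dots> = cnj (\<rho> q) * l2ip lborel ?G (A (\<lambda>x. g (q, x)))"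
      unfolding integral_mult_right_zero average_pairing[OF \<rho> A_L2[OF section_L2]] ..
    also have "l2ip lborel ?G (A (\<lambda>x. g (q, x))) = cnj (l2ip lborel (\<lambda>x. g (q, x)) (A ?G))"
      by (simp add: A_selfadjoint[OF GL section_L2, symmetric] l2ip_commute[of _ "A ?G"])
    finally show "(LINT p|lborel. \<rho> p * cnj (\<rho> q) * l2ip lborel (A (\<lambda>x. g (p, x))) (\<lambda>x. g (q, x))) =
        cnj (\<rho> q * l2ip lborel (\<lambda>x. g (q, x)) (A ?G))" by simp
  qed
  also have "\<dots> = cnj (l2ip lborel ?G (A ?G))"
    unfolding Bochner_Integration.integral_cnj average_pairing[OF \<rho> A_L2[OF GL]] ..
  also have "\<dots> = l2ip lborel (A ?G) ?G"
    by (rule l2ip_commute[symmetric])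
  finally show ?thesis .
qed

section \<open>Signed and complex measures\<close>

definition signed_measure :: "'a measure \<Rightarrow> ('a set \<Rightarrow> real) \<Rightarrow> bool" where
  "signed_measure M s \<longleftrightarrow>
     (\<forall>A. range A \<subseteq> sets M \<longrightarrow> disjoint_family A \<longrightarrow> (\<lambda>n::nat. s (A n)) sums s (\<Union>n. A n)) \<and>
     (\<exists>C. \<forall>A\<in>sets M. \<bar>s A\<bar> \<le> C)"

lemma signed_measure_uminus: "signed_measure M s \<Longrightarrow> signed_measure M (\<lambda>A. - s A)"
  by (auto simp: signed_measure_def intro: sums_minus)

lemma signed_measure_empty:
  assumes "signed_measure M s"
  shows "s {} = 0"
proof -
  have "(\<lambda>n::nat. s {}) sums s {}"
    using assms[unfolded signed_measure_def, THEN conjunct1, rule_format, of "\<lambda>_. {}"]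
    by (simp add: disjoint_family_on_def)
  then have "(\<lambda>n::nat. s {}) \<longlonglongrightarrow> 0"
    using sums_summable summable_LIMSEQ_zero by blast
  then show ?thesis by (simp add: LIMSEQ_const_iff)
qed

lemma signed_measure_Un:
  assumes s: "signed_measure M s" and "A \<in> sets M" "B \<in> sets M" "A \<inter> B = {}"
  shows "s (A \<union> B) = s A + s B"
proof -
  have "(\<lambda>n. s (binaryset A B n)) sums s (\<Union>n. binaryset A B n)"
    using assms by (intro s[unfolded signed_measure_def, THEN conjunct1, rule_format])
      (auto simp: range_binaryset_eq disjoint_family_on_def binaryset_def)
  moreover have "(\<lambda>n. s (binaryset A B n)) sums (s A + s B)"
    by (rule binaryset_sums[where f=s, OF signed_measure_empty[OF s]])
  ultimately show ?thesis by (simp add: UN_binaryset_eq sums_unique2)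
qed

lemma signed_measure_Diff:
  assumes s: "signed_measure M s" and "A \<in> sets M" "B \<in> sets M" "B \<subseteq> A"
  shows "s A = s B + s (A - B)"
  using signed_measure_Un[OF s assms(3) sets.Diff[OF assms(2,3)]] assms(4) by (simp add: Un_absorb1)

lemma ennreal_sum_le: "ennreal (\<Sum>i<n. f i) \<le> (\<Sum>i<n::nat. ennreal (f i))"
proof -
  have "ennreal (\<Sum>i<n. f i) \<le> ennreal (\<Sum>i<n. max 0 (f i))"
    by (intro ennreal_leI sum_mono) auto
  also have "\<dots> = (\<Sum>i<n. ennreal (max 0 (f i)))"
    by (rule sum_ennreal[symmetric]) auto
  also have "\<dots> = (\<Sum>i<n. ennreal (f i))"
    by (intro sum.cong refl) (simp add: max_def ennreal_neg)
  finally show ?thesis .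
qed

text \<open>\<open>measure_of\<close> returns the intended values only after the supremum has been
  shown to be countably additive. Joining subsets of disjoint sets gives superadditivity; cutting a
  subset \<open>B\<close> of the union into the pieces \<open>B \<inter> A n\<close> gives the
  converse inequality.\<close>

lemma pos_variation_emeasure:
  assumes s: "signed_measure M s" and A: "A \<in> sets M"
  shows "emeasure (pos_variation M s) A = (SUP B\<in>{B \<in> sets M. B \<subseteq> A}. ennreal (s B))"
proof -
  define f where "f = (\<lambda>A. SUP B\<in>{B \<in> sets M. B \<subseteq> A}. ennreal (s B))"
  have fd: "f A = (SUP B\<in>{B \<in> sets M. B \<subseteq> A}. ennreal (s B))" for A
    by (simp add: f_def)
  have fub: "ennreal (s B) \<le> f A" if "B \<in> sets M" "B \<subseteq> A" for A B
    unfolding f_def by (rule SUP_upper) (use that in auto)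
  have super: "f A + f B \<le> f (A \<union> B)" if AB: "A \<in> sets M" "B \<in> sets M" "A \<inter> B = {}" for A B
  proof -
    have ne: "{B \<in> sets M. B \<subseteq> A} \<noteq> {}" for A :: "'a set" by auto
    have "ennreal (s C) + ennreal (s D) \<le> f (A \<union> B)"
      if C: "C \<in> sets M" "C \<subseteq> A" and D: "D \<in> sets M" "D \<subseteq> B" for C D
    proof -
      have le: "ennreal (s C) \<le> f (A \<union> B)" "ennreal (s D) \<le> f (A \<union> B)" using C D by (auto intro!: fub)
      \<comment> \<open>\<open>ennreal\<close> turns a negative value into 0, so the two values add
        up only if both are non-negative; otherwise one summand vanishes and the other is already
        below the supremum.\<close>
      consider "s C \<le> 0" | "s D \<le> 0" | "0 \<le> s C" "0 \<le> s D" by linarith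
      then show ?thesis
      proof cases
        case 3
        have "ennreal (s C) + ennreal (s D) = ennreal (s (C \<union> D))"
          using 3 C D AB by (subst signed_measure_Un[OF s]) (auto simp: ennreal_plus)
        also have "\<dots> \<le> f (A \<union> B)" using C D by (intro fub) auto
        finally show ?thesis .
      qed (use le in \<open>auto simp: ennreal_neg\<close>)
    qed
    then have "(SUP C\<in>{C \<in> sets M. C \<subseteq> A}. ennreal (s C) + ennreal (s D)) \<le> f (A \<union> B)"
      if "D \<in> sets M" "D \<subseteq> B" for D using that by (intro SUP_least) auto
    then have "(SUP C\<in>{C \<in> sets M. C \<subseteq> A}. ennreal (s C)) + ennreal (s D) \<le> f (A \<union> B)"
      if "D \<in> sets M" "D \<subseteq> B" for D using that by (subst (asm) ennreal_SUP_add_left[OF ne]) auto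
    then have "f A + ennreal (s D) \<le> f (A \<union> B)" if "D \<in> sets M" "D \<subseteq> B" for D
      using that by (simp add: f_def)
    then have "(SUP D\<in>{D \<in> sets M. D \<subseteq> B}. f A + ennreal (s D)) \<le> f (A \<union> B)"
      by (intro SUP_least) auto
    then show ?thesis
      using ennreal_SUP_add_right[OF ne[of B], of "f A" "\<lambda>D. ennreal (s D)"] by (simp add: f_def)
  qed
  have f0: "f {} = 0"
    using signed_measure_empty[OF s] by (auto simp: f_def SUP_eq_const intro!: antisym SUP_least)
  have "emeasure (pos_variation M s) A = f A"
  proof (rule emeasure_measure_of[OF _ sets.space_closed])
    show "pos_variation M s = measure_of (space M) (sets M) f"
      by (simp add: pos_variation_def f_def)
    show "A \<in> sets (pos_variation M s)" using A by (simp add: pos_variation_def)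
    show "positive (sets (pos_variation M s)) f" by (simp add: positive_def f0)
    show "countably_additive (sets (pos_variation M s)) f"
    proof (rule countably_additiveI)
      fix A :: "nat \<Rightarrow> 'a set"
      assume "range A \<subseteq> sets (pos_variation M s)" and dA: "disjoint_family A"
      then have rA: "A i \<in> sets M" for i by (auto simp: pos_variation_def)
      have fin: "(\<Sum>i<n. f (A i)) \<le> f (\<Union>i<n. A i)" for n
      proof (induction n)
        case (Suc n)
        have "(\<Sum>i<Suc n. f (A i)) \<le> f (\<Union>i<n. A i) + f (A n)" using Suc by (simp add: add_mono)
        also have "\<dots> \<le> f ((\<Union>i<n. A i) \<union> A n)"
        proof (rule super)
          have "A i \<inter> A n = {}" if "i < n" for i
            using dA that by (auto simp: disjoint_family_on_def)
          then show "(\<Union>i<n. A i) \<inter> A n = {}" by auto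
        qed (use rA in auto)
        also have "(\<Union>i<n. A i) \<union> A n = (\<Union>i<Suc n. A i)" by (auto simp: less_Suc_eq)
        finally show ?case .
      qed (simp add: f0)
      show "(\<Sum>i. f (A i)) = f (\<Union>i. A i)"
      proof (rule antisym)
        have "(\<Sum>i<n. f (A i)) \<le> f (\<Union>i. A i)" for n
        proof -
          have "f (\<Union>i<n. A i) \<le> f (\<Union>i. A i)"
            unfolding f_def by (rule SUP_subset_mono) auto
          with fin[of n] show ?thesis by (rule order_trans)
        qed
        then show "(\<Sum>i. f (A i)) \<le> f (\<Union>i. A i)"
          by (auto simp: suminf_eq_SUP intro: SUP_least)
        have "ennreal (s B) \<le> (\<Sum>i. f (A i))" if B: "B \<in> sets M" "B \<subseteq> (\<Union>i. A i)" for B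
        proof -
          have "(\<lambda>n. s (B \<inter> A n)) sums s (\<Union>n. B \<inter> A n)"
          proof (intro s[unfolded signed_measure_def, THEN conjunct1, rule_format])
            show "disjoint_family (\<lambda>n. B \<inter> A n)"
              using dA by (rule disjoint_family_on_bisimulation) auto
          qed (use rA B in auto)
          moreover have "(\<Union>n. B \<inter> A n) = B" using B by auto
          ultimately have "(\<lambda>n. ennreal (\<Sum>i<n. s (B \<inter> A i))) \<longlonglongrightarrow> ennreal (s B)"
            by (intro tendsto_ennrealI) (simp add: sums_def)
          moreover have "ennreal (\<Sum>i<n. s (B \<inter> A i)) \<le> (\<Sum>i. f (A i))" for n
          proof -
            have "ennreal (\<Sum>i<n. s (B \<inter> A i)) \<le> (\<Sum>i<n. f (A i))"
              by (rule order_trans[OF ennreal_sum_le sum_mono]) (use B rA in \<open>auto intro!: fub\<close>)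
            also have "\<dots> \<le> (\<Sum>i. f (A i))" by (intro sum_le_suminf) auto
            finally show ?thesis .
          qed
          ultimately show ?thesis by (intro LIMSEQ_le_const2) auto
        qed
        then show "f (\<Union>i. A i) \<le> (\<Sum>i. f (A i))"
          by (subst fd) (intro SUP_least, auto)
      qed
    qed
  qed
  then show ?thesis by (simp add: f_def)
qed

lemma sets_pos_variation [simp, measurable_cong]: "sets (pos_variation M s) = sets M"
  by (simp add: pos_variation_def)

lemma space_pos_variation [simp]: "space (pos_variation M s) = space M"
  by (simp add: pos_variation_def)

lemma finite_measure_pos_variation:
  assumes s: "signed_measure M s"
  shows "finite_measure (pos_variation M s)"
proof -
  obtain C where C: "\<And>A. A \<in> sets M \<Longrightarrow> \<bar>s A\<bar> \<le> C" using s by (auto simp: signed_measure_def)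
  have "emeasure (pos_variation M s) (space M) \<le> ennreal C"
    unfolding pos_variation_emeasure[OF s sets.top]
    by (rule SUP_least) (use C in \<open>auto intro!: ennreal_leI simp: abs_le_iff\<close>)
  then show ?thesis by (intro finite_measureI) (auto simp: top_unique)
qed

lemma pos_variation_upper:
  assumes s: "signed_measure M s" and "A \<in> sets M" "B \<in> sets M" "B \<subseteq> A"
  shows "s B \<le> measure (pos_variation M s) A"
proof -
  interpret finite_measure "pos_variation M s" by (rule finite_measure_pos_variation[OF s])
  have "ennreal (s B) \<le> emeasure (pos_variation M s) A"
    unfolding pos_variation_emeasure[OF s assms(2)] by (rule SUP_upper) (use assms in auto)
  then show ?thesis by (simp add: emeasure_eq_measure)
qed

lemma pos_variation_least:
  assumes s: "signed_measure M s" and "A \<in> sets M" "0 \<le> c" "\<And>B. B \<in> sets M \<Longrightarrow> B \<subseteq> A \<Longrightarrow> s B \<le> c"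
  shows "measure (pos_variation M s) A \<le> c"
proof -
  interpret finite_measure "pos_variation M s" by (rule finite_measure_pos_variation[OF s])
  have "emeasure (pos_variation M s) A \<le> ennreal c"
    unfolding pos_variation_emeasure[OF s assms(2)] by (rule SUP_least) (use assms in \<open>auto intro: ennreal_leI\<close>)
  then show ?thesis using assms(3) by (simp add: emeasure_eq_measure)
qed

text \<open>For \<open>B \<subseteq> A\<close> the value at \<open>B\<close> is the value at
  \<open>A\<close> plus that of the negative at \<open>A - B\<close>. The supremum over
  \<open>B\<close> bounds the positive variation by \<open>t A\<close> plus the negative variation;
  the same inequality for the negative of \<open>s\<close> closes the gap.\<close>

lemma jordan_decomposition:
  assumes s: "signed_measure M s" and A: "A \<in> sets M"
  shows "s A = measure (pos_variation M s) A - measure (pos_variation M (\<lambda>A. - s A)) A"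
proof -
  have le: "measure (pos_variation M t) A \<le> t A + measure (pos_variation M (\<lambda>A. - t A)) A"
    if t: "signed_measure M t" for t
  proof (rule pos_variation_least[OF t A])
    note t' = signed_measure_uminus[OF t]
    show "0 \<le> t A + measure (pos_variation M (\<lambda>A. - t A)) A"
      using pos_variation_upper[OF t' A A] by simp
    fix B assume B: "B \<in> sets M" "B \<subseteq> A"
    show "t B \<le> t A + measure (pos_variation M (\<lambda>A. - t A)) A"
      using signed_measure_Diff[OF t A B] pos_variation_upper[OF t' A, of "A - B"] A B by auto
  qed
  from le[OF s] le[OF signed_measure_uminus[OF s]] show ?thesis by simp
qed

lemma integrable_bounded_finite:
  fixes f :: "'a \<Rightarrow> 'b::{banach,second_countable_topology}"
  assumes "finite_measure M" "f \<in> borel_measurable M" "\<And>x. x \<in> space M \<Longrightarrow> norm (f x) \<le> B"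
  shows "integrable M f" "norm (integral\<^sup>L M f) \<le> B * measure M (space M)"
proof -
  interpret finite_measure M by fact
  show i: "integrable M f"
    by (rule integrable_const_bound[of _ B]) (use assms in auto)
  have "norm (integral\<^sup>L M f) \<le> (LINT x|M. norm (f x))" by (rule integral_norm_bound)
  also have "\<dots> \<le> (LINT x|M. B)"
    by (rule integral_mono) (use i assms in auto)
  also have "\<dots> = B * measure M (space M)" by (simp add: lebesgue_integral_const)
  finally show "norm (integral\<^sup>L M f) \<le> B * measure M (space M)" .
qed

lemma integral_bounded_tendsto:
  fixes f :: "nat \<Rightarrow> 'a \<Rightarrow> complex"
  assumes "finite_measure M" "\<And>n. f n \<in> borel_measurable M" "g \<in> borel_measurable M"
    "\<And>x. x \<in> space M \<Longrightarrow> (\<lambda>n. f n x) \<longlonglongrightarrow> g x" "\<And>n x. x \<in> space M \<Longrightarrow> cmod (f n x) \<le> B"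
  shows "(\<lambda>n. integral\<^sup>L M (f n)) \<longlonglongrightarrow> integral\<^sup>L M g"
proof -
  interpret finite_measure M by fact
  show ?thesis
    by (rule integral_dominated_convergence[where w="\<lambda>_. B"]) (use assms in auto)
qed

lemma complex_measure_bound:
  assumes "\<kappa> \<in> complex_measures M" "A \<in> sets M"
  shows "cmod (\<kappa> A) \<le> enn2real (total_variation M \<kappa>)"
proof -
  have "ennreal (cmod (\<kappa> A)) \<le> total_variation M \<kappa>"
    unfolding total_variation_def
    by (rule SUP_upper2[of "{A}"]) (use assms in auto)
  moreover have "total_variation M \<kappa> < \<infinity>" using assms by (simp add: complex_measures_def)
  ultimately show ?thesis by (cases "total_variation M \<kappa>") auto
qed

lemma signed_measure_Re_Im:
  assumes "\<kappa> \<in> complex_measures M"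
  shows "signed_measure M (\<lambda>A. Re (\<kappa> A))" "signed_measure M (\<lambda>A. Im (\<kappa> A))"
proof -
  have sums: "(\<lambda>n. \<kappa> (A n)) sums \<kappa> (\<Union>n. A n)" if "range A \<subseteq> sets M" "disjoint_family A" for A :: "nat \<Rightarrow> _"
    using assms that by (auto simp: complex_measures_def)
  have "\<forall>A\<in>sets M. \<bar>Re (\<kappa> A)\<bar> \<le> enn2real (total_variation M \<kappa>)"
    "\<forall>A\<in>sets M. \<bar>Im (\<kappa> A)\<bar> \<le> enn2real (total_variation M \<kappa>)"
    using complex_measure_bound[OF assms] abs_Re_le_cmod abs_Im_le_cmod order_trans by blast+
  then show "signed_measure M (\<lambda>A. Re (\<kappa> A))" "signed_measure M (\<lambda>A. Im (\<kappa> A))"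
    unfolding signed_measure_def using sums_Re[OF sums] sums_Im[OF sums] by blast+
qed

lemma signed_integral_bound:
  assumes s: "signed_measure M s" and b: "\<And>A. A \<in> sets M \<Longrightarrow> \<bar>s A\<bar> \<le> C"
    and [measurable]: "\<phi> \<in> borel_measurable M" and B: "\<And>x. x \<in> space M \<Longrightarrow> cmod (\<phi> x) \<le> B" "0 \<le> B"
  shows "cmod (signed_integral M s \<phi>) \<le> 2 * B * C"
proof -
  have C: "0 \<le> C" using b[of "{}"] by auto
  have *: "cmod (LINT z|pos_variation M t. \<phi> z) \<le> B * C" if t: "signed_measure M t" "\<And>A. A \<in> sets M \<Longrightarrow> t A \<le> C" for t
  proof -
    have "cmod (LINT z|pos_variation M t. \<phi> z) \<le> B * measure (pos_variation M t) (space M)"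
      using integrable_bounded_finite(2)[OF finite_measure_pos_variation[OF t(1)], of \<phi> B] B by auto
    also have "\<dots> \<le> B * C"
      using B by (intro mult_left_mono pos_variation_least[OF t(1) _ C t(2)]) auto
    finally show ?thesis .
  qed
  have "cmod (signed_integral M s \<phi>) \<le> cmod (LINT z|pos_variation M s. \<phi> z) + cmod (LINT z|pos_variation M (\<lambda>A. - s A). \<phi> z)"
    unfolding signed_integral_def by (rule norm_triangle_ineq4)
  also have "\<dots> \<le> B * C + B * C"
    using b by (intro add_mono * s signed_measure_uminus) (auto simp: abs_le_iff)
  finally show ?thesis by simp
qed

text \<open>The factor 4 counts the positive and negative variations of real and imaginary part. It
  is crude, but serves as a majorant that does not depend on \<phi>.\<close>

lemma cm_integral_bound:
  assumes \<kappa>: "\<kappa> \<in> complex_measures M" and [measurable]: "\<phi> \<in> borel_measurable M"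
    and B: "\<And>x. x \<in> space M \<Longrightarrow> cmod (\<phi> x) \<le> B" "0 \<le> B"
  shows "cmod (cm_integral M \<kappa> \<phi>) \<le> 4 * B * enn2real (total_variation M \<kappa>)"
proof -
  have b: "\<bar>Re (\<kappa> A)\<bar> \<le> enn2real (total_variation M \<kappa>)" "\<bar>Im (\<kappa> A)\<bar> \<le> enn2real (total_variation M \<kappa>)"
    if "A \<in> sets M" for A
    using complex_measure_bound[OF \<kappa> that] abs_Re_le_cmod abs_Im_le_cmod order_trans by blast+
  have "cmod (cm_integral M \<kappa> \<phi>) \<le> cmod (signed_integral M (\<lambda>A. Re (\<kappa> A)) \<phi>) + cmod (signed_integral M (\<lambda>A. Im (\<kappa> A)) \<phi>)"
    unfolding cm_integral_def using norm_triangle_ineq[of _ "\<i> * signed_integral M (\<lambda>A. Im (\<kappa> A)) \<phi>"] by (simp add: norm_mult)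
  also have "\<dots> \<le> 2 * B * enn2real (total_variation M \<kappa>) + 2 * B * enn2real (total_variation M \<kappa>)"
    by (intro add_mono signed_integral_bound signed_measure_Re_Im[OF \<kappa>] b B) auto
  finally show ?thesis by simp
qed

lemma cm_integral_tendsto:
  fixes f :: "nat \<Rightarrow> 'a \<Rightarrow> complex"
  assumes \<kappa>: "\<kappa> \<in> complex_measures M"
    and m: "\<And>n. f n \<in> borel_measurable M" "g \<in> borel_measurable M"
    and l: "\<And>x. x \<in> space M \<Longrightarrow> (\<lambda>n. f n x) \<longlonglongrightarrow> g x" "\<And>n x. x \<in> space M \<Longrightarrow> cmod (f n x) \<le> B"
  shows "(\<lambda>n. cm_integral M \<kappa> (f n)) \<longlonglongrightarrow> cm_integral M \<kappa> g"
proof -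
  have *: "(\<lambda>n. LINT z|pos_variation M s. f n z) \<longlonglongrightarrow> (LINT z|pos_variation M s. g z)" if "signed_measure M s" for s
    by (rule integral_bounded_tendsto[OF finite_measure_pos_variation[OF that]])
      (use m l in \<open>auto simp: measurable_cong_sets[OF sets_pos_variation refl]\<close>)
  show ?thesis unfolding cm_integral_def signed_integral_def
    by (intro tendsto_intros * signed_measure_uminus signed_measure_Re_Im[OF \<kappa>])
qed

lemma cm_integral_indicator:
  assumes \<kappa>: "\<kappa> \<in> complex_measures M" and A: "A \<in> sets M"
  shows "cm_integral M \<kappa> (indicator A) = \<kappa> A"
proof -
  have *: "(LINT z|pos_variation M s. indicator A z) = complex_of_real (measure (pos_variation M s) A)"
    if "signed_measure M s" for s
  proof -
    interpret finite_measure "pos_variation M s" by (rule finite_measure_pos_variation[OF that])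
    have "(indicator A :: 'a \<Rightarrow> complex) = (\<lambda>z. of_real (indicator A z))"
      by (auto simp: indicator_def)
    then show ?thesis using A sets.sets_into_space[OF A] by (simp add: Int_absorb2)
  qed
  have **: "signed_integral M s (indicator A) = of_real (s A)" if s: "signed_measure M s" for s
    using jordan_decomposition[OF s A] by (simp add: signed_integral_def * s signed_measure_uminus)
  show ?thesis
    by (simp add: cm_integral_def ** signed_measure_Re_Im[OF \<kappa>] flip: complex_eq)
qed

section \<open>Refining sequences of finite partitions\<close>

text \<open>\<open>c N z\<close> is the label of the cell of the \<open>N\<close>-th partition that
  contains \<open>z\<close>. With labels in place of set families, partitions of products and
  subspaces are obtained by pairing and restricting functions.\<close>

locale coding =
  fixes M :: "'a measure" and c :: "nat \<Rightarrow> 'a \<Rightarrow> 'c"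
  assumes refine: "\<And>N N' y z. N \<le> N' \<Longrightarrow> y \<in> space M \<Longrightarrow> z \<in> space M \<Longrightarrow> c N' y = c N' z \<Longrightarrow> c N y = c N z"
    and finite_range: "finite (c N ` space M)"
    and generated: "sets M = sigma_sets (space M) {{y \<in> space M. c N y \<in> R} |N R. True}"
begin

lemma cell_sets [measurable]: "{y \<in> space M. c N y \<in> R} \<in> sets M"
  unfolding generated by (rule sigma_sets.Basic) blast

lemma cell_sets1 [measurable]: "{y \<in> space M. c N y = a} \<in> sets M"
  using cell_sets[of N "{a}"] by simp

text \<open>The sets that can be approximated by unions of cells form a \<sigma>-algebra. Several
  measures are treated at once because a signed measure is controlled only through its two
  variations, and absolute continuity compares these with a further measure.\<close>

lemma approximation:
  assumes T: "finite T" "\<And>\<tau>. \<tau> \<in> T \<Longrightarrow> finite_measure \<tau>" "\<And>\<tau>. \<tau> \<in> T \<Longrightarrow> sets \<tau> = sets M"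
    and S: "S \<in> sets M" and e: "e > 0"
  shows "\<exists>N R. \<forall>\<tau>\<in>T. measure \<tau> (sym_diff S {y \<in> space M. c N y \<in> R}) < e"
  using S[unfolded generated] e
proof (induction arbitrary: e rule: sigma_sets.induct)
  case (Basic a)
  then obtain N R where "a = {y \<in> space M. c N y \<in> R}" by blast
  with Basic show ?case by (intro exI[of _ N] exI[of _ R]) simp
next
  case Empty
  then show ?case by (intro exI[of _ 0] exI[of _ "{}"]) simp
next
  case (Compl a)
  obtain N R where NR: "\<forall>\<tau>\<in>T. measure \<tau> (sym_diff a {y \<in> space M. c N y \<in> R}) < e"
    using Compl.IH[OF Compl.prems] by blast
  have "a \<in> sets M" using Compl.hyps unfolding generated[symmetric] .
  then have "a \<subseteq> space M" by (rule sets.sets_into_space)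
  then have "sym_diff (space M - a) {y \<in> space M. c N y \<in> - R} = sym_diff a {y \<in> space M. c N y \<in> R}" by auto
  with NR show ?case by (intro exI[of _ N] exI[of _ "- R"]) simp
next
  case (Union a)
  have am: "a i \<in> sets M" for i using Union.hyps(1)[of i] unfolding generated[symmetric] .
  have ev: "\<forall>\<^sub>F n in sequentially. measure \<tau> ((\<Union>i. a i) - (\<Union>i<n. a i)) < e / 2" if \<tau>: "\<tau> \<in> T" for \<tau>
  proof -
    interpret finite_measure \<tau> using T \<tau> by auto
    have "(\<lambda>n. measure \<tau> ((\<Union>i. a i) - (\<Union>i<n. a i))) \<longlonglongrightarrow> measure \<tau> (\<Inter>n. (\<Union>i. a i) - (\<Union>i<n. a i))"
    proof (rule finite_Lim_measure_decseq)
      show "range (\<lambda>n. (\<Union>i. a i) - (\<Union>i<n. a i)) \<subseteq> sets \<tau>" using am T(3)[OF \<tau>] by auto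
      show "decseq (\<lambda>n. (\<Union>i. a i) - (\<Union>i<n. a i))" by (auto simp: decseq_def)
    qed
    moreover have E: "(\<Inter>n. (\<Union>i. a i) - (\<Union>i<n. a i)) = {}" by auto
    ultimately have "(\<lambda>n. measure \<tau> ((\<Union>i. a i) - (\<Union>i<n. a i))) \<longlonglongrightarrow> 0"
      unfolding E by simp
    from order_tendstoD(2)[OF this, of "e/2"] show ?thesis using Union.prems by simp
  qed
  have "\<forall>\<^sub>F n in sequentially. \<forall>\<tau>\<in>T. measure \<tau> ((\<Union>i. a i) - (\<Union>i<n. a i)) < e / 2"
    using ev T(1) by (simp add: eventually_ball_finite)
  then obtain n where n: "\<And>\<tau>. \<tau> \<in> T \<Longrightarrow> measure \<tau> ((\<Union>i. a i) - (\<Union>i<n. a i)) < e / 2"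
    by (auto simp: eventually_sequentially)
  \<comment> \<open>Summed over \<open>i < n\<close> the errors stay within \<open>e / 2\<close>;
    \<open>Suc n\<close> avoids division by 0 when \<open>n = 0\<close>.\<close>
  define d where "d = e / (2 * real (Suc n))"
  have d: "d > 0" using Union.prems by (simp add: d_def)
  have "\<exists>N. \<forall>i. \<exists>R. \<forall>\<tau>\<in>T. measure \<tau> (sym_diff (a i) {y \<in> space M. c (N i) y \<in> R}) < d"
    by (intro choice allI Union.IH[OF d])
  then obtain N where "\<forall>i. \<exists>R. \<forall>\<tau>\<in>T. measure \<tau> (sym_diff (a i) {y \<in> space M. c (N i) y \<in> R}) < d" by blast
  then have "\<exists>R. \<forall>i. \<forall>\<tau>\<in>T. measure \<tau> (sym_diff (a i) {y \<in> space M. c (N i) y \<in> R i}) < d"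
    by (rule choice)
  then obtain R where NR: "\<And>i \<tau>. \<tau> \<in> T \<Longrightarrow> measure \<tau> (sym_diff (a i) {y \<in> space M. c (N i) y \<in> R i}) < d"
    by blast
  define N' where "N' = Max (insert 0 (N ` {..<n}))"
  have N': "N i \<le> N'" if "i < n" for i unfolding N'_def using that by (intro Max_ge) auto
  define b where "b i = {y \<in> space M. c (N i) y \<in> R i}" for i
  \<comment> \<open>By refinement every \<open>b i\<close> is a union of cells of the common level
    \<open>N'\<close>, hence so is their finite union.\<close>
  define R' where "R' = c N' ` (\<Union>i<n. b i)"
  have b': "{y \<in> space M. c N' y \<in> R'} = (\<Union>i<n. b i)"
  proof (intro equalityI subsetI)
    fix y assume "y \<in> {y \<in> space M. c N' y \<in> R'}"
    then obtain z i where z: "y \<in> space M" "i < n" "z \<in> b i" "c N' y = c N' z" by (auto simp: R'_def)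
    then have "c (N i) y = c (N i) z" by (intro refine[OF N']) (auto simp: b_def)
    with z have "y \<in> b i" by (simp add: b_def)
    with z(2) show "y \<in> (\<Union>i<n. b i)" by blast
  qed (auto simp: R'_def b_def)
  have "measure \<tau> (sym_diff (\<Union>i. a i) (\<Union>i<n. b i)) < e" if \<tau>: "\<tau> \<in> T" for \<tau>
  proof -
    interpret finite_measure \<tau> using T \<tau> by auto
    have am'[measurable]: "a i \<in> sets \<tau>" "b i \<in> sets \<tau>" for i
      unfolding T(3)[OF \<tau>] b_def by (rule am cell_sets)+
    have sub: "sym_diff (\<Union>i. a i) (\<Union>i<n. b i) \<subseteq>
        ((\<Union>i. a i) - (\<Union>i<n. a i)) \<union> (\<Union>i<n. sym_diff (a i) (b i))" by fast
    have "measure \<tau> (sym_diff (\<Union>i. a i) (\<Union>i<n. b i)) \<le>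
        measure \<tau> (((\<Union>i. a i) - (\<Union>i<n. a i)) \<union> (\<Union>i<n. sym_diff (a i) (b i)))"
      by (rule finite_measure_mono[OF sub]) measurable
    also have "\<dots> \<le> measure \<tau> ((\<Union>i. a i) - (\<Union>i<n. a i)) + measure \<tau> (\<Union>i<n. sym_diff (a i) (b i))"
      by (rule measure_Un_le) measurable
    also have "measure \<tau> (\<Union>i<n. sym_diff (a i) (b i)) \<le> (\<Sum>i<n. measure \<tau> (sym_diff (a i) (b i)))"
      by (rule measure_UNION_le) (simp, measurable)
    also have "\<dots> \<le> (\<Sum>i<n. d)" using NR[OF \<tau>] by (intro sum_mono) (auto simp: b_def less_imp_le)
    also have "\<dots> \<le> e / 2" using Union.prems by (simp add: d_def field_simps)
    finally show ?thesis using n[OF \<tau>] by linarith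
  qed
  then show ?case unfolding b'[symmetric] by blast
qed

lemma cell_decomposition:
  assumes "finite_measure \<tau>" "sets \<tau> = sets M"
  shows "measure \<tau> {y \<in> space M. c N y \<in> R} = (\<Sum>a\<in>R \<inter> c N ` space M. measure \<tau> {y \<in> space M. c N y = a})"
proof -
  interpret finite_measure \<tau> by fact
  have "{y \<in> space M. c N y \<in> R} = (\<Union>a\<in>R \<inter> c N ` space M. {y \<in> space M. c N y = a})" by auto
  then show ?thesis
    using finite_range[of N] assms(2)
    by (auto simp: disjoint_family_on_def intro!: finite_measure_finite_Union)
qed

text \<open>A union of cells has a non-negative value by finite additivity. Approximating
  \<open>S\<close> by such a union for both variations at the same time changes the value of
  \<open>s\<close> by less than \<open>e\<close>.\<close>

lemma signed_measure_nonneg: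
  assumes s: "signed_measure M s" and cells: "\<And>N a. 0 \<le> s {y \<in> space M. c N y = a}" and S: "S \<in> sets M"
  shows "0 \<le> s S"
proof (rule field_le_epsilon)
  fix e :: real assume e: "0 < e"
  define P where "P = pos_variation M s"
  define Q where "Q = pos_variation M (\<lambda>A. - s A)"
  have PQ: "finite_measure P" "finite_measure Q" "sets P = sets M" "sets Q = sets M"
    using finite_measure_pos_variation[OF s] finite_measure_pos_variation[OF signed_measure_uminus[OF s]]
    by (auto simp: P_def Q_def)
  interpret P: finite_measure P by fact
  interpret Q: finite_measure Q by fact
  have j: "s A = measure P A - measure Q A" if "A \<in> sets M" for A
    using jordan_decomposition[OF s that] by (simp add: P_def Q_def)
  obtain N R where NR: "\<forall>\<tau>\<in>{P, Q}. measure \<tau> (sym_diff S {y \<in> space M. c N y \<in> R}) < e / 2"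
    using approximation[of "{P, Q}" S "e/2"] PQ S e by auto
  let ?S = "{y \<in> space M. c N y \<in> R}"
  have "s ?S = (\<Sum>a\<in>R \<inter> c N ` space M. s {y \<in> space M. c N y = a})"
    by (simp add: j cell_decomposition[OF PQ(1,3)] cell_decomposition[OF PQ(2,4)] sum_subtractf)
  then have "0 \<le> s ?S" by (simp add: sum_nonneg cells)
  then have "measure Q ?S \<le> measure P ?S" by (simp add: j)
  moreover have "measure P ?S \<le> measure P S + measure P (sym_diff S ?S)"
    by (rule order_trans[OF P.finite_measure_mono measure_Un_le]) (use S PQ in auto)
  moreover have "measure Q S \<le> measure Q ?S + measure Q (sym_diff S ?S)"
    by (rule order_trans[OF Q.finite_measure_mono measure_Un_le]) (use S PQ in auto)
  ultimately show "0 \<le> s S + e" using NR j[OF S] by auto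
qed

lemma signed_measure_zero:
  assumes s: "signed_measure M s" and "\<And>N a. s {y \<in> space M. c N y = a} = 0" and "S \<in> sets M"
  shows "s S = 0"
proof (rule antisym)
  show "0 \<le> s S" by (rule signed_measure_nonneg[OF s _ assms(3)]) (simp add: assms(2))
  have "0 \<le> - s S" by (rule signed_measure_nonneg[OF signed_measure_uminus[OF s] _ assms(3)]) (simp add: assms(2))
  then show "s S \<le> 0" by simp
qed

end

text \<open>Generation is put as measurability of the identity map out of the \<sigma>-algebra
  spanned by the cells. In this form it follows for products and subspaces from the usual
  measurability rules for pairs and restrictions.\<close>

lemma codingI:
  assumes "\<And>N N' y z. N \<le> N' \<Longrightarrow> y \<in> space M \<Longrightarrow> z \<in> space M \<Longrightarrow> c N' y = c N' z \<Longrightarrow> c N y = c N z"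
    and "\<And>N. finite (c N ` space M)"
    and cells: "\<And>N a. {y \<in> space M. c N y = a} \<in> sets M"
    and id: "\<And>\<A>. \<lbrakk>sigma_algebra (space M) \<A>; \<And>N R. {y \<in> space M. c N y \<in> R} \<in> \<A>\<rbrakk> \<Longrightarrow>
      (\<lambda>y. y) \<in> sigma (space M) \<A> \<rightarrow>\<^sub>M M"
  shows "coding M c"
proof
  let ?G = "{{y \<in> space M. c N y \<in> R} |N R. True}"
  have G: "?G \<subseteq> Pow (space M)" by auto
  have "sets M \<subseteq> sigma_sets (space M) ?G"
  proof
    fix A assume A: "A \<in> sets M"
    have sa: "sigma_algebra (space M) (sigma_sets (space M) ?G)"
      by (rule sigma_algebra_sigma_sets[OF G])
    then interpret sigma_algebra "space M" "sigma_sets (space M) ?G" .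
    have "(\<lambda>y. y) \<in> sigma (space M) (sigma_sets (space M) ?G) \<rightarrow>\<^sub>M M"
      by (rule id[OF sa]) (blast intro: sigma_sets.Basic)
    from measurable_sets[OF this A] show "A \<in> sigma_sets (space M) ?G"
      using sets.sets_into_space[OF A] unfolding sets_measure_of_eq space_measure_of_eq by (simp add: Int_absorb2)
  qed
  moreover have "sigma_sets (space M) ?G \<subseteq> sets M"
  proof (rule sets.sigma_sets_subset, clarify)
    fix N R
    have "{y \<in> space M. c N y \<in> R} = (\<Union>a\<in>R \<inter> c N ` space M. {y \<in> space M. c N y = a})" by auto
    also have "\<dots> \<in> sets M" using assms(2)[of N] cells by (intro sets.finite_UN) auto
    finally show "{y \<in> space M. c N y \<in> R} \<in> sets M" .
  qed
  ultimately show "sets M = sigma_sets (space M) ?G" by (rule antisym)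
qed fact+

lemma coding_prod:
  assumes "coding M1 c1" "coding M2 c2"
  shows "coding (M1 \<Otimes>\<^sub>M M2) (\<lambda>N z. (c1 N (fst z), c2 N (snd z)))"
proof -
  interpret c1: coding M1 c1 by fact
  interpret c2: coding M2 c2 by fact
  show ?thesis
  proof (rule codingI)
    fix N N' y z assume "N \<le> N'" "y \<in> space (M1 \<Otimes>\<^sub>M M2)" "z \<in> space (M1 \<Otimes>\<^sub>M M2)"
      "(c1 N' (fst y), c2 N' (snd y)) = (c1 N' (fst z), c2 N' (snd z))"
    then show "(c1 N (fst y), c2 N (snd y)) = (c1 N (fst z), c2 N (snd z))"
      using c1.refine[of N N' "fst y" "fst z"] c2.refine[of N N' "snd y" "snd z"]
      by (auto simp: space_pair_measure)
  next
    fix N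
    have "(\<lambda>z. (c1 N (fst z), c2 N (snd z))) ` space (M1 \<Otimes>\<^sub>M M2) \<subseteq> c1 N ` space M1 \<times> c2 N ` space M2"
      by (auto simp: space_pair_measure)
    then show "finite ((\<lambda>z. (c1 N (fst z), c2 N (snd z))) ` space (M1 \<Otimes>\<^sub>M M2))"
      using finite_subset c1.finite_range c2.finite_range by blast
  next
    fix N and a :: "'b \<times> 'd"
    have "{z \<in> space (M1 \<Otimes>\<^sub>M M2). (c1 N (fst z), c2 N (snd z)) = a} =
        {y \<in> space M1. c1 N y = fst a} \<times> {y \<in> space M2. c2 N y = snd a}"
      by (auto simp: space_pair_measure)
    then show "{z \<in> space (M1 \<Otimes>\<^sub>M M2). (c1 N (fst z), c2 N (snd z)) = a} \<in> sets (M1 \<Otimes>\<^sub>M M2)" by auto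
  next
    fix \<A> assume sa: "sigma_algebra (space (M1 \<Otimes>\<^sub>M M2)) \<A>"
      and cyl: "\<And>N R. {z \<in> space (M1 \<Otimes>\<^sub>M M2). (c1 N (fst z), c2 N (snd z)) \<in> R} \<in> \<A>"
    interpret sigma_algebra "space (M1 \<Otimes>\<^sub>M M2)" \<A> by fact
    let ?N = "sigma (space (M1 \<Otimes>\<^sub>M M2)) \<A>"
    have sN: "space ?N = space (M1 \<Otimes>\<^sub>M M2)" "sets ?N = \<A>"
      by (rule space_measure_of_eq sets_measure_of_eq)+
    have f: "fst \<in> ?N \<rightarrow>\<^sub>M M1"
    proof (rule measurable_sigma_sets[OF c1.generated])
      fix A assume "A \<in> {{y \<in> space M1. c1 N y \<in> R} |N R. True}"
      then obtain N R where A: "A = {y \<in> space M1. c1 N y \<in> R}" by blast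
      have e: "fst -` A \<inter> space ?N = {z \<in> space (M1 \<Otimes>\<^sub>M M2). (c1 N (fst z), c2 N (snd z)) \<in> R \<times> UNIV}"
        unfolding sN by (auto simp: A space_pair_measure)
      show "fst -` A \<inter> space ?N \<in> sets ?N" unfolding sN(2) e by (rule cyl)
    next
      show "fst \<in> space ?N \<rightarrow> space M1" unfolding sN(1) by (auto simp: space_pair_measure)
      show "{{y \<in> space M1. c1 N y \<in> R} |N R. True} \<subseteq> Pow (space M1)" by auto
    qed
    have g: "snd \<in> ?N \<rightarrow>\<^sub>M M2"
    proof (rule measurable_sigma_sets[OF c2.generated])
      fix A assume "A \<in> {{y \<in> space M2. c2 N y \<in> R} |N R. True}"
      then obtain N R where A: "A = {y \<in> space M2. c2 N y \<in> R}" by blast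
      have e: "snd -` A \<inter> space ?N = {z \<in> space (M1 \<Otimes>\<^sub>M M2). (c1 N (fst z), c2 N (snd z)) \<in> UNIV \<times> R}"
        unfolding sN by (auto simp: A space_pair_measure)
      show "snd -` A \<inter> space ?N \<in> sets ?N" unfolding sN(2) e by (rule cyl)
    next
      show "snd \<in> space ?N \<rightarrow> space M2" unfolding sN(1) by (auto simp: space_pair_measure)
      show "{{y \<in> space M2. c2 N y \<in> R} |N R. True} \<subseteq> Pow (space M2)" by auto
    qed
    show "(\<lambda>y. y) \<in> ?N \<rightarrow>\<^sub>M M1 \<Otimes>\<^sub>M M2"
      using measurable_Pair[OF f g] by (simp only: prod.collapse)
  qed
qed

lemma coding_restrict:
  assumes "coding M c"
  shows "coding (restrict_space M X) c"
proof -
  interpret coding M c by fact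
  have sp: "space (restrict_space M X) = X \<inter> space M" by (simp add: space_restrict_space)
  show ?thesis
  proof (rule codingI)
    show "\<And>N N' y z. N \<le> N' \<Longrightarrow> y \<in> space (restrict_space M X) \<Longrightarrow> z \<in> space (restrict_space M X) \<Longrightarrow>
        c N' y = c N' z \<Longrightarrow> c N y = c N z"
      using refine by (auto simp: sp)
    show "finite (c N ` space (restrict_space M X))" for N
      using finite_range[of N] by (rule finite_subset[rotated]) (auto simp: sp)
    show "{y \<in> space (restrict_space M X). c N y = a} \<in> sets (restrict_space M X)" for N a
    proof -
      have "{y \<in> space (restrict_space M X). c N y = a} = X \<inter> {y \<in> space M. c N y = a}" by (auto simp: sp)
      then show ?thesis by (auto simp: sets_restrict_space)
    qed
  next
    fix \<A> assume sa: "sigma_algebra (space (restrict_space M X)) \<A>"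
      and cyl: "\<And>N R. {y \<in> space (restrict_space M X). c N y \<in> R} \<in> \<A>"
    interpret sigma_algebra "space (restrict_space M X)" \<A> by fact
    let ?N = "sigma (space (restrict_space M X)) \<A>"
    have sN: "space ?N = space (restrict_space M X)" "sets ?N = \<A>"
      by (rule space_measure_of_eq sets_measure_of_eq)+
    have "(\<lambda>y. y) \<in> ?N \<rightarrow>\<^sub>M M"
    proof (rule measurable_sigma_sets[OF generated])
      fix A assume "A \<in> {{y \<in> space M. c N y \<in> R} |N R. True}"
      then obtain N R where A: "A = {y \<in> space M. c N y \<in> R}" by blast
      have e: "(\<lambda>y. y) -` A \<inter> space ?N = {y \<in> space (restrict_space M X). c N y \<in> R}"
        unfolding sN by (auto simp: A sp)
      show "(\<lambda>y. y) -` A \<inter> space ?N \<in> sets ?N" unfolding sN(2) e by (rule cyl)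
    next
      show "(\<lambda>y. y) \<in> space ?N \<rightarrow> space M" unfolding sN(1) by (auto simp: sp)
      show "{{y \<in> space M. c N y \<in> R} |N R. True} \<subseteq> Pow (space M)" by auto
    qed
    then show "(\<lambda>y. y) \<in> ?N \<rightarrow>\<^sub>M restrict_space M X"
      by (intro measurable_restrict_space2) (use sN(1) in \<open>auto simp: sp\<close>)
  qed
qed

lemma coding_cong:
  assumes "coding M c" "sets M = sets M'"
  shows "coding M' c"
  using assms(1) unfolding coding_def assms(2) sets_eq_imp_space_eq[OF assms(2)] .

section \<open>Partitions of Euclidean space by closed sets\<close>

definition closed_generator :: "nat \<Rightarrow> 'a::euclidean_space set" where
  "closed_generator = (SOME E. (\<forall>i. closed (E i)) \<and> sets borel = sigma_sets UNIV (range E))"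

text \<open>Complements of a countable base. Closed sets are chosen because their indicators are
  pointwise limits of continuous functions (\<open>closed_indicator_approx\<close>), so that cells
  come within reach of continuous test functions.\<close>

lemma closed_generator:
  "closed (closed_generator i :: 'a::euclidean_space set)"
  "sets (borel :: 'a::euclidean_space measure) = sigma_sets UNIV (range closed_generator)"
proof -
  obtain B :: "'a set set" where B: "countable B" "topological_basis B"
    using ex_countable_basis[where 'a='a] by auto
  have "sets borel = sets (sigma UNIV B)" by (rule arg_cong[OF borel_eq_countable_basis[OF B]])
  also have "\<dots> = sigma_sets UNIV B" by (rule sets_measure_of) simp
  finally have bB: "sets borel = sigma_sets UNIV B" .
  have ne: "B \<noteq> {}"
    using topological_basisE[OF B(2) open_UNIV, of undefined] by blast
  have rB: "range (from_nat_into B) = B" using ne B(1) by (rule range_from_nat_into)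
  let ?E = "\<lambda>i. - from_nat_into B i"
  have EB: "sigma_sets UNIV (range ?E) = sigma_sets UNIV B"
  proof (rule sigma_sets_eqI)
    fix A assume "A \<in> range ?E"
    then obtain i where "A = - from_nat_into B i" by (rule imageE)
    then have "A = UNIV - from_nat_into B i" by (simp only: Compl_eq_Diff_UNIV)
    moreover have "UNIV - from_nat_into B i \<in> sigma_sets UNIV B"
      by (intro sigma_sets.Compl sigma_sets.Basic from_nat_into[OF ne])
    ultimately show "A \<in> sigma_sets UNIV B" by simp
  next
    fix A assume "A \<in> B"
    then have "A \<in> range (from_nat_into B)" unfolding rB .
    then obtain i where "A = from_nat_into B i" by (rule imageE)
    then have A: "A = UNIV - ?E i" by (simp only: Compl_eq_Diff_UNIV[symmetric] double_complement)
    show "A \<in> sigma_sets UNIV (range ?E)"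
      unfolding A by (intro sigma_sets.Compl sigma_sets.Basic rangeI)
  qed
  have cl: "closed (?E i)" for i
    by (rule closed_Compl[OF topological_basis_open[OF B(2) from_nat_into[OF ne]]])
  have "\<exists>E::nat \<Rightarrow> 'a set. (\<forall>i. closed (E i)) \<and> sets borel = sigma_sets UNIV (range E)"
    by (intro exI[of _ ?E] conjI allI trans[OF bB EB[symmetric]] cl)
  then have "(\<forall>i. closed (closed_generator i :: 'a set)) \<and> sets (borel :: 'a measure) = sigma_sets UNIV (range closed_generator)"
    unfolding closed_generator_def by (rule someI_ex)
  then show "closed (closed_generator i :: 'a set)"
    "sets (borel :: 'a measure) = sigma_sets UNIV (range closed_generator)"
    by simp_all
qed

definition bits :: "nat \<Rightarrow> 'a::euclidean_space \<Rightarrow> nat set" where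
  "bits N x = {i. i < N \<and> x \<in> closed_generator i}"

lemma bits_eq_iff: "I \<subseteq> {..<N} \<Longrightarrow> bits N x = I \<longleftrightarrow> (\<forall>i<N. x \<in> closed_generator i \<longleftrightarrow> i \<in> I)"
  by (auto simp: bits_def)

lemma bits_subset: "bits N x \<subseteq> {..<N}"
  by (auto simp: bits_def)

lemma coding_bits: "coding (borel :: 'a::euclidean_space measure) bits"
proof (rule codingI)
  show "bits N y = bits N z" if "N \<le> N'" "bits N' y = bits N' z" for N N' and y z :: 'a
  proof -
    have "bits N w = bits N' w \<inter> {..<N}" for w :: 'a using that(1) by (auto simp: bits_def)
    then show ?thesis using that(2) by simp
  qed
  show "finite (bits N ` space (borel :: 'a measure))" for N
    by (rule finite_subset[of _ "Pow {..<N}"]) (use bits_subset in auto)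
  show "{y \<in> space borel. bits N y = I} \<in> sets (borel :: 'a measure)" for N I
  proof (cases "I \<subseteq> {..<N}")
    case True
    have "{y \<in> space borel. y \<in> closed_generator i \<longleftrightarrow> i \<in> I} \<in> sets (borel :: 'a measure)" for i
    proof (cases "i \<in> I")
      case False
      then have "{y \<in> space borel. y \<in> closed_generator i \<longleftrightarrow> i \<in> I} = - (closed_generator i :: 'a set)" by auto
      then show ?thesis by (simp only: borel_open[OF open_Compl[OF closed_generator(1)]])
    next
      case True
      then have "{y \<in> space borel. y \<in> closed_generator i \<longleftrightarrow> i \<in> I} = (closed_generator i :: 'a set)" by auto
      then show ?thesis by (simp only: borel_closed[OF closed_generator(1)])
    qed
    then have "{y \<in> space borel. \<forall>i\<in>{..<N}. y \<in> closed_generator i \<longleftrightarrow> i \<in> I} \<in> sets (borel :: 'a measure)"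
      by (intro sets.sets_Collect_finite_All) auto
    moreover have "bits N y = I \<longleftrightarrow> (\<forall>i\<in>{..<N}. y \<in> closed_generator i \<longleftrightarrow> i \<in> I)" for y :: 'a
      unfolding bits_eq_iff[OF True] by auto
    ultimately show ?thesis by (simp only:)
  next
    case False
    then have "bits N y \<noteq> I" for y :: 'a using bits_subset[of N y] by auto
    then show ?thesis by simp
  qed
next
  fix \<A> :: "'a set set" assume sa: "sigma_algebra (space borel) \<A>"
    and cyl: "\<And>N R. {y \<in> space borel. bits N y \<in> R} \<in> \<A>"
  interpret sigma_algebra "space borel" \<A> by fact
  let ?N = "sigma (space (borel::'a measure)) \<A>"
  have sN: "space ?N = space borel" "sets ?N = \<A>"
    by (rule space_measure_of_eq sets_measure_of_eq)+
  show "(\<lambda>y. y) \<in> ?N \<rightarrow>\<^sub>M borel"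
  proof (rule measurable_sigma_sets[OF closed_generator(2)])
    fix A :: "'a set" assume "A \<in> range closed_generator"
    then obtain i where A: "A = closed_generator i" by blast
    have e: "(\<lambda>y. y) -` A \<inter> space ?N = {y \<in> space borel. bits (Suc i) y \<in> {I. i \<in> I}}"
      unfolding sN by (auto simp: A bits_def)
    show "(\<lambda>y. y) -` A \<inter> space ?N \<in> sets ?N" unfolding sN(2) e by (rule cyl)
  qed auto
qed

lemma closed_indicator_approx:
  fixes F :: "'a::euclidean_space set"
  assumes "closed F"
  obtains e :: "nat \<Rightarrow> 'a \<Rightarrow> real" where "\<And>n. continuous_on UNIV (e n)" "\<And>n x. 0 \<le> e n x" "\<And>n x. e n x \<le> 1"
    "\<And>x. (\<lambda>n. e n x) \<longlonglongrightarrow> indicator F x"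
proof (cases "F = {}")
  case True
  then show ?thesis using that[of "\<lambda>_ _. 0"] by simp
next
  case False
  define e where "e = (\<lambda>(n::nat) x. max 0 (1 - real n * infdist x F))"
  have "(\<lambda>n. e n x) \<longlonglongrightarrow> indicator F x" for x
  proof (cases "x \<in> F")
    case True
    then show ?thesis by (simp add: e_def)
  next
    case x: False
    have pos: "infdist x F > 0"
      using in_closed_iff_infdist_zero[OF assms False, of x] x infdist_nonneg[of x F] by linarith
    obtain k where "1 / infdist x F \<le> real k" using real_arch_simple by blast
    then have k: "1 \<le> real k * infdist x F" using pos by (simp add: pos_divide_le_eq)
    have "e n x = 0" if "n \<ge> k" for n
    proof -
      have "real k * infdist x F \<le> real n * infdist x F" using that pos by (intro mult_right_mono) auto
      then show ?thesis using k by (simp add: e_def)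
    qed
    then have "\<forall>\<^sub>F n in sequentially. e n x = 0" by (auto simp: eventually_sequentially)
    then show ?thesis using x by (simp add: tendsto_eventually)
  qed
  moreover have "continuous_on UNIV (e n)" for n
    unfolding e_def by (intro continuous_intros)
  moreover have "0 \<le> e n x" "e n x \<le> 1" for n x
    by (auto simp: e_def infdist_nonneg)
  ultimately show ?thesis using that by blast
qed

text \<open>A cell is an intersection of generators and complements of generators, so a product of
  the approximations \<open>e\<close> and \<open>1 - e\<close> converges to its indicator. The
  additional factor tends to 1 and supplies the compact support of a test function.\<close>

lemma bits_cell_approx:
  fixes I :: "nat set"
  obtains f :: "nat \<Rightarrow> 'a::euclidean_space \<Rightarrow> real" where
    "\<And>n. continuous_on UNIV (f n)" "\<And>n x. 0 \<le> f n x" "\<And>n x. f n x \<le> 1"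
    "\<And>n x. norm x > real n \<Longrightarrow> f n x = 0"
    "\<And>x. (\<lambda>n. f n x) \<longlonglongrightarrow> indicator {x. bits N x = I} x"
proof (cases "I \<subseteq> {..<N}")
  case False
  then have "bits N x \<noteq> I" for x :: 'a using bits_subset[of N x] by auto
  then show ?thesis using that[of "\<lambda>_ _. 0"] by simp
next
  case True
  have "\<exists>e. (\<forall>n. continuous_on UNIV (e n)) \<and> (\<forall>n x. 0 \<le> e n x) \<and> (\<forall>n x. e n x \<le> (1::real)) \<and>
      (\<forall>x::'a. (\<lambda>n. e n x) \<longlonglongrightarrow> indicator (closed_generator i) x)" for i
    using closed_indicator_approx[OF closed_generator(1)[of i]] by metis
  then have "\<exists>e. \<forall>i. (\<forall>n. continuous_on UNIV (e i n)) \<and> (\<forall>n x. 0 \<le> e i n x) \<and> (\<forall>n x. e i n x \<le> (1::real)) \<and>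
      (\<forall>x::'a. (\<lambda>n. e i n x) \<longlonglongrightarrow> indicator (closed_generator i) x)"
    by (intro choice) blast
  then obtain e where e: "\<And>i n. continuous_on UNIV (e i n)" "\<And>i n x. 0 \<le> e i n x" "\<And>i n x. e i n x \<le> (1::real)"
      "\<And>i (x::'a). (\<lambda>n. e i n x) \<longlonglongrightarrow> indicator (closed_generator i) x"
    by blast
  define h where "h = (\<lambda>n i x. if i \<in> I then e i n x else 1 - e i n x)"
  define f where "f = (\<lambda>n x. max 0 (min 1 (real n - norm x)) * (\<Prod>i<N. h n i x))"
  have h01: "0 \<le> h n i x" "h n i x \<le> 1" for n i x using e(2,3) by (auto simp: h_def)
  have hc: "continuous_on UNIV (h n i)" for n i
    unfolding h_def by (cases "i \<in> I") (auto intro!: continuous_intros e)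
  have p01: "0 \<le> (\<Prod>i<N. h n i x)" "(\<Prod>i<N. h n i x) \<le> 1" for n x
    using h01 by (auto intro: prod_nonneg prod_le_1)
  have "(\<lambda>n. f n x) \<longlonglongrightarrow> indicator {x. bits N x = I} x" for x
  proof -
    have hl: "(\<lambda>n. h n i x) \<longlonglongrightarrow> (if x \<in> closed_generator i \<longleftrightarrow> i \<in> I then 1 else 0)" for i
    proof (cases "i \<in> I")
      case True
      then show ?thesis using e(4)[of i x] by (auto simp: h_def indicator_def)
    next
      case False
      have "(\<lambda>n. 1 - e i n x) \<longlonglongrightarrow> 1 - indicator (closed_generator i) x" by (intro tendsto_intros e)
      then show ?thesis using False by (auto simp: h_def indicator_def)
    qed
    have "(\<lambda>n. max 0 (min 1 (real n - norm x))) \<longlonglongrightarrow> 1"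
    proof (rule tendsto_eventually)
      obtain k where "norm x + 1 \<le> real k" using real_arch_simple by blast
      then show "\<forall>\<^sub>F n in sequentially. max 0 (min 1 (real n - norm x)) = 1"
        by (intro eventually_sequentiallyI[of k]) auto
    qed
    then have "(\<lambda>n. f n x) \<longlonglongrightarrow> 1 * (\<Prod>i<N. if x \<in> closed_generator i \<longleftrightarrow> i \<in> I then 1 else 0)"
      unfolding f_def by (intro tendsto_intros hl)
    also have "1 * (\<Prod>i<N. if x \<in> closed_generator i \<longleftrightarrow> i \<in> I then 1 else (0::real)) = indicator {x. bits N x = I} x"
      by (auto simp: indicator_def bits_eq_iff[OF True] intro!: prod.neutral)
    finally show ?thesis .
  qed
  moreover have "continuous_on UNIV (f n)" for n
    unfolding f_def by (intro continuous_intros hc)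
  moreover have "0 \<le> f n x" for n x
    using p01(1)[of n x] by (simp add: f_def)
  moreover have "f n x \<le> 1" for n x
    unfolding f_def by (rule mult_le_one[OF _ p01]) auto
  moreover have "f n x = 0" if "norm x > real n" for n x
    using that by (simp add: f_def)
  ultimately show ?thesis using that by blast
qed

text \<open>The majorant \<open>t\<close> will be a total variation, which is not assumed to be
  measurable; \<open>nn_integral\<close> is then a lower integral. The countable supremum
  \<open>H\<close> of the functions \<open>cmod (f n w) / c\<close> is measurable and lies below
  \<open>t\<close>, so it has a finite square integral and dominates in place of
  \<open>t\<close>.\<close>

lemma dominated_by_lower_integral:
  fixes f :: "nat \<Rightarrow> 'w \<Rightarrow> complex" and t :: "'w \<Rightarrow> real"
  assumes f [measurable]: "\<And>n. f n \<in> borel_measurable M" and le: "\<And>n w. cmod (f n w) \<le> c * t w" and c: "0 < c"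
    and T: "(\<integral>\<^sup>+w. (ennreal (t w))\<^sup>2 \<partial>M) < \<infinity>"
    and lim: "\<And>w. (\<lambda>n. f n w) \<longlonglongrightarrow> g w"
    and a: "a \<in> L2 M"
  shows "g \<in> L2 M" "f n \<in> L2 M" "(\<lambda>n. LINT w|M. a w * f n w) \<longlonglongrightarrow> (LINT w|M. a w * g w)"
proof -
  have g [measurable]: "g \<in> borel_measurable M"
    by (rule borel_measurable_LIMSEQ_metric[OF f]) (rule lim)
  define H where "H w = (SUP n. ennreal (cmod (f n w) / c))" for w
  have [measurable]: "H \<in> borel_measurable M" unfolding H_def by measurable
  have Ht: "H w \<le> ennreal (t w)" for w
    unfolding H_def using le[of _ w] c by (intro SUP_least ennreal_leI) (simp add: divide_le_eq mult.commute)
  define h where "h w = enn2real (H w)" for w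
  have [measurable]: "h \<in> borel_measurable M" unfolding h_def by measurable
  have h0: "0 \<le> h w" for w by (simp add: h_def)
  have hH: "ennreal (h w) = H w" for w
    unfolding h_def using Ht[of w] by (intro ennreal_enn2real) (auto intro: le_less_trans)
  have fh: "cmod (f n w) \<le> c * h w" for n w
  proof -
    have "ennreal (cmod (f n w) / c) \<le> ennreal (h w)"
      unfolding hH H_def by (rule SUP_upper) simp
    then have "cmod (f n w) / c \<le> h w"
      using h0 by (simp only: ennreal_le_iff)
    then show ?thesis using c by (simp add: divide_le_eq mult.commute)
  qed
  have hL: "(\<lambda>w. complex_of_real (h w)) \<in> L2 M"
  proof (rule L2_nnI)
    have "(\<integral>\<^sup>+w. ennreal ((cmod (complex_of_real (h w)))\<^sup>2) \<partial>M) \<le> (\<integral>\<^sup>+w. (ennreal (t w))\<^sup>2 \<partial>M)"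
    proof (rule nn_integral_mono)
      fix w
      have "ennreal ((cmod (complex_of_real (h w)))\<^sup>2) = (H w)\<^sup>2"
        using h0 by (simp add: hH[symmetric] ennreal_power)
      also have "\<dots> \<le> (ennreal (t w))\<^sup>2" by (intro power_mono Ht) simp
      finally show "ennreal ((cmod (complex_of_real (h w)))\<^sup>2) \<le> (ennreal (t w))\<^sup>2" .
    qed
    with T show "(\<integral>\<^sup>+w. ennreal ((cmod (complex_of_real (h w)))\<^sup>2) \<partial>M) < \<infinity>" by (rule le_less_trans[rotated])
  qed measurable
  have GL: "(\<lambda>w. complex_of_real c * complex_of_real (h w)) \<in> L2 M" by (rule L2_cmult[OF hL])
  have bd: "AE w in M. cmod (f n w) \<le> cmod (complex_of_real c * complex_of_real (h w))" for n
    using fh[of n] c h0 by (auto simp: norm_mult)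
  have lim': "AE w in M. (\<lambda>n. f n w) \<longlonglongrightarrow> g w" using lim by simp
  show gL: "g \<in> L2 M" by (rule l2_dominated(2)[OF f g GL lim' bd])
  show fL: "f n \<in> L2 M" for n by (rule l2_dominated(1)[OF f g GL lim' bd])
  have "(\<lambda>n. l2ip M (f n) (\<lambda>w. cnj (a w))) \<longlonglongrightarrow> l2ip M g (\<lambda>w. cnj (a w))"
    by (rule l2ip_tendsto[OF fL gL l2_dominated(3)[OF f g GL lim' bd] L2_cnj[OF a] L2_cnj[OF a]])
      (simp add: l2n_def)
  then show "(\<lambda>n. LINT w|M. a w * f n w) \<longlonglongrightarrow> (LINT w|M. a w * g w)"
    by (simp add: l2ip_def mult.commute)
qed

text \<open>Hermitian symmetry is a consequence of real values: the vectors (1, 1) and (1,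
  \<open>\<i>\<close>) force it. The determinant inequality is then the discriminant argument for a
  quadratic polynomial in \<open>s\<close>.\<close>

lemma psd_2x2:
  fixes a b x y :: complex
  assumes psd: "\<And>c d. c * cnj c * a + c * cnj d * x + d * cnj c * y + d * cnj d * b \<in> \<real>\<^sub>\<ge>\<^sub>0"
  shows "0 \<le> Re a" "0 \<le> Re b" "Im a = 0" "Im b = 0" "y = cnj x" "(cmod x)\<^sup>2 \<le> Re a * Re b"
proof -
  have a: "a \<in> \<real>\<^sub>\<ge>\<^sub>0" and b: "b \<in> \<real>\<^sub>\<ge>\<^sub>0" using psd[of 1 0] psd[of 0 1] by simp_all
  then show ab: "0 \<le> Re a" "0 \<le> Re b" "Im a = 0" "Im b = 0" by (auto simp: complex_nonneg_Reals_iff)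
  show y: "y = cnj x"
    using psd[of 1 1] psd[of 1 \<i>] ab by (auto simp: complex_nonneg_Reals_iff complex_eq_iff)
  \<comment> \<open>The form at the vector with components \<open>- s * cnj x\<close> and 1, for
    which both mixed terms equal \<open>- s * (cmod x)\<^sup>2\<close>.\<close>
  have q: "0 \<le> s\<^sup>2 * (cmod x)\<^sup>2 * Re a - 2 * s * (cmod x)\<^sup>2 + Re b" for s
  proof -
    have "0 \<le> Re (- of_real s * cnj x * cnj (- of_real s * cnj x) * a + - of_real s * cnj x * cnj 1 * x
        + 1 * cnj (- of_real s * cnj x) * y + 1 * cnj 1 * b)"
      using psd[of "- of_real s * cnj x" 1] unfolding complex_nonneg_Reals_iff by blast
    also have "\<dots> = s\<^sup>2 * (cmod x)\<^sup>2 * Re a - 2 * s * (cmod x)\<^sup>2 + Re b"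
      unfolding y cmod_power2 by (simp add: ab power2_eq_square algebra_simps)
    finally show ?thesis .
  qed
  show "(cmod x)\<^sup>2 \<le> Re a * Re b"
  proof (cases "Re a = 0")
    case True
    show ?thesis
    proof (cases "cmod x = 0")
      case False
      then have "(cmod x)\<^sup>2 > 0" by simp
      \<comment> \<open>With \<open>Re a = 0\<close> the polynomial is affine in \<open>s\<close>,
        and this \<open>s\<close> would give it the value -1.\<close>
      then have "2 * ((Re b + 1) / (2 * (cmod x)\<^sup>2)) * (cmod x)\<^sup>2 = Re b + 1" by (simp add: field_simps)
      then show ?thesis using q[of "(Re b + 1) / (2 * (cmod x)\<^sup>2)"] True by simp
    qed (use ab in simp)
  next
    case False
    then have pos: "Re a > 0" using ab by simp
    then have "(1 / Re a)\<^sup>2 * (cmod x)\<^sup>2 * Re a - 2 * (1 / Re a) * (cmod x)\<^sup>2 + Re b = Re b - (cmod x)\<^sup>2 / Re a"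
      by (simp add: power2_eq_square field_simps)
    then have "(cmod x)\<^sup>2 / Re a \<le> Re b" using q[of "1 / Re a"] by linarith
    then show ?thesis using pos by (simp add: divide_le_eq mult.commute)
  qed
qed

text \<open>For positive \<open>g\<close> and \<open>h\<close> this is the Cauchy-Schwarz inequality
  for the square of \<open>sqrt a + sqrt b\<close> over \<open>g + h\<close>. It will be applied to
  diagonal entries \<open>a\<close>, \<open>b\<close>, masses \<open>g\<close>, \<open>h\<close> of
  two halves of a cell and the real part \<open>x\<close> of the mixed entry. As
  \<open>x / 0 = 0\<close>, vanishing masses have to force vanishing entries.\<close>

lemma quotient_refine:
  fixes a b g h x :: real
  assumes "0 \<le> a" "0 \<le> b" "0 \<le> g" "0 \<le> h" "g = 0 \<Longrightarrow> a = 0" "h = 0 \<Longrightarrow> b = 0" "x\<^sup>2 \<le> a * b"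
  shows "(a + b + 2 * x) / (g + h) \<le> a / g + b / h"
proof -
  have x: "\<bar>x\<bar> \<le> sqrt a * sqrt b"
    using assms(1,2,7) by (metis real_sqrt_abs real_sqrt_le_iff real_sqrt_mult)
  consider "g = 0" "h = 0" | "g = 0" "h > 0" | "g > 0" "h = 0" | "g > 0" "h > 0"
    using assms(3,4) by fastforce
  then show ?thesis
  proof cases
    case 4
    have "0 \<le> (sqrt a * h - sqrt b * g)\<^sup>2" by simp
    also have "\<dots> = a * h\<^sup>2 + b * g\<^sup>2 - 2 * (sqrt a * sqrt b) * (g * h)"
      using assms(1,2) by (simp add: power2_diff power_mult_distrib mult_ac)
    also have "\<dots> \<le> a * h\<^sup>2 + b * g\<^sup>2 - 2 * x * (g * h)"
      using x 4 by (intro diff_left_mono mult_right_mono) auto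
    finally have "(a + b + 2 * x) * (g * h) \<le> (a * h + b * g) * (g + h)"
      by (simp add: algebra_simps power2_eq_square)
    then show ?thesis using 4 by (simp add: divide_simps mult_ac)
  qed (use assms x in auto)
qed

lemma (in coding) signed_cell_decomposition:
  assumes s: "signed_measure M s"
  shows "s {y \<in> space M. c N y \<in> R} = (\<Sum>a\<in>R \<inter> c N ` space M. s {y \<in> space M. c N y = a})"
  using jordan_decomposition[OF s]
    cell_decomposition[OF finite_measure_pos_variation[OF s] sets_pos_variation]
    cell_decomposition[OF finite_measure_pos_variation[OF signed_measure_uminus[OF s]] sets_pos_variation]
  by (simp add: sum_subtractf)

lemma complex_measure_Un:
  assumes \<kappa>: "\<kappa> \<in> complex_measures M" and "A \<in> sets M" "B \<in> sets M" "A \<inter> B = {}"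
  shows "\<kappa> (A \<union> B) = \<kappa> A + \<kappa> B"
  using signed_measure_Un[OF signed_measure_Re_Im(1)[OF \<kappa>] assms(2-)]
    signed_measure_Un[OF signed_measure_Re_Im(2)[OF \<kappa>] assms(2-)] by (simp add: complex_eq_iff)

lemma complex_measure_empty:
  assumes "\<kappa> \<in> complex_measures M"
  shows "\<kappa> {} = 0"
  using signed_measure_empty[OF signed_measure_Re_Im(1)[OF assms]]
    signed_measure_empty[OF signed_measure_Re_Im(2)[OF assms]]
  by (simp add: complex_eq_iff)

lemma complex_measure_sums:
  assumes "\<kappa> \<in> complex_measures M" "\<And>i. A i \<in> sets M" "disjoint_family A"
  shows "(\<lambda>n::nat. \<kappa> (A n)) sums \<kappa> (\<Union>n. A n)"
  using assms by (auto simp: complex_measures_def)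

lemma complex_measure_UN:
  assumes \<kappa>: "\<kappa> \<in> complex_measures M" and A: "\<And>i. A i \<in> sets M" "disjoint_family A"
  shows "\<kappa> (\<Union>i<n::nat. A i) = (\<Sum>i<n. \<kappa> (A i))"
proof (induction n)
  case (Suc n)
  have "A i \<inter> A n = {}" if "i < n" for i
    using A(2) that by (auto simp: disjoint_family_on_def)
  then have "\<kappa> ((\<Union>i<n. A i) \<union> A n) = \<kappa> (\<Union>i<n. A i) + \<kappa> (A n)"
    by (intro complex_measure_Un[OF \<kappa>]) (use A in auto)
  moreover have "(\<Union>i<Suc n. A i) = (\<Union>i<n. A i) \<union> A n" by (auto simp: less_Suc_eq)
  ultimately show ?case using Suc by simp
qed (simp add: complex_measure_empty[OF \<kappa>])

text \<open>A Dynkin argument: rectangles are covered by \<open>meas\<close>, complements by finite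
  and disjoint unions by countable additivity of each \<open>\<kappa> w\<close>.\<close>

lemma section_measurable:
  fixes \<kappa> :: "'w \<Rightarrow> 'x set \<Rightarrow> complex"
  assumes cm: "\<And>w. \<kappa> w \<in> complex_measures M" and meas: "\<And>A. A \<in> sets M \<Longrightarrow> (\<lambda>w. \<kappa> w A) \<in> borel_measurable W"
    and S: "S \<in> sets (W \<Otimes>\<^sub>M M)"
  shows "(\<lambda>w. \<kappa> w (Pair w -` S)) \<in> borel_measurable W"
  using Int_stable_pair_measure_generator pair_measure_closed S[unfolded sets_pair_measure]
proof (induction rule: sigma_sets_induct_disjoint)
  case (basic S)
  then obtain D A where S: "S = D \<times> A" and D: "D \<in> sets W" and A: "A \<in> sets M" by blast
  have "\<kappa> w (Pair w -` S) = indicator D w * \<kappa> w A" for w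
    using complex_measure_empty[OF cm] by (auto simp: S indicator_def)
  then show ?case using D meas[OF A] by simp
next
  case empty
  then show ?case using complex_measure_empty[OF cm] by simp
next
  case (compl S)
  then have S: "S \<in> sets (W \<Otimes>\<^sub>M M)" by (simp only: sets_pair_measure)
  have eq: "\<kappa> w (Pair w -` (space W \<times> space M - S)) = \<kappa> w (space M) - \<kappa> w (Pair w -` S)" if "w \<in> space W" for w
  proof -
    have sec: "Pair w -` S \<in> sets M" by (rule sets_Pair1[OF S])
    then have "\<kappa> w (Pair w -` S \<union> (space M - Pair w -` S)) = \<kappa> w (Pair w -` S) + \<kappa> w (space M - Pair w -` S)"
      by (intro complex_measure_Un[OF cm]) auto
    moreover have "Pair w -` S \<union> (space M - Pair w -` S) = space M"
      using sets.sets_into_space[OF sec] by auto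
    moreover have "Pair w -` (space W \<times> space M - S) = space M - Pair w -` S" using that by auto
    ultimately show ?thesis by simp
  qed
  have "(\<lambda>w. \<kappa> w (space M) - \<kappa> w (Pair w -` S)) \<in> borel_measurable W"
    using meas[of "space M"] compl.IH by simp
  then show ?case by (simp cong: measurable_cong add: eq)
next
  case (union S)
  then have S: "S i \<in> sets (W \<Otimes>\<^sub>M M)" for i by (auto simp only: sets_pair_measure)
  show ?case
  proof (rule borel_measurable_LIMSEQ_metric)
    show "(\<lambda>w. \<Sum>i<n. \<kappa> w (Pair w -` S i)) \<in> borel_measurable W" for n
      using union by (intro borel_measurable_sum) auto
    show "(\<lambda>n. \<Sum>i<n. \<kappa> w (Pair w -` S i)) \<longlonglongrightarrow> \<kappa> w (Pair w -` (\<Union>i. S i))" for w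
    proof -
      have "(\<lambda>n. \<kappa> w (Pair w -` S n)) sums \<kappa> w (\<Union>n. Pair w -` S n)"
        using union.hyps(1) by (intro complex_measure_sums[OF cm] sets_Pair1[OF S]) (auto simp: disjoint_family_on_def)
      then show ?thesis by (simp add: sums_def vimage_UN)
    qed
  qed
qed

section \<open>Measure-valued kernels\<close>

locale measure_kernel =
  fixes W :: "'w measure" and M :: "'x measure" and \<kappa> :: "'w \<Rightarrow> 'x set \<Rightarrow> complex"
  assumes cm: "\<kappa> w \<in> complex_measures M"
    and meas: "A \<in> sets M \<Longrightarrow> (\<lambda>w. \<kappa> w A) \<in> borel_measurable W"
    and tv: "(\<integral>\<^sup>+w. (total_variation M (\<kappa> w))\<^sup>2 \<partial>W) < \<infinity>"
begin

text \<open>Nothing is known about measurability in \<open>w\<close>; it serves as an upper bound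
  whose square has a finite lower integral.\<close>

definition tvr :: "'w \<Rightarrow> real" where
  "tvr w = enn2real (total_variation M (\<kappa> w))"

lemma tvr_finite: "(\<integral>\<^sup>+w. (ennreal (tvr w))\<^sup>2 \<partial>W) < \<infinity>"
proof -
  have "ennreal (tvr w) = total_variation M (\<kappa> w)" for w
    unfolding tvr_def using cm[of w] by (intro ennreal_enn2real) (simp add: complex_measures_def)
  then show ?thesis using tv by simp
qed

lemma kernel_bound: "A \<in> sets M \<Longrightarrow> cmod (\<kappa> w A) \<le> 1 * tvr w"
  using complex_measure_bound[OF cm] by (simp add: tvr_def)

lemma section_L2: "S \<in> sets (W \<Otimes>\<^sub>M M) \<Longrightarrow> (\<lambda>w. \<kappa> w (Pair w -` S)) \<in> L2 W"
  by (rule dominated_by_lower_integral(1)[where f="\<lambda>_ w. \<kappa> w (Pair w -` S)", OF _ _ _ tvr_finite _ L2_zero])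
    (auto intro: section_measurable[OF cm meas] kernel_bound sets_Pair1)

lemma kernel_L2:
  assumes A: "A \<in> sets M"
  shows "(\<lambda>w. \<kappa> w A) \<in> L2 W"
  by (rule dominated_by_lower_integral(1)[where f="\<lambda>_ w. \<kappa> w A", OF _ _ _ tvr_finite _ L2_zero])
    (auto intro: meas[OF A] kernel_bound[OF A])

text \<open>The value at \<open>S\<close> of the scalar measure
  \<open>a(w) \<kappa>(w, dz) dw\<close> on the product space.\<close>

definition joint :: "('w \<Rightarrow> complex) \<Rightarrow> ('w \<times> 'x) set \<Rightarrow> complex" where
  "joint a S = (LINT w|W. a w * \<kappa> w (Pair w -` S))"

lemma joint_sums:
  assumes a: "a \<in> L2 W" and S: "\<And>i. S i \<in> sets (W \<Otimes>\<^sub>M M)" "disjoint_family S"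
  shows "(\<lambda>n::nat. joint a (S n)) sums joint a (\<Union>n. S n)"
proof -
  have sec: "Pair w -` S i \<in> sets M" for w i by (rule sets_Pair1[OF S(1)])
  have dis: "disjoint_family (\<lambda>i. Pair w -` S i)" for w
    using S(2) by (auto simp: disjoint_family_on_def)
  have "(\<Sum>i<n. joint a (S i)) = (LINT w|W. a w * (\<Sum>i<n. \<kappa> w (Pair w -` S i)))" for n
    unfolding joint_def sum_distrib_left
    by (rule Bochner_Integration.integral_sum[symmetric]) (intro L2_mult_integrable a section_L2 S)
  moreover have "(\<lambda>n. LINT w|W. a w * (\<Sum>i<n. \<kappa> w (Pair w -` S i))) \<longlonglongrightarrow> (LINT w|W. a w * \<kappa> w (Pair w -` (\<Union>n. S n)))"
  proof (rule dominated_by_lower_integral(3)[where c=1, OF _ _ _ tvr_finite _ a])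
    show "(\<lambda>w. \<Sum>i<n. \<kappa> w (Pair w -` S i)) \<in> borel_measurable W" for n
      by (intro borel_measurable_sum section_measurable[OF cm meas] S)
    \<comment> \<open>A partial sum is the value at a finite union, hence bounded by the total
      variation whatever \<open>n\<close> is.\<close>
    show "cmod (\<Sum>i<n. \<kappa> w (Pair w -` S i)) \<le> 1 * tvr w" for n w
      unfolding complex_measure_UN[OF cm sec dis, symmetric] using sec by (intro kernel_bound) auto
    show "(\<lambda>n. \<Sum>i<n. \<kappa> w (Pair w -` S i)) \<longlonglongrightarrow> \<kappa> w (Pair w -` (\<Union>n. S n))" for w
      using complex_measure_sums[OF cm sec dis, of w] by (simp add: sums_def vimage_UN)
  qed simp
  ultimately show ?thesis by (simp add: sums_def joint_def)
qed

lemma joint_bounded: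
  assumes a: "a \<in> L2 W"
  shows "\<exists>C. \<forall>S\<in>sets (W \<Otimes>\<^sub>M M). cmod (joint a S) \<le> C"
proof -
  define T where "T = sqrt (enn2real (\<integral>\<^sup>+w. (ennreal (tvr w))\<^sup>2 \<partial>W))"
  have T0: "0 \<le> T" unfolding T_def by (intro real_sqrt_ge_zero enn2real_nonneg)
  have T: "(\<integral>\<^sup>+w. (ennreal (tvr w))\<^sup>2 \<partial>W) = ennreal (T\<^sup>2)"
    using tvr_finite by (simp add: T_def)
  have "cmod (joint a S) \<le> l2n W a * T" if S: "S \<in> sets (W \<Otimes>\<^sub>M M)" for S
  proof -
    have "(\<integral>\<^sup>+w. ennreal ((cmod (\<kappa> w (Pair w -` S)))\<^sup>2) \<partial>W) \<le> (\<integral>\<^sup>+w. (ennreal (tvr w))\<^sup>2 \<partial>W)"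
      using kernel_bound[OF sets_Pair1[OF S]]
      by (intro nn_integral_mono) (auto simp: ennreal_power tvr_def intro!: ennreal_leI power_mono)
    then have le0: "(\<integral>\<^sup>+w. ennreal ((cmod (\<kappa> w (Pair w -` S)))\<^sup>2) \<partial>W) \<le> ennreal (T\<^sup>2)"
      unfolding T .
    have "l2n W (\<lambda>w. \<kappa> w (Pair w -` S)) \<le> T"
      by (rule L2_nn_le(2)[OF section_measurable[OF cm meas S] le0 T0])
    then have le: "l2n W (\<lambda>w. cnj (\<kappa> w (Pair w -` S))) \<le> T" by (simp add: l2n_cnj)
    have "joint a S = l2ip W a (\<lambda>w. cnj (\<kappa> w (Pair w -` S)))" by (simp add: joint_def l2ip_def)
    then have "cmod (joint a S) \<le> l2n W a * l2n W (\<lambda>w. cnj (\<kappa> w (Pair w -` S)))"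
      using l2_cauchy_schwarz[OF a L2_cnj[OF section_L2[OF S]]] by simp
    also have "\<dots> \<le> l2n W a * T" by (rule mult_left_mono[OF le]) simp
    finally show ?thesis .
  qed
  then show ?thesis by blast
qed

lemma joint_signed:
  assumes a: "a \<in> L2 W"
  shows "signed_measure (W \<Otimes>\<^sub>M M) (\<lambda>S. Re (joint a S))" "signed_measure (W \<Otimes>\<^sub>M M) (\<lambda>S. Im (joint a S))"
proof -
  obtain C where C: "\<forall>S\<in>sets (W \<Otimes>\<^sub>M M). cmod (joint a S) \<le> C" using joint_bounded[OF a] by blast
  have sums: "(\<lambda>n. joint a (A n)) sums joint a (\<Union>n. A n)" if "range A \<subseteq> sets (W \<Otimes>\<^sub>M M)" "disjoint_family A" for A :: "nat \<Rightarrow> _"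
    using that by (intro joint_sums[OF a]) auto
  have "\<forall>S\<in>sets (W \<Otimes>\<^sub>M M). \<bar>Re (joint a S)\<bar> \<le> C" "\<forall>S\<in>sets (W \<Otimes>\<^sub>M M). \<bar>Im (joint a S)\<bar> \<le> C"
    using C abs_Re_le_cmod abs_Im_le_cmod order_trans by blast+
  then show "signed_measure (W \<Otimes>\<^sub>M M) (\<lambda>S. Re (joint a S))" "signed_measure (W \<Otimes>\<^sub>M M) (\<lambda>S. Im (joint a S))"
    unfolding signed_measure_def using sums_Re[OF sums] sums_Im[OF sums] by blast+
qed

lemma joint_Times:
  assumes "A \<in> sets M"
  shows "joint a (D \<times> A) = (LINT w|W. a w * indicator D w * \<kappa> w A)"
  unfolding joint_def
proof (intro Bochner_Integration.integral_cong refl)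
  fix w
  show "a w * \<kappa> w (Pair w -` (D \<times> A)) = a w * indicator D w * \<kappa> w A"
    using complex_measure_empty[OF cm] by (auto simp: indicator_def)
qed

text \<open>For \<open>a\<close> equal to \<rho> tensor its conjugate this is the quadratic form at
  \<rho> of the operator with kernel \<open>\<kappa> w A\<close>.\<close>

definition form :: "('w \<Rightarrow> complex) \<Rightarrow> 'x set \<Rightarrow> complex" where
  "form a A = (LINT w|W. a w * \<kappa> w A)"

lemma form_joint: "A \<in> sets M \<Longrightarrow> form a A = joint a (space W \<times> A)"
  unfolding form_def
  by (subst joint_Times) (auto intro!: Bochner_Integration.integral_cong)

lemma form_signed:
  assumes a: "a \<in> L2 W"
  shows "signed_measure M (\<lambda>A. Re (form a A))" "signed_measure M (\<lambda>A. Im (form a A))"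
proof -
  have fj: "form a (\<Union>n. A n) = joint a (\<Union>n. space W \<times> A n)" "form a (A n) = joint a (space W \<times> A n)"
    "(\<lambda>n. form a (A n)) sums form a (\<Union>n. A n)"
    if "range A \<subseteq> sets M" "disjoint_family A" for A :: "nat \<Rightarrow> _" and n
  proof -
    have "(\<Union>n. space W \<times> A n) = space W \<times> (\<Union>n. A n)" by auto
    then show 1: "form a (\<Union>n. A n) = joint a (\<Union>n. space W \<times> A n)" using that by (simp add: form_joint sets.countable_UN)
    show 2: "form a (A n) = joint a (space W \<times> A n)" for n using that by (simp add: form_joint range_subsetD)
    have "(\<lambda>n. joint a (space W \<times> A n)) sums joint a (\<Union>n. space W \<times> A n)"
      using that by (intro joint_sums[OF a]) (auto simp: disjoint_family_on_def)
    then show "(\<lambda>n. form a (A n)) sums form a (\<Union>n. A n)" by (simp add: 1 2)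
  qed
  obtain C where C: "\<forall>S\<in>sets (W \<Otimes>\<^sub>M M). cmod (joint a S) \<le> C" using joint_bounded[OF a] by blast
  then have "\<forall>A\<in>sets M. cmod (form a A) \<le> C" by (auto simp: form_joint)
  then have "\<forall>A\<in>sets M. \<bar>Re (form a A)\<bar> \<le> C" "\<forall>A\<in>sets M. \<bar>Im (form a A)\<bar> \<le> C"
    using abs_Re_le_cmod abs_Im_le_cmod order_trans by blast+
  then show "signed_measure M (\<lambda>A. Re (form a A))" "signed_measure M (\<lambda>A. Im (form a A))"
    unfolding signed_measure_def using sums_Re[OF fj(3)] sums_Im[OF fj(3)] by blast+
qed

end

text \<open>Subsets of a null set are null, so \<open>s\<close> vanishes on all of them and its two
  variations are absolutely continuous. Their densities are finite almost everywhere, and the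
  difference is a density of \<open>s\<close>.\<close>

lemma signed_Radon_Nikodym:
  assumes "finite_measure \<Gamma>" and s: "signed_measure \<Gamma> s" and ac: "\<And>S. S \<in> null_sets \<Gamma> \<Longrightarrow> s S = 0"
  shows "\<exists>F::_ \<Rightarrow> real. integrable \<Gamma> F \<and> (\<forall>S\<in>sets \<Gamma>. s S = (LINT y|\<Gamma>. indicator S y * F y))"
proof -
  interpret finite_measure \<Gamma> by fact
  have pos: "\<exists>F::_ \<Rightarrow> real. integrable \<Gamma> F \<and> (\<forall>S\<in>sets \<Gamma>. measure (pos_variation \<Gamma> s) S = (LINT y|\<Gamma>. indicator S y * F y))"
    if s: "signed_measure \<Gamma> s" and ac: "\<And>S. S \<in> null_sets \<Gamma> \<Longrightarrow> s S = 0" for s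
  proof -
    let ?P = "pos_variation \<Gamma> s"
    interpret P: finite_measure ?P by (rule finite_measure_pos_variation[OF s])
    have "absolutely_continuous \<Gamma> ?P"
      unfolding absolutely_continuous_def
    proof
      fix S assume S: "S \<in> null_sets \<Gamma>"
      have "s B = 0" if "B \<in> sets \<Gamma>" "B \<subseteq> S" for B
        using ac null_sets_subset[OF S that] by blast
      then have "measure ?P S \<le> 0"
        using S by (intro pos_variation_least[OF s]) auto
      then show "S \<in> null_sets ?P"
        using S by (simp add: null_sets_def P.emeasure_eq_measure measure_le_0_iff)
    qed
    then obtain \<phi> where \<phi>[measurable]: "\<phi> \<in> borel_measurable \<Gamma>" and d: "density \<Gamma> \<phi> = ?P"
      using Radon_Nikodym[of ?P] by auto
    have "(\<integral>\<^sup>+y. \<phi> y \<partial>\<Gamma>) = emeasure ?P (space \<Gamma>)"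
      unfolding d[symmetric] by (subst emeasure_density) (auto intro!: nn_integral_cong)
    then have "(\<integral>\<^sup>+y. \<phi> y \<partial>\<Gamma>) \<noteq> \<infinity>" by (simp add: P.emeasure_eq_measure)
    then have AE: "AE y in \<Gamma>. \<phi> y \<noteq> \<infinity>" by (intro nn_integral_PInf_AE) auto
    define F where "F y = enn2real (\<phi> y)" for y
    have F[measurable]: "F \<in> borel_measurable \<Gamma>" unfolding F_def by measurable
    have F0: "0 \<le> F y" for y by (simp add: F_def)
    have dF: "density \<Gamma> (\<lambda>y. ennreal (F y)) = ?P"
      unfolding d[symmetric]
      by (rule density_cong) (use AE in \<open>auto simp: F_def top.not_eq_extremum\<close>)
    have "integrable ?P (\<lambda>y. 1::real)" by simp
    then have "integrable \<Gamma> F"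
      unfolding dF[symmetric] by (subst (asm) integrable_density) (use F0 in auto)
    moreover have "measure ?P S = (LINT y|\<Gamma>. indicator S y * F y)" if S: "S \<in> sets \<Gamma>" for S
    proof -
      have "measure ?P S = (LINT y|?P. indicator S y)"
        using S sets.sets_into_space[OF S] by (simp add: Int_absorb2)
      also have "\<dots> = (LINT y|\<Gamma>. F y *\<^sub>R indicator S y)"
        unfolding dF[symmetric] using S F0 by (intro integral_density) auto
      finally show ?thesis by (simp add: mult.commute)
    qed
    ultimately show ?thesis by blast
  qed
  have ac': "\<And>S. S \<in> null_sets \<Gamma> \<Longrightarrow> - s S = 0" by (simp add: ac)
  obtain F :: "_ \<Rightarrow> real" where F: "integrable \<Gamma> F"
      "\<forall>S\<in>sets \<Gamma>. measure (pos_variation \<Gamma> s) S = (LINT y|\<Gamma>. indicator S y * F y)"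
    using pos[OF s ac] by blast
  obtain G :: "_ \<Rightarrow> real" where G: "integrable \<Gamma> G"
      "\<forall>S\<in>sets \<Gamma>. measure (pos_variation \<Gamma> (\<lambda>A. - s A)) S = (LINT y|\<Gamma>. indicator S y * G y)"
    using pos[OF signed_measure_uminus[OF s] ac'] by blast
  have "s S = (LINT y|\<Gamma>. indicator S y * (F y - G y))" if S: "S \<in> sets \<Gamma>" for S
  proof -
    have "s S = (LINT y|\<Gamma>. indicator S y * F y) - (LINT y|\<Gamma>. indicator S y * G y)"
      using jordan_decomposition[OF s S] F(2)[rule_format, OF S] G(2)[rule_format, OF S] by simp
    also have "\<dots> = (LINT y|\<Gamma>. indicator S y * F y - indicator S y * G y)"
      using integrable_real_mult_indicator[OF S F(1)] integrable_real_mult_indicator[OF S G(1)]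
      by (intro Bochner_Integration.integral_diff[symmetric]) (simp_all add: mult.commute)
    finally show ?thesis by (simp add: right_diff_distrib)
  qed
  with F(1) G(1) show ?thesis by (intro exI[of _ "\<lambda>y. F y - G y"]) auto
qed

lemma signed_measureI:
  assumes "\<And>A::nat \<Rightarrow> 'a set. range A \<subseteq> sets M \<Longrightarrow> disjoint_family A \<Longrightarrow> (\<lambda>n. s (A n)) sums s (\<Union>n. A n)"
    and "\<forall>A\<in>sets M. \<bar>s A\<bar> \<le> C"
  shows "signed_measure M s"
  using assms by (auto simp: signed_measure_def)

lemma signed_measure_sums:
  "signed_measure M s \<Longrightarrow> range A \<subseteq> sets M \<Longrightarrow> disjoint_family A \<Longrightarrow> (\<lambda>n::nat. s (A n)) sums s (\<Union>n. A n)"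
  by (simp add: signed_measure_def)

lemma signed_measure_cmult:
  assumes s: "signed_measure M s"
  shows "signed_measure M (\<lambda>A. s A * c)"
proof -
  obtain C where "\<forall>A\<in>sets M. \<bar>s A\<bar> \<le> C" using s by (auto simp: signed_measure_def)
  then have "\<forall>A\<in>sets M. \<bar>s A * c\<bar> \<le> C * \<bar>c\<bar>" by (auto simp: abs_mult intro: mult_right_mono)
  from signed_measureI[OF _ this] show ?thesis using sums_mult2[OF signed_measure_sums[OF s]] by simp
qed

lemma signed_measure_add:
  assumes s: "signed_measure M s" and t: "signed_measure M t"
  shows "signed_measure M (\<lambda>A. s A + t A)"
proof -
  obtain C D where "\<forall>A\<in>sets M. \<bar>s A\<bar> \<le> C" "\<forall>A\<in>sets M. \<bar>t A\<bar> \<le> D" using s t by (auto simp: signed_measure_def)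
  then have "\<forall>A\<in>sets M. \<bar>s A + t A\<bar> \<le> C + D" by (auto intro!: order_trans[OF abs_triangle_ineq] add_mono)
  from signed_measureI[OF _ this] show ?thesis
    using sums_add[OF signed_measure_sums[OF s] signed_measure_sums[OF t]] by simp
qed

lemma signed_measure_sum:
  assumes "\<And>i. i \<in> I \<Longrightarrow> signed_measure M (s i)"
  shows "signed_measure M (\<lambda>A. \<Sum>i\<in>I. s i A)"
  using assms
proof (induction I rule: infinite_finite_induct)
  case (insert i I)
  then show ?case by (simp add: signed_measure_add)
qed (auto simp: signed_measure_def)

section \<open>Positive semidefinite kernels\<close>

interpretation bits: coding borel bits
  by (rule coding_bits)

definition bit_cell :: "nat \<Rightarrow> nat set \<Rightarrow> 'a::euclidean_space set" where
  "bit_cell N I = {p. bits N p = I}"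

lemma bit_cell_sets [measurable]: "bit_cell N I \<in> sets borel"
  using bits.cell_sets1[of N I] by (simp add: bit_cell_def)

text \<open>Level \<open>N\<close> consults the generators with index below \<open>N\<close>; the
  next level adds the one with index \<open>N\<close> itself, which splits every cell in
  two.\<close>

lemma bit_cell_refine:
  assumes "I \<subseteq> {..<N}"
  shows "bit_cell N I = bit_cell (Suc N) I \<union> (bit_cell (Suc N) (insert N I) :: 'a::euclidean_space set)"
    "bit_cell (Suc N) I \<inter> bit_cell (Suc N) (insert N I) = ({} :: 'a set)"
proof -
  have b: "bits (Suc N) p = (if p \<in> closed_generator N then insert N (bits N p) else bits N p)" for p :: 'a
    by (auto simp: bits_def less_Suc_eq)
  have n: "N \<notin> I" using assms by auto
  have nb: "N \<notin> bits N p" for p :: 'a by (auto simp: bits_def)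
  show "bit_cell N I = bit_cell (Suc N) I \<union> (bit_cell (Suc N) (insert N I) :: 'a set)"
    using n nb by (auto simp: bit_cell_def b insert_ident split: if_splits)
  show "bit_cell (Suc N) I \<inter> bit_cell (Suc N) (insert N I) = ({} :: 'a set)"
    using n by (auto simp: bit_cell_def)
qed

lemma sum_Pow_lessThan_Suc:
  "(\<Sum>I\<in>Pow {..<Suc N}. f I) = (\<Sum>I\<in>Pow {..<N}. f I + f (insert N I))" for f :: "nat set \<Rightarrow> 'b::comm_monoid_add"
proof -
  have "Pow {..<Suc N} = Pow {..<N} \<union> insert N ` Pow {..<N}"
    by (simp add: lessThan_Suc Pow_insert)
  moreover have "Pow {..<N} \<inter> insert N ` Pow {..<N} = {}" by auto
  moreover have "inj_on (insert N) (Pow {..<N})"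
    by (rule inj_onI) (metis PowD insert_ident lessThan_iff less_irrefl subsetD)
  ultimately show ?thesis
    by (simp add: sum.union_disjoint sum.reindex sum.distrib)
qed

text \<open>The sequence is forgotten here: positivity of all forms and the bound on the compressed
  traces are what trace measure and density are built from. The quotients in \<open>trace\<close>
  are the diagonal entries at the normalized functions \<omega> 1_I.\<close>

locale psd_kernel = measure_kernel "lborel :: ('p::euclidean_space \<times> 'p) measure" M \<kappa> + coding M c
  for M :: "'x measure" and \<kappa> :: "('p::euclidean_space) \<times> 'p \<Rightarrow> 'x set \<Rightarrow> complex" and c :: "nat \<Rightarrow> 'x \<Rightarrow> 'c" +
  fixes \<omega> :: "'p::euclidean_space \<Rightarrow> real" and C :: real
  assumes \<omega>_meas [measurable]: "\<omega> \<in> borel_measurable borel" and \<omega>_pos: "0 < \<omega> p"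
    and \<omega>_L2: "(\<lambda>p. complex_of_real (\<omega> p)) \<in> L2 lborel"
    and form_nonneg: "\<rho> \<in> L2 lborel \<Longrightarrow> A \<in> sets M \<Longrightarrow> form (\<lambda>w. \<rho> (fst w) * cnj (\<rho> (snd w))) A \<in> \<real>\<^sub>\<ge>\<^sub>0"
    and trace: "(\<Sum>I\<in>Pow {..<N}. Re (form (\<lambda>w. of_real (\<omega> (fst w) * indicator (bit_cell N I) (fst w)) *
        of_real (\<omega> (snd w) * indicator (bit_cell N I) (snd w))) (space M)) /
        (l2n lborel (\<lambda>p. complex_of_real (\<omega> p * indicator (bit_cell N I) p)))\<^sup>2) \<le> C"
begin

definition wt :: "'p set \<Rightarrow> 'p \<Rightarrow> complex" where
  "wt Q p = of_real (\<omega> p * indicator Q p)"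

text \<open>The weights are real, so this is also \<open>wt Q\<close> tensor the conjugate of
  \<open>wt R\<close>, the shape required by \<open>form_nonneg\<close>.\<close>

definition wt2 :: "'p set \<Rightarrow> 'p set \<Rightarrow> 'p \<times> 'p \<Rightarrow> complex" where
  "wt2 Q R w = wt Q (fst w) * wt R (snd w)"

definition mass :: "'p set \<Rightarrow> real" where
  "mass Q = (l2n lborel (wt Q))\<^sup>2"

definition entry :: "'p set \<Rightarrow> 'p set \<Rightarrow> 'x set \<Rightarrow> complex" where
  "entry Q R A = form (wt2 Q R) A"

lemma wt_L2: "Q \<in> sets borel \<Longrightarrow> wt Q \<in> L2 lborel"
  by (rule L2_bound[where c=1, OF \<omega>_L2])
    (auto simp: wt_def[abs_def] indicator_def borel_measurable_indicator
      intro!: borel_measurable_of_real borel_measurable_times)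

lemma wt2_L2:
  assumes "Q \<in> sets borel" "R \<in> sets borel"
  shows "wt2 Q R \<in> L2 lborel" "(l2n lborel (wt2 Q R))\<^sup>2 = mass Q * mass R"
  using L2_tensor[OF wt_L2[OF assms(1)] wt_L2[OF assms(2)]]
  by (simp_all add: wt2_def[abs_def] mass_def power_mult_distrib)

lemma mass_nonneg: "0 \<le> mass Q"
  by (simp add: mass_def)

lemma mass_Un:
  assumes Q: "Q \<in> sets borel" and R: "R \<in> sets borel" and d: "Q \<inter> R = {}"
  shows "mass (Q \<union> R) = mass Q + mass R"
proof -
  have eq: "wt (Q \<union> R) = (\<lambda>p. wt Q p + wt R p)"
    using d by (auto simp: wt_def indicator_def fun_eq_iff)
  have "(\<lambda>p. wt Q p * cnj (wt R p)) = (\<lambda>p. 0)"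
    using d by (auto simp: wt_def indicator_def fun_eq_iff)
  then have "l2ip lborel (wt Q) (wt R) = 0" by (simp add: l2ip_def)
  then show ?thesis
    unfolding mass_def eq using l2n_sq_add[OF wt_L2[OF Q] wt_L2[OF R]] by simp
qed

lemma form_lincomb4:
  assumes "a1 \<in> L2 lborel" "a2 \<in> L2 lborel" "a3 \<in> L2 lborel" "a4 \<in> L2 lborel" and A: "A \<in> sets M"
  shows "form (\<lambda>w. x1 * a1 w + x2 * a2 w + x3 * a3 w + x4 * a4 w) A =
    x1 * form a1 A + x2 * form a2 A + x3 * form a3 A + x4 * form a4 A"
  using assms(1-4)[THEN L2_mult_integrable, OF kernel_L2[OF A]]
  by (simp add: form_def distrib_right mult.assoc)

lemma entry_psd:
  assumes Q: "Q \<in> sets borel" and R: "R \<in> sets borel" and A: "A \<in> sets M"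
  shows "x * cnj x * entry Q Q A + x * cnj y * entry Q R A + y * cnj x * entry R Q A + y * cnj y * entry R R A \<in> \<real>\<^sub>\<ge>\<^sub>0"
proof -
  let ?\<rho> = "\<lambda>p. x * wt Q p + y * wt R p"
  have "form (\<lambda>w. ?\<rho> (fst w) * cnj (?\<rho> (snd w))) A =
      form (\<lambda>w. (x * cnj x) * wt2 Q Q w + (x * cnj y) * wt2 Q R w + (y * cnj x) * wt2 R Q w + (y * cnj y) * wt2 R R w) A"
    by (rule arg_cong[where f="\<lambda>a. form a A"]) (simp add: fun_eq_iff wt2_def wt_def algebra_simps)
  also have "\<dots> = x * cnj x * entry Q Q A + x * cnj y * entry Q R A + y * cnj x * entry R Q A + y * cnj y * entry R R A"
    unfolding entry_def by (rule form_lincomb4[OF wt2_L2(1)[OF Q Q] wt2_L2(1)[OF Q R] wt2_L2(1)[OF R Q] wt2_L2(1)[OF R R] A])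
  finally show ?thesis
    using form_nonneg[of ?\<rho>, OF L2_add[OF L2_cmult[OF wt_L2[OF Q]] L2_cmult[OF wt_L2[OF R]]] A] by simp
qed

lemmas entry_facts = psd_2x2[OF entry_psd]

lemma entry_Un:
  assumes Q: "Q \<in> sets borel" and R: "R \<in> sets borel" and d: "Q \<inter> R = {}" and A: "A \<in> sets M"
  shows "Re (entry (Q \<union> R) (Q \<union> R) A) = Re (entry Q Q A) + Re (entry R R A) + 2 * Re (entry Q R A)"
proof -
  have eq: "wt2 (Q \<union> R) (Q \<union> R) = (\<lambda>w. 1 * wt2 Q Q w + 1 * wt2 Q R w + 1 * wt2 R Q w + 1 * wt2 R R w)"
    using d by (auto simp: wt2_def wt_def indicator_def fun_eq_iff)
  have "entry (Q \<union> R) (Q \<union> R) A = 1 * entry Q Q A + 1 * entry Q R A + 1 * entry R Q A + 1 * entry R R A"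
    unfolding entry_def eq
    by (rule form_lincomb4[OF wt2_L2(1)[OF Q Q] wt2_L2(1)[OF Q R] wt2_L2(1)[OF R Q] wt2_L2(1)[OF R R] A])
  then show ?thesis using entry_facts(5)[OF Q R A] by simp
qed

text \<open>Guards the convention \<open>x / 0 = 0\<close>: a cell without mass must not hide a
  positive entry when the trace is refined.\<close>

lemma entry_mass_zero:
  assumes Q: "Q \<in> sets borel" and A: "A \<in> sets M" and m: "mass Q = 0"
  shows "entry Q Q A = 0"
proof -
  have "entry Q Q A = l2ip lborel (wt2 Q Q) (\<lambda>w. cnj (\<kappa> w A))"
    by (simp add: entry_def form_def l2ip_def)
  then have "cmod (entry Q Q A) \<le> l2n lborel (wt2 Q Q) * l2n lborel (\<lambda>w. cnj (\<kappa> w A))"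
    using l2_cauchy_schwarz[OF wt2_L2(1)[OF Q Q] L2_cnj[OF kernel_L2[OF A]]] by simp
  moreover have "l2n lborel (wt2 Q Q) = 0" using wt2_L2(2)[OF Q Q] m by simp
  ultimately show ?thesis by simp
qed

text \<open>The trace of the operator-valued measure compressed to step functions: with the orthonormal vectors
  \<open>e\<^sub>I = \<omega> 1\<^sub>I / \<parallel>\<omega> 1\<^sub>I\<parallel>\<close> over the cells \<open>I\<close> of the \<open>N\<close>-th partition it is the sum of the \<open>\<langle>\<kappa>(A) e\<^sub>I, e\<^sub>I\<rangle>\<close>. A cell
  with \<open>mass = 0\<close> contributes 0, as \<open>x / 0 = 0\<close>.\<close>

definition ptrace :: "nat \<Rightarrow> 'x set \<Rightarrow> real" where
  "ptrace N A = (\<Sum>I\<in>Pow {..<N}. Re (entry (bit_cell N I) (bit_cell N I) A) / mass (bit_cell N I))"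

lemma ptrace_term_nonneg:
  "A \<in> sets M \<Longrightarrow> 0 \<le> Re (entry (bit_cell N I) (bit_cell N I) A) / mass (bit_cell N I)"
  using entry_facts(1)[OF bit_cell_sets bit_cell_sets] mass_nonneg by (intro divide_nonneg_nonneg) auto

lemma ptrace_nonneg: "A \<in> sets M \<Longrightarrow> 0 \<le> ptrace N A"
  unfolding ptrace_def by (intro sum_nonneg ptrace_term_nonneg)

lemma ptrace_signed: "signed_measure M (ptrace N)"
proof -
  have "signed_measure M (\<lambda>A. Re (entry Q Q A) / mass Q)" if "Q \<in> sets borel" for Q
    using signed_measure_cmult[OF form_signed(1)[OF wt2_L2(1)[OF that that]], of "1 / mass Q"]
    by (simp add: entry_def)
  then show ?thesis unfolding ptrace_def[abs_def] by (intro signed_measure_sum) auto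
qed

lemma ptrace_le: "A \<in> sets M \<Longrightarrow> ptrace N A \<le> C"
proof -
  assume A: "A \<in> sets M"
  have "ptrace N A \<le> ptrace N (space M)"
    using signed_measure_Diff[OF ptrace_signed sets.top A sets.sets_into_space[OF A], of N]
      ptrace_nonneg[OF sets.compl_sets[OF A], of N] by simp
  also have "\<dots> \<le> C"
    using trace[of N] by (simp add: ptrace_def entry_def mass_def wt2_def[abs_def] wt_def[abs_def])
  finally show ?thesis .
qed

text \<open>When a cell is split, masses add and the entry of the union gains twice the real part of
  the mixed entry, which the 2 by 2 determinant controls; \<open>quotient_refine\<close> compares
  the quotients.\<close>

lemma ptrace_Suc:
  assumes A: "A \<in> sets M"
  shows "ptrace N A \<le> ptrace (Suc N) A"
  unfolding ptrace_def sum_Pow_lessThan_Suc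
proof (rule sum_mono)
  fix I assume "I \<in> Pow {..<N}"
  then have I: "I \<subseteq> {..<N}" by simp
  let ?Q = "bit_cell (Suc N) I :: 'p set" and ?R = "bit_cell (Suc N) (insert N I) :: 'p set"
  have ref: "bit_cell N I = ?Q \<union> ?R" "?Q \<inter> ?R = {}" by (rule bit_cell_refine[OF I])+
  have x: "(Re (entry ?Q ?R A))\<^sup>2 \<le> Re (entry ?Q ?Q A) * Re (entry ?R ?R A)"
    using entry_facts(6)[OF bit_cell_sets bit_cell_sets A, of "Suc N" I "Suc N" "insert N I"]
      zero_le_power2[of "Im (entry ?Q ?R A)"] unfolding cmod_power2 by linarith
  show "Re (entry (bit_cell N I) (bit_cell N I) A) / mass (bit_cell N I) \<le>
      Re (entry ?Q ?Q A) / mass ?Q + Re (entry ?R ?R A) / mass ?R"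
    unfolding ref(1) entry_Un[OF bit_cell_sets bit_cell_sets ref(2) A] mass_Un[OF bit_cell_sets bit_cell_sets ref(2)]
    by (rule quotient_refine[OF entry_facts(1)[OF bit_cell_sets bit_cell_sets A] entry_facts(1)[OF bit_cell_sets bit_cell_sets A] mass_nonneg mass_nonneg _ _ x])
      (simp_all add: entry_mass_zero A)
qed

definition trace_measure :: "'x measure" where
  "trace_measure = measure_of (space M) (sets M) (\<lambda>A. SUP N. ennreal (ptrace N A))"

lemma sets_trace_measure [simp, measurable_cong]: "sets trace_measure = sets M"
  by (simp add: trace_measure_def)

lemma space_trace_measure [simp]: "space trace_measure = space M"
  by (simp add: trace_measure_def)

lemma ptrace_incseq: "A \<in> sets M \<Longrightarrow> incseq (\<lambda>N. ennreal (ptrace N A))"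
  by (intro incseq_SucI ennreal_leI ptrace_Suc)

text \<open>The compressed traces increase with \<open>N\<close> on every set, so that supremum and
  infinite sum may be exchanged; countable additivity survives the limit for this reason.\<close>

lemma emeasure_trace_measure:
  assumes A: "A \<in> sets M"
  shows "emeasure trace_measure A = (SUP N. ennreal (ptrace N A))"
proof (rule emeasure_measure_of[OF trace_measure_def sets.space_closed])
  show "A \<in> sets trace_measure" using A by simp
  show "positive (sets trace_measure) (\<lambda>A. SUP N. ennreal (ptrace N A))"
    by (simp add: positive_def signed_measure_empty[OF ptrace_signed])
  show "countably_additive (sets trace_measure) (\<lambda>A. SUP N. ennreal (ptrace N A))"
  proof (rule countably_additiveI)
    fix A :: "nat \<Rightarrow> 'x set"
    assume r: "range A \<subseteq> sets trace_measure" and d: "disjoint_family A"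
    then have Am: "A i \<in> sets M" for i by auto
    have "(\<Sum>i. SUP N. ennreal (ptrace N (A i))) = (SUP N. \<Sum>i. ennreal (ptrace N (A i)))"
      by (rule ennreal_suminf_SUP_eq) (rule ptrace_incseq[OF Am])
    also have "\<dots> = (SUP N. ennreal (ptrace N (\<Union>i. A i)))"
    proof -
      have "(\<lambda>i. ptrace N (A i)) sums ptrace N (\<Union>i. A i)" for N
        using ptrace_signed[of N] Am d unfolding signed_measure_def by blast
      then have "(\<Sum>i. ennreal (ptrace N (A i))) = ennreal (ptrace N (\<Union>i. A i))" for N
        by (intro suminf_ennreal_eq ptrace_nonneg Am)
      then show ?thesis by simp
    qed
    finally show "(\<Sum>i. SUP N. ennreal (ptrace N (A i))) = (SUP N. ennreal (ptrace N (\<Union>i. A i)))" .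
  qed
qed

lemma C_nonneg: "0 \<le> C"
  using ptrace_nonneg[OF sets.top, of 0] ptrace_le[OF sets.top, of 0] by linarith

sublocale trm: finite_measure trace_measure
proof (rule finite_measureI)
  have "emeasure trace_measure (space M) \<le> ennreal C"
    unfolding emeasure_trace_measure[OF sets.top] by (intro SUP_least ennreal_leI ptrace_le) simp
  then show "emeasure trace_measure (space trace_measure) \<noteq> \<infinity>" by (auto simp: top_unique)
qed

lemma ptrace_le_trace_measure:
  assumes A: "A \<in> sets M"
  shows "ptrace N A \<le> measure trace_measure A"
proof -
  have "ennreal (ptrace N A) \<le> emeasure trace_measure A"
    unfolding emeasure_trace_measure[OF A] by (rule SUP_upper) simp
  then show ?thesis by (simp add: trm.emeasure_eq_measure)
qed

section \<open>The reference measure and the weighted joint measure\<close>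

definition pair_weight :: "('p \<times> 'p) measure" where
  "pair_weight = density lborel (\<lambda>w. ennreal ((cmod (wt2 UNIV UNIV w))\<^sup>2))"

lemma sets_pair_weight [simp, measurable_cong]: "sets pair_weight = sets borel"
  by (simp add: pair_weight_def)

lemma space_pair_weight [simp]: "space pair_weight = UNIV"
  by (simp add: pair_weight_def)

lemma wt2_UNIV_L2: "wt2 UNIV UNIV \<in> L2 lborel"
  by (rule wt2_L2(1)) auto

lemma wt2_UNIV_measurable [measurable]: "wt2 UNIV UNIV \<in> borel_measurable borel"
  using L2_measurable[OF wt2_UNIV_L2] by simp

lemma emeasure_pair_weight_Times:
  assumes Q: "Q \<in> sets borel" and R: "R \<in> sets borel"
  shows "emeasure pair_weight (Q \<times> R) = ennreal (mass Q * mass R)"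
proof -
  have QR: "Q \<times> R \<in> sets borel" using Q R by (metis borel_prod pair_measureI)
  have "emeasure pair_weight (Q \<times> R) = (\<integral>\<^sup>+w. ennreal ((cmod (wt2 UNIV UNIV w))\<^sup>2) * indicator (Q \<times> R) w \<partial>lborel)"
    unfolding pair_weight_def using QR by (subst emeasure_density) auto
  also have "\<dots> = (\<integral>\<^sup>+w. ennreal ((cmod (wt2 Q R w))\<^sup>2) \<partial>lborel)"
    by (intro nn_integral_cong) (auto simp: wt2_def wt_def indicator_def split: if_splits)
  also have "\<dots> = ennreal (mass Q * mass R)"
    by (simp add: nn_integral_l2n[OF wt2_L2(1)[OF Q R]] wt2_L2(2)[OF Q R])
  finally show ?thesis .
qed

sublocale pw: finite_measure pair_weight
proof (rule finite_measureI)
  have "emeasure pair_weight (UNIV \<times> UNIV) = ennreal (mass UNIV * mass UNIV)"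
    by (rule emeasure_pair_weight_Times) auto
  then show "emeasure pair_weight (space pair_weight) \<noteq> \<infinity>" by simp
qed

definition reference :: "(('p \<times> 'p) \<times> 'x) measure" where
  "reference = pair_weight \<Otimes>\<^sub>M trace_measure"

lemma sets_reference [simp, measurable_cong]: "sets reference = sets (lborel \<Otimes>\<^sub>M M)"
  unfolding reference_def by (rule sets_pair_measure_cong) auto

lemma space_reference: "space reference = UNIV \<times> space M"
  by (simp add: reference_def space_pair_measure)

sublocale pwtr: pair_sigma_finite pair_weight trace_measure ..

sublocale ref: finite_measure reference
proof (rule finite_measureI)
  have "emeasure reference (UNIV \<times> space M) = emeasure pair_weight UNIV * emeasure trace_measure (space M)"
    unfolding reference_def by (rule trm.emeasure_pair_measure_Times) auto
  then show "emeasure reference (space reference) \<noteq> \<infinity>"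
    by (simp add: space_reference pw.emeasure_eq_measure trm.emeasure_eq_measure ennreal_mult_eq_top_iff)
qed

lemma measure_reference_Times:
  assumes "Q \<in> sets borel" "R \<in> sets borel" "A \<in> sets M"
  shows "measure reference ((Q \<times> R) \<times> A) = mass Q * mass R * measure trace_measure A"
proof -
  have QR: "Q \<times> R \<in> sets borel" using assms by (metis borel_prod pair_measureI)
  have "emeasure reference ((Q \<times> R) \<times> A) = ennreal (mass Q * mass R) * emeasure trace_measure A"
    unfolding reference_def using assms QR
    by (subst trm.emeasure_pair_measure_Times) (auto simp: emeasure_pair_weight_Times)
  then have "ennreal (measure reference ((Q \<times> R) \<times> A)) = ennreal (mass Q * mass R * measure trace_measure A)"
    by (simp add: ref.emeasure_eq_measure trm.emeasure_eq_measure ennreal_mult mass_nonneg)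
  then show ?thesis by (simp add: mass_nonneg)
qed

definition jcode :: "nat \<Rightarrow> ('p \<times> 'p) \<times> 'x \<Rightarrow> (nat set \<times> nat set) \<times> 'c" where
  "jcode N y = ((bits N (fst (fst y)), bits N (snd (fst y))), c N (snd y))"

sublocale jc: coding reference jcode
proof -
  have "coding ((borel \<Otimes>\<^sub>M borel) \<Otimes>\<^sub>M M) jcode"
    using coding_prod[OF coding_prod[OF coding_bits coding_bits] coding_axioms]
    unfolding jcode_def[abs_def] .
  moreover have "sets ((borel \<Otimes>\<^sub>M borel) \<Otimes>\<^sub>M M) = sets reference"
    unfolding sets_reference by (rule sets_pair_measure_cong) (simp_all only: borel_prod sets_lborel)
  ultimately show "coding reference jcode" by (rule coding_cong)
qed

definition xcell :: "nat \<Rightarrow> 'c \<Rightarrow> 'x set" where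
  "xcell N L = {z \<in> space M. c N z = L}"

lemma xcell_sets [measurable]: "xcell N L \<in> sets M"
  unfolding xcell_def by (rule cell_sets1)

lemma jcell: "{y \<in> space reference. jcode N y = ((I, K), L)} = (bit_cell N I \<times> bit_cell N K) \<times> xcell N L"
  by (auto simp: jcode_def bit_cell_def xcell_def space_reference)

text \<open>The weight is that of \<open>entry\<close>, so that \<open>J\<close> of a box is an
  entry (\<open>J_Times\<close>) and positivity of matrices can be used on cells.\<close>

definition J :: "(('p \<times> 'p) \<times> 'x) set \<Rightarrow> complex" where
  "J = joint (wt2 UNIV UNIV)"

lemma J_signed: "signed_measure reference (\<lambda>S. Re (J S))" "signed_measure reference (\<lambda>S. Im (J S))"
  using joint_signed[OF wt2_UNIV_L2] by (simp_all add: J_def signed_measure_def)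

lemma J_Times:
  assumes "A \<in> sets M"
  shows "J ((Q \<times> R) \<times> A) = entry Q R A"
  unfolding J_def joint_Times[OF assms] entry_def form_def
  by (intro Bochner_Integration.integral_cong refl) (auto simp: wt2_def wt_def indicator_def)

text \<open>The Hilbert-Schmidt norm of a positive matrix is at most its trace; this and the Cauchy-Schwarz
  inequality over the cells give the square root, and with it absolute continuity.\<close>

lemma J_cells_bound:
  "cmod (J {y \<in> space reference. jcode N y \<in> R}) \<le> sqrt (C * measure reference {y \<in> space reference. jcode N y \<in> R})"
proof -
  define T where "T = R \<inter> jcode N ` space reference"
  define U where "U = (Pow {..<N} \<times> Pow {..<N}) \<times> c N ` space M"
  have finU: "finite U" unfolding U_def using finite_range by auto
  have TU: "T \<subseteq> U" using bits_subset by (fastforce simp: T_def U_def jcode_def space_reference)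
  have finT: "finite T" using TU finU by (rule finite_subset)
  define \<tau> where "\<tau> I L = Re (entry (bit_cell N I) (bit_cell N I) (xcell N L)) / mass (bit_cell N I)" for I L
  define n where "n L = ptrace N (xcell N L)" for L
  have \<tau>0: "0 \<le> \<tau> I L" for I L unfolding \<tau>_def by (rule ptrace_term_nonneg) simp
  have n: "n L = (\<Sum>I\<in>Pow {..<N}. \<tau> I L)" for L by (simp add: n_def ptrace_def \<tau>_def)
  have n0: "0 \<le> n L" for L unfolding n_def by (rule ptrace_nonneg) simp
  have \<tau>n: "\<tau> I L = 0" if "n L = 0" "I \<in> Pow {..<N}" for I L
    using that \<tau>0 unfolding n by (subst (asm) sum_nonneg_eq_0_iff) auto
  \<comment> \<open>The square of \<open>x r * z r\<close> is the product of the two diagonal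
    entries that bounds the squared entry. It is split in this way because the squares of
    \<open>x\<close> sum to at most the reference measure, while those of \<open>z\<close>, summed
    first over \<open>I\<close> and \<open>K\<close>, give \<open>n L\<close> and then the
    compressed trace of the whole space.\<close>
  define x where "x r = (case r of ((I, K), L) \<Rightarrow> sqrt (mass (bit_cell N I) * mass (bit_cell N K) * n L))" for r
  define z where "z r = (case r of ((I, K), L) \<Rightarrow> sqrt (\<tau> I L * \<tau> K L / n L))" for r
  let ?J = "\<lambda>r. J {y \<in> space reference. jcode N y = r}"
  have Jr: "cmod (?J r) \<le> x r * z r" if "r \<in> U" for r
  proof -
    obtain I K L where r: "r = ((I, K), L)" by (metis prod.exhaust)
    with that have IK: "I \<in> Pow {..<N}" "K \<in> Pow {..<N}" by (auto simp: U_def)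
    let ?a = "Re (entry (bit_cell N I) (bit_cell N I) (xcell N L))" and ?b = "Re (entry (bit_cell N K) (bit_cell N K) (xcell N L))"
    have am: "?a = mass (bit_cell N I) * \<tau> I L" "?b = mass (bit_cell N K) * \<tau> K L"
      by (cases "mass (bit_cell N I) = 0"; cases "mass (bit_cell N K) = 0"; simp add: \<tau>_def entry_mass_zero)+
    have "(cmod (?J r))\<^sup>2 \<le> ?a * ?b"
      unfolding r jcell J_Times[OF xcell_sets] by (rule entry_facts(6)) auto
    also have "?a * ?b = (x r * z r)\<^sup>2"
    proof (cases "n L = 0")
      case True
      then show ?thesis using \<tau>n[OF True IK(1)] by (simp add: am r x_def z_def)
    next
      case False
      have "(x r * z r)\<^sup>2 = (mass (bit_cell N I) * mass (bit_cell N K) * n L) * (\<tau> I L * \<tau> K L / n L)"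
        using mass_nonneg \<tau>0 n0 by (simp add: r x_def z_def power_mult_distrib)
      then show ?thesis using False by (simp add: am)
    qed
    finally show ?thesis
      by (rule power2_le_imp_le) (auto simp: r x_def z_def mass_nonneg \<tau>0 n0)
  qed
  have "J {y \<in> space reference. jcode N y \<in> R} = (\<Sum>r\<in>T. ?J r)"
    unfolding complex_eq_iff Re_sum Im_sum T_def
    using jc.signed_cell_decomposition[OF J_signed(1)] jc.signed_cell_decomposition[OF J_signed(2)] by simp
  then have "cmod (J {y \<in> space reference. jcode N y \<in> R}) \<le> (\<Sum>r\<in>T. x r * z r)"
    using Jr TU by (auto intro!: order_trans[OF norm_sum] sum_mono)
  moreover have "(\<Sum>r\<in>T. x r * z r)\<^sup>2 \<le> C * measure reference {y \<in> space reference. jcode N y \<in> R}"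
  proof -
    have "(\<Sum>r\<in>T. x r * z r)\<^sup>2 \<le> (\<Sum>r\<in>T. (x r)\<^sup>2) * (\<Sum>r\<in>T. (z r)\<^sup>2)"
      by (rule Cauchy_Schwarz_ineq_sum)
    also have "(\<Sum>r\<in>T. (x r)\<^sup>2) \<le> (\<Sum>r\<in>T. measure reference {y \<in> space reference. jcode N y = r})"
    proof (rule sum_mono)
      fix r assume "r \<in> T"
      obtain I K L where r: "r = ((I, K), L)" by (metis prod.exhaust)
      have "(x r)\<^sup>2 = mass (bit_cell N I) * mass (bit_cell N K) * n L"
        using mass_nonneg n0 by (simp add: r x_def)
      also have "\<dots> \<le> mass (bit_cell N I) * mass (bit_cell N K) * measure trace_measure (xcell N L)"
        unfolding n_def by (intro mult_left_mono ptrace_le_trace_measure mult_nonneg_nonneg mass_nonneg) simp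
      also have "\<dots> = measure reference {y \<in> space reference. jcode N y = r}"
        unfolding r jcell by (rule measure_reference_Times[symmetric]) auto
      finally show "(x r)\<^sup>2 \<le> measure reference {y \<in> space reference. jcode N y = r}" .
    qed
    also have "\<dots> = measure reference {y \<in> space reference. jcode N y \<in> R}"
      unfolding T_def by (rule jc.cell_decomposition[symmetric]) (auto intro: ref.finite_measure_axioms)
    also have "(\<Sum>r\<in>T. (z r)\<^sup>2) \<le> (\<Sum>r\<in>U. (z r)\<^sup>2)"
      by (rule sum_mono2[OF finU TU]) auto
    also have "\<dots> = (\<Sum>L\<in>c N ` space M. \<Sum>I\<in>Pow {..<N}. \<Sum>K\<in>Pow {..<N}. \<tau> I L * \<tau> K L / n L)"
    proof -
      have zr: "(z ((I, K), L))\<^sup>2 = \<tau> I L * \<tau> K L / n L" for I K L using \<tau>0 n0 by (simp add: z_def)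
      have "(\<Sum>r\<in>U. (z r)\<^sup>2) = (\<Sum>p\<in>Pow {..<N} \<times> Pow {..<N}. \<Sum>L\<in>c N ` space M. (z (p, L))\<^sup>2)"
        unfolding U_def by (subst sum.cartesian_product) simp
      also have "\<dots> = (\<Sum>L\<in>c N ` space M. \<Sum>p\<in>Pow {..<N} \<times> Pow {..<N}. (z (p, L))\<^sup>2)" by (rule sum.swap)
      also have "\<dots> = (\<Sum>L\<in>c N ` space M. \<Sum>I\<in>Pow {..<N}. \<Sum>K\<in>Pow {..<N}. (z ((I, K), L))\<^sup>2)"
        by (simp add: sum.cartesian_product case_prod_beta')
      finally show ?thesis by (simp only: zr)
    qed
    also have "\<dots> = (\<Sum>L\<in>c N ` space M. n L)"
    proof (rule sum.cong[OF refl])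
      fix L
      have "(\<Sum>I\<in>Pow {..<N}. \<Sum>K\<in>Pow {..<N}. \<tau> I L * \<tau> K L / n L) = n L * n L / n L"
        unfolding n by (simp add: sum_product sum_divide_distrib)
      then show "(\<Sum>I\<in>Pow {..<N}. \<Sum>K\<in>Pow {..<N}. \<tau> I L * \<tau> K L / n L) = n L" by simp
    qed
    also have "\<dots> = ptrace N (space M)"
      using signed_cell_decomposition[OF ptrace_signed, of N N UNIV] by (simp add: n_def xcell_def)
    also have "\<dots> \<le> C" by (rule ptrace_le) simp
    finally show ?thesis
      by (simp add: mult.commute mult_left_mono mult_right_mono sum_nonneg)
  qed
  ultimately show ?thesis
    by (meson order_trans real_le_rsqrt)
qed

text \<open>The bound on unions of cells reaches a null set through approximation by such a union
  \<open>S'\<close>, for the reference measure and all four variations at once. Then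
  \<open>S'\<close> has reference measure at most \<open>e\<close>. Each variation changes by less
  than \<open>e\<close>, so real and imaginary part change by at most \<open>2 * e\<close> each,
  which explains \<open>4 * e\<close> next to the square root.\<close>

lemma J_absolutely_continuous:
  assumes S: "S \<in> null_sets reference"
  shows "J S = 0"
proof -
  let ?T = "{pos_variation reference (\<lambda>S. Re (J S)), pos_variation reference (\<lambda>A. - Re (J A)),
    pos_variation reference (\<lambda>S. Im (J S)), pos_variation reference (\<lambda>A. - Im (J A)), reference}"
  note fin = finite_measure_pos_variation[OF J_signed(1)] finite_measure_pos_variation[OF J_signed(2)]
    finite_measure_pos_variation[OF signed_measure_uminus[OF J_signed(1)]]
    finite_measure_pos_variation[OF signed_measure_uminus[OF J_signed(2)]] ref.finite_measure_axioms
  have Sm: "S \<in> sets reference" using S by auto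
  have diff: "\<bar>s S - s S'\<bar> \<le> 2 * e"
    if s: "signed_measure reference s" and S': "S' \<in> sets reference"
      and e: "measure (pos_variation reference s) (sym_diff S S') < e"
        "measure (pos_variation reference (\<lambda>A. - s A)) (sym_diff S S') < e" for s S' e
  proof -
    have md: "\<bar>measure P S - measure P S'\<bar> \<le> measure P (sym_diff S S')"
      if "finite_measure P" "sets P = sets reference" for P
    proof -
      interpret finite_measure P by fact
      have "measure P S \<le> measure P S' + measure P (sym_diff S S')"
        by (rule order_trans[OF finite_measure_mono measure_Un_le]) (use Sm S' that(2) in auto)
      moreover have "measure P S' \<le> measure P S + measure P (sym_diff S S')"
        by (rule order_trans[OF finite_measure_mono measure_Un_le]) (use Sm S' that(2) in auto)
      ultimately show ?thesis by linarith
    qed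
    show ?thesis
      using md[OF finite_measure_pos_variation[OF s] sets_pos_variation]
        md[OF finite_measure_pos_variation[OF signed_measure_uminus[OF s]] sets_pos_variation]
        jordan_decomposition[OF s Sm] jordan_decomposition[OF s S'] e by linarith
  qed
  have small: "cmod (J S) \<le> 4 * e + sqrt (C * e)" if e: "e > 0" for e
  proof -
    have T: "\<tau> \<in> ?T \<Longrightarrow> finite_measure \<tau>" "\<tau> \<in> ?T \<Longrightarrow> sets \<tau> = sets reference" for \<tau>
      using fin by (elim insertE; simp; fail)+
    obtain N R where NR: "\<forall>\<tau>\<in>?T. measure \<tau> (sym_diff S {y \<in> space reference. jcode N y \<in> R}) < e"
      using jc.approximation[of ?T S e] T Sm e by blast
    define S' where "S' = {y \<in> space reference. jcode N y \<in> R}"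
    have S': "S' \<in> sets reference" unfolding S'_def by (rule jc.cell_sets)
    note NR' = NR[folded S'_def]
    have "\<bar>Re (J S) - Re (J S')\<bar> \<le> 2 * e"
      by (rule diff[OF J_signed(1) S']) (use NR' in auto)
    moreover have "\<bar>Im (J S) - Im (J S')\<bar> \<le> 2 * e"
      by (rule diff[OF J_signed(2) S']) (use NR' in auto)
    ultimately have "cmod (J S - J S') \<le> 4 * e"
      using cmod_le[of "J S - J S'"] by simp
    moreover have "cmod (J S') \<le> sqrt (C * e)"
    proof -
      have "measure reference S' \<le> measure reference S + measure reference (sym_diff S S')"
        by (rule order_trans[OF ref.finite_measure_mono measure_Un_le]) (use Sm S' in auto)
      also have "measure reference S = 0" using S by (simp add: null_sets_def measure_def)
      finally have "measure reference S' \<le> e" using NR' by auto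
      then have "C * measure reference S' \<le> C * e" using C_nonneg by (intro mult_left_mono) auto
      then show ?thesis
        using J_cells_bound[of N R] unfolding S'_def[symmetric] by (meson order_trans real_sqrt_le_mono)
    qed
    moreover have "cmod (J S) \<le> cmod (J S - J S') + cmod (J S')"
      using norm_triangle_ineq[of "J S - J S'" "J S'"] by simp
    ultimately show ?thesis by linarith
  qed
  have inv0: "(\<lambda>n. 1 / real (Suc n)) \<longlonglongrightarrow> 0" by (rule LIMSEQ_Suc[OF lim_1_over_n])
  have lim: "(\<lambda>n. 4 * (1 / real (Suc n)) + sqrt (C * (1 / real (Suc n)))) \<longlonglongrightarrow> 4 * 0 + sqrt (C * 0)"
    by (intro tendsto_intros inv0)
  have "cmod (J S) \<le> 4 * 0 + sqrt (C * 0)"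
  proof (rule LIMSEQ_le_const[OF lim], intro exI allI impI)
    show "cmod (J S) \<le> 4 * (1 / real (Suc n)) + sqrt (C * (1 / real (Suc n)))" for n
      by (rule small) simp
  qed
  then show ?thesis by simp
qed

theorem joint_density:
  "\<exists>F :: ('p \<times> 'p) \<times> 'x \<Rightarrow> complex. integrable reference F \<and>
     (\<forall>S\<in>sets reference. J S = (LINT y|reference. indicator S y * F y))"
proof -
  obtain F1 :: "_ \<Rightarrow> real" where F1: "integrable reference F1" "\<forall>S\<in>sets reference. Re (J S) = (LINT y|reference. indicator S y * F1 y)"
    using signed_Radon_Nikodym[OF ref.finite_measure_axioms J_signed(1)] J_absolutely_continuous by auto
  obtain F2 :: "_ \<Rightarrow> real" where F2: "integrable reference F2" "\<forall>S\<in>sets reference. Im (J S) = (LINT y|reference. indicator S y * F2 y)"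
    using signed_Radon_Nikodym[OF ref.finite_measure_axioms J_signed(2)] J_absolutely_continuous by auto
  let ?F = "\<lambda>y. complex_of_real (F1 y) + \<i> * complex_of_real (F2 y)"
  have "J S = (LINT y|reference. indicator S y * ?F y)" if S: "S \<in> sets reference" for S
  proof -
    have i: "integrable reference (\<lambda>y. indicator S y * f y)" if "integrable reference f" for f :: "_ \<Rightarrow> real"
      using integrable_real_mult_indicator[OF S that] by (simp add: mult.commute)
    have "(LINT y|reference. indicator S y * ?F y) =
        (LINT y|reference. complex_of_real (indicator S y * F1 y) + \<i> * complex_of_real (indicator S y * F2 y))"
      by (intro Bochner_Integration.integral_cong refl) (simp add: indicator_def)
    also have "\<dots> = of_real (LINT y|reference. indicator S y * F1 y) + \<i> * of_real (LINT y|reference. indicator S y * F2 y)"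
    proof -
      have c: "integrable reference (\<lambda>y. complex_of_real (indicator S y * F1 y))"
        "integrable reference (\<lambda>y. \<i> * complex_of_real (indicator S y * F2 y))"
        by (rule integrable_of_real[OF i[OF F1(1)]])
          (rule Bochner_Integration.integrable_mult_right, rule integrable_of_real[OF i[OF F2(1)]])
      show ?thesis
        unfolding Bochner_Integration.integral_add[OF c] integral_mult_right_zero integral_complex_of_real ..
    qed
    also have "\<dots> = J S"
      using F1(2) F2(2) S by (simp add: complex_eq_iff)
    finally show ?thesis by simp
  qed
  moreover have "integrable reference ?F" using F1(1) F2(1) by auto
  ultimately show ?thesis by blast
qed

end

section \<open>From the joint density to densities of the single kernels\<close>

lemma signed_measure_density:
  fixes g :: "'a \<Rightarrow> real"
  assumes g: "integrable \<nu> g" and sets: "sets \<nu> = sets M"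
  shows "signed_measure M (\<lambda>A. LINT z|\<nu>. indicator A z * g z)"
proof (rule signed_measureI)
  have i: "integrable \<nu> (\<lambda>z. indicator A z * g z)" if "A \<in> sets M" for A
    using integrable_real_mult_indicator[of A \<nu> g] that g sets by (simp add: mult.commute)
  show "\<forall>A\<in>sets M. \<bar>LINT z|\<nu>. indicator A z * g z\<bar> \<le> (LINT z|\<nu>. \<bar>g z\<bar>)"
  proof
    fix A assume A: "A \<in> sets M"
    have "\<bar>LINT z|\<nu>. indicator A z * g z\<bar> \<le> (LINT z|\<nu>. \<bar>indicator A z * g z\<bar>)"
      by (rule integral_abs_bound)
    also have "\<dots> \<le> (LINT z|\<nu>. \<bar>g z\<bar>)"
      by (rule integral_mono) (use i[OF A] g in \<open>auto simp: indicator_def\<close>)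
    finally show "\<bar>LINT z|\<nu>. indicator A z * g z\<bar> \<le> (LINT z|\<nu>. \<bar>g z\<bar>)" .
  qed
  fix A :: "nat \<Rightarrow> 'a set" assume r: "range A \<subseteq> sets M" and d: "disjoint_family A"
  then have Am: "A i \<in> sets M" for i by auto
  have ind: "(\<Sum>i<n. indicator (A i) z * g z) = indicator (\<Union>i<n. A i) z * g z" for n z
    using d unfolding sum_distrib_right[symmetric]
    by (subst indicator_UN_disjoint) (auto intro: disjoint_family_on_mono)
  have "(\<Sum>i<n. LINT z|\<nu>. indicator (A i) z * g z) = (LINT z|\<nu>. indicator (\<Union>i<n. A i) z * g z)" for n
    unfolding ind[symmetric] by (rule Bochner_Integration.integral_sum[symmetric]) (rule i[OF Am])
  moreover have "(\<lambda>n. LINT z|\<nu>. indicator (\<Union>i<n. A i) z * g z) \<longlonglongrightarrow> (LINT z|\<nu>. indicator (\<Union>i. A i) z * g z)"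
  proof (rule integral_dominated_convergence[where w="\<lambda>z. \<bar>g z\<bar>"])
    show "(\<lambda>z. indicator (\<Union>i<n. A i) z * g z) \<in> borel_measurable \<nu>" for n
      using i[of "\<Union>i<n. A i"] Am by auto
    show "(\<lambda>z. indicator (\<Union>i. A i) z * g z) \<in> borel_measurable \<nu>"
      using i[of "\<Union>i. A i"] Am by auto
    show "AE z in \<nu>. (\<lambda>n. indicator (\<Union>i<n. A i) z * g z) \<longlonglongrightarrow> indicator (\<Union>i. A i) z * g z"
      by (intro AE_I2 tendsto_mult LIMSEQ_indicator_UN tendsto_const)
    show "AE z in \<nu>. norm (indicator (\<Union>i<n. A i) z * g z) \<le> \<bar>g z\<bar>" for n
      by (auto simp: indicator_def)
  qed (use g in auto)
  ultimately show "(\<lambda>n. LINT z|\<nu>. indicator (A n) z * g z) sums (LINT z|\<nu>. indicator (\<Union>n. A n) z * g z)"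
    by (simp add: sums_def)
qed

context psd_kernel
begin

definition bw :: "'p \<times> 'p \<Rightarrow> real" where
  "bw w = \<omega> (fst w) * \<omega> (snd w)"

lemma bw_pos: "0 < bw w"
  by (simp add: bw_def \<omega>_pos)

lemma wt2_bw: "wt2 UNIV UNIV w = of_real (bw w)"
  by (simp add: wt2_def wt_def bw_def)

lemma bw_measurable [measurable]: "bw \<in> borel_measurable borel"
proof -
  have "(\<lambda>w. \<omega> (fst w) * \<omega> (snd w)) \<in> borel_measurable (borel \<Otimes>\<^sub>M borel)" by measurable
  then show ?thesis by (simp add: bw_def[abs_def] borel_prod)
qed

lemma pair_weight_bw: "pair_weight = density lborel (\<lambda>w. ennreal ((bw w)\<^sup>2))"
  by (simp add: pair_weight_def wt2_bw)

lemma AE_pair_weight: "(AE w in pair_weight. P w) \<longleftrightarrow> (AE w in lborel. P w)"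
  unfolding pair_weight_bw using bw_pos by (subst AE_density) (auto simp: less_imp_neq[symmetric])

text \<open>For fixed \<open>A\<close> the measure \<open>D \<mapsto> J (D \<times> A)\<close> has
  two Lebesgue densities: \<open>bw w * \<kappa> w A\<close> by definition, and \<open>bw w\<close>
  squared times the integral of \<open>F\<close> over \<open>A\<close> by Radon-Nikodym. They agree
  almost everywhere, and one factor \<open>bw\<close> cancels. The null set still depends on
  \<open>A\<close>.\<close>

lemma kernel_density_AE:
  assumes F: "integrable reference F" and J: "\<forall>S\<in>sets reference. J S = (LINT y|reference. indicator S y * F y)"
    and A: "A \<in> sets M"
  shows "AE w in lborel. \<kappa> w A = (LINT z|trace_measure. indicator A z * (of_real (bw w) * F (w, z)))"
proof -
  define G where "G w = (LINT z|trace_measure. indicator A z * F (w, z))" for w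
  have UA: "D \<times> A \<in> sets reference" if "D \<in> sets borel" for D
    using A that by simp
  have ind: "indicator (D \<times> A) (w, z) = indicator D w * (indicator A z :: complex)" for D w z
    by (simp add: indicator_def)
  have iD: "integrable reference (\<lambda>y. indicator (D \<times> A) y * F y)" if "D \<in> sets borel" for D
    using integrable_mult_indicator[OF UA[OF that] F]
    by (rule Bochner_Integration.integrable_cong[OF refl, THEN iffD1, rotated]) (simp add: indicator_def)
  have GD: "integrable pair_weight (\<lambda>w. indicator D w * G w)"
    "J (D \<times> A) = (LINT w|pair_weight. indicator D w * G w)" if D: "D \<in> sets borel" for D
  proof -
    have "integrable pair_weight (\<lambda>w. LINT z|trace_measure. indicator (D \<times> A) (w, z) * F (w, z))"
      using pwtr.integrable_fst'[OF iD[OF D, unfolded reference_def]] .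
    moreover have "(LINT z|trace_measure. indicator (D \<times> A) (w, z) * F (w, z)) = indicator D w * G w" for w
      unfolding ind G_def by (simp add: mult.assoc)
    ultimately show "integrable pair_weight (\<lambda>w. indicator D w * G w)" by simp
    show "J (D \<times> A) = (LINT w|pair_weight. indicator D w * G w)"
      using J UA[OF D] pwtr.integral_fst'[OF iD[OF D, unfolded reference_def], symmetric]
      by (simp add: reference_def ind G_def mult.assoc)
  qed
  have Gm [measurable]: "G \<in> borel_measurable borel"
    using borel_measurable_integrable[OF GD(1)[of UNIV]] by simp
  have h1: "integrable lborel (\<lambda>w. of_real (bw w) * \<kappa> w A)"
    using L2_mult_integrable[OF wt2_UNIV_L2 kernel_L2[OF A]] by (simp add: wt2_bw)
  have h2: "integrable lborel (\<lambda>w. (bw w)\<^sup>2 *\<^sub>R G w)"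
  proof -
    have "integrable pair_weight G" using GD(1)[of UNIV] by simp
    then show ?thesis unfolding pair_weight_bw by (subst (asm) integrable_density) auto
  qed
  have "AE w in lborel. of_real (bw w) * \<kappa> w A = (bw w)\<^sup>2 *\<^sub>R G w"
  proof (rule sigma_finite_measure.density_unique_banach[OF sigma_finite_lborel h1 h2])
    fix D assume D: "D \<in> sets (lborel :: ('p \<times> 'p) measure)"
    then have Db: "D \<in> sets borel" by simp
    have "set_lebesgue_integral lborel D (\<lambda>w. of_real (bw w) * \<kappa> w A) = J (D \<times> A)"
      unfolding J_def joint_Times[OF A] set_lebesgue_integral_def
      by (intro Bochner_Integration.integral_cong refl) (simp add: wt2_bw indicator_def)
    also have "\<dots> = (LINT w|lborel. (bw w)\<^sup>2 *\<^sub>R (indicator D w * G w))"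
      unfolding GD(2)[OF Db] unfolding pair_weight_bw using Db by (intro integral_density) auto
    also have "\<dots> = set_lebesgue_integral lborel D (\<lambda>w. (bw w)\<^sup>2 *\<^sub>R G w)"
      unfolding set_lebesgue_integral_def
      by (intro Bochner_Integration.integral_cong refl) (simp add: indicator_def)
    finally show "set_lebesgue_integral lborel D (\<lambda>w. of_real (bw w) * \<kappa> w A) =
        set_lebesgue_integral lborel D (\<lambda>w. (bw w)\<^sup>2 *\<^sub>R G w)" .
  qed
  then show ?thesis
  proof eventually_elim
    case (elim w)
    have "of_real (bw w) * \<kappa> w A = of_real (bw w) * (of_real (bw w) * G w)"
      using elim by (simp add: scaleR_conv_of_real power2_eq_square)
    then have "\<kappa> w A = of_real (bw w) * G w" using bw_pos[of w] by simp
    also have "\<dots> = (LINT z|trace_measure. of_real (bw w) * (indicator A z * F (w, z)))"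
      unfolding G_def by (rule integral_mult_right_zero[symmetric])
    also have "\<dots> = (LINT z|trace_measure. indicator A z * (of_real (bw w) * F (w, z)))"
      by (simp only: mult.left_commute)
    finally show ?case .
  qed
qed

text \<open>At a fixed \<open>w\<close> both sides are complex measures of \<open>A\<close>, so
  their difference vanishes as soon as it vanishes on cells. The equality has thus to be arranged
  for countably many sets only, which makes one null set enough.\<close>

lemma kernel_equals_density:
  assumes g: "integrable trace_measure g"
    and cells: "\<And>N L. L \<in> c N ` space M \<Longrightarrow> \<kappa> w (xcell N L) = (LINT z|trace_measure. indicator (xcell N L) z * g z)"
    and A: "A \<in> sets M"
  shows "\<kappa> w A = (LINT z|trace_measure. indicator A z * g z)"
proof -
  have ig: "integrable trace_measure (\<lambda>z. indicator A z * g z)" if "A \<in> sets M" for A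
  proof -
    have "integrable trace_measure (\<lambda>z. indicat_real A z *\<^sub>R g z)"
      using that by (intro integrable_mult_indicator g) simp
    then show ?thesis
      by (rule Bochner_Integration.integrable_cong[OF refl, THEN iffD1, rotated]) (simp add: indicator_def)
  qed
  have Re: "Re (LINT z|trace_measure. indicator A z * g z) = (LINT z|trace_measure. indicator A z * Re (g z))"
    and Im: "Im (LINT z|trace_measure. indicator A z * g z) = (LINT z|trace_measure. indicator A z * Im (g z))"
    if "A \<in> sets M" for A
    unfolding integral_Re[OF ig[OF that], symmetric] integral_Im[OF ig[OF that], symmetric]
    by (intro Bochner_Integration.integral_cong refl; simp add: indicator_def)+
  have cells': "\<kappa> w (xcell N L) = (LINT z|trace_measure. indicator (xcell N L) z * g z)" for N L
  proof (cases "L \<in> c N ` space M")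
    case False
    then have "xcell N L = {}" by (auto simp: xcell_def)
    then show ?thesis using complex_measure_empty[OF cm] by simp
  qed (rule cells)
  have "Re (\<kappa> w A) - (LINT z|trace_measure. indicator A z * Re (g z)) = 0"
  proof (rule signed_measure_zero[OF _ _ A])
    show "signed_measure M (\<lambda>A. Re (\<kappa> w A) - (LINT z|trace_measure. indicator A z * Re (g z)))"
      using signed_measure_add[OF signed_measure_Re_Im(1)[OF cm[of w]] signed_measure_uminus[OF signed_measure_density[of trace_measure "\<lambda>z. Re (g z)" M]]] g
      by simp
    show "Re (\<kappa> w {y \<in> space M. c N y = a}) - (LINT z|trace_measure. indicator {y \<in> space M. c N y = a} z * Re (g z)) = 0" for N a
      using cells'[of N a] Re[OF xcell_sets, of N a] by (simp add: xcell_def)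
  qed
  moreover have "Im (\<kappa> w A) - (LINT z|trace_measure. indicator A z * Im (g z)) = 0"
  proof (rule signed_measure_zero[OF _ _ A])
    show "signed_measure M (\<lambda>A. Im (\<kappa> w A) - (LINT z|trace_measure. indicator A z * Im (g z)))"
      using signed_measure_add[OF signed_measure_Re_Im(2)[OF cm[of w]] signed_measure_uminus[OF signed_measure_density[of trace_measure "\<lambda>z. Im (g z)" M]]] g
      by simp
    show "Im (\<kappa> w {y \<in> space M. c N y = a}) - (LINT z|trace_measure. indicator {y \<in> space M. c N y = a} z * Im (g z)) = 0" for N a
      using cells'[of N a] Im[OF xcell_sets, of N a] by (simp add: xcell_def)
  qed
  ultimately show ?thesis using Re[OF A] Im[OF A] by (simp add: complex_eq_iff)
qed

text \<open>On the sets where real or imaginary part of \<open>g\<close> has one sign, its integral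
  is a part of a value of \<open>\<kappa> w\<close>, at most \<open>tvr w\<close> in modulus; there
  are four such sets.\<close>

lemma density_norm_bound:
  assumes g: "integrable trace_measure g"
    and eq: "\<And>A. A \<in> sets M \<Longrightarrow> \<kappa> w A = (LINT z|trace_measure. indicator A z * g z)"
  shows "(LINT z|trace_measure. cmod (g z)) \<le> 4 * tvr w"
proof -
  have gm [measurable]: "g \<in> borel_measurable M"
    using borel_measurable_integrable[OF g] by (simp add: measurable_cong_sets[OF sets_trace_measure refl])
  have ig: "integrable trace_measure (\<lambda>z. indicator A z * g z)" if "A \<in> sets M" for A
  proof -
    have "integrable trace_measure (\<lambda>z. indicat_real A z *\<^sub>R g z)"
      using that by (intro integrable_mult_indicator g) simp
    then show ?thesis
      by (rule Bochner_Integration.integrable_cong[OF refl, THEN iffD1, rotated]) (simp add: indicator_def)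
  qed
  have part: "(LINT z|trace_measure. \<bar>h z\<bar>) \<le> 2 * tvr w"
    if h: "integrable trace_measure h" and hm [measurable]: "h \<in> borel_measurable M"
      and le: "\<And>A. A \<in> sets M \<Longrightarrow> \<bar>LINT z|trace_measure. indicator A z * h z\<bar> \<le> tvr w" for h :: "'x \<Rightarrow> real"
  proof -
    let ?P = "{z \<in> space M. 0 \<le> h z}" and ?N = "{z \<in> space M. h z < 0}"
    have ih: "integrable trace_measure (\<lambda>z. indicator A z * h z)" if "A \<in> sets M" for A
      using integrable_real_mult_indicator[of A trace_measure h] that h by (simp add: mult.commute)
    have PN: "?P \<in> sets M" "?N \<in> sets M" by measurable
    have "(LINT z|trace_measure. \<bar>h z\<bar>) = (LINT z|trace_measure. indicator ?P z * h z - indicator ?N z * h z)"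
      by (intro Bochner_Integration.integral_cong refl) (auto simp: indicator_def)
    also have "\<dots> = (LINT z|trace_measure. indicator ?P z * h z) - (LINT z|trace_measure. indicator ?N z * h z)"
      by (rule Bochner_Integration.integral_diff[OF ih[OF PN(1)] ih[OF PN(2)]])
    also have "\<dots> \<le> 2 * tvr w" using le[OF PN(1)] le[OF PN(2)] by linarith
    finally show ?thesis .
  qed
  have Re: "(LINT z|trace_measure. \<bar>Re (g z)\<bar>) \<le> 2 * tvr w"
  proof (rule part)
    fix A assume A: "A \<in> sets M"
    have "(LINT z|trace_measure. indicator A z * Re (g z)) = Re (\<kappa> w A)"
      unfolding eq[OF A] integral_Re[OF ig[OF A], symmetric]
      by (intro Bochner_Integration.integral_cong refl) (simp add: indicator_def)
    then show "\<bar>LINT z|trace_measure. indicator A z * Re (g z)\<bar> \<le> tvr w"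
      using kernel_bound[OF A, of w] abs_Re_le_cmod[of "\<kappa> w A"] by simp
  qed (use g in auto)
  have Im: "(LINT z|trace_measure. \<bar>Im (g z)\<bar>) \<le> 2 * tvr w"
  proof (rule part)
    fix A assume A: "A \<in> sets M"
    have "(LINT z|trace_measure. indicator A z * Im (g z)) = Im (\<kappa> w A)"
      unfolding eq[OF A] integral_Im[OF ig[OF A], symmetric]
      by (intro Bochner_Integration.integral_cong refl) (simp add: indicator_def)
    then show "\<bar>LINT z|trace_measure. indicator A z * Im (g z)\<bar> \<le> tvr w"
      using kernel_bound[OF A, of w] abs_Im_le_cmod[of "\<kappa> w A"] by simp
  qed (use g in auto)
  have "(LINT z|trace_measure. cmod (g z)) \<le> (LINT z|trace_measure. \<bar>Re (g z)\<bar> + \<bar>Im (g z)\<bar>)"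
    by (rule integral_mono) (use g cmod_le in auto)
  also have "\<dots> = (LINT z|trace_measure. \<bar>Re (g z)\<bar>) + (LINT z|trace_measure. \<bar>Im (g z)\<bar>)"
    by (rule Bochner_Integration.integral_add) (use g in auto)
  finally show ?thesis using Re Im by linarith
qed

theorem kernel_factorization:
  "\<exists>f. (\<lambda>(w, z). f w z) \<in> borel_measurable (lborel \<Otimes>\<^sub>M trace_measure) \<and> f \<in> L2_L1 lborel trace_measure \<and>
     (AE w in lborel. integrable trace_measure (f w) \<and>
        (\<forall>A\<in>sets M. \<kappa> w A = (LINT z|trace_measure. indicator A z * f w z)))"
proof -
  obtain F :: "('p \<times> 'p) \<times> 'x \<Rightarrow> complex" where F: "integrable reference F"
    and J: "\<forall>S\<in>sets reference. J S = (LINT y|reference. indicator S y * F y)"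
    using joint_density by blast
  define f where "f w z = of_real (bw w) * F (w, z)" for w z
  have fw: "f w = (\<lambda>z. of_real (bw w) * F (w, z))" for w by (simp add: f_def fun_eq_iff)
  have Fm [measurable]: "F \<in> borel_measurable (borel \<Otimes>\<^sub>M M)"
    using borel_measurable_integrable[OF F]
    by (subst measurable_cong_sets[OF _ refl, of _ reference]) (auto intro: sets_pair_measure_cong)
  have fm: "(\<lambda>(w, z). f w z) \<in> borel_measurable (borel \<Otimes>\<^sub>M M)"
    unfolding f_def by measurable
  have fm': "(\<lambda>(w, z). f w z) \<in> borel_measurable (lborel \<Otimes>\<^sub>M trace_measure)"
    using fm by (subst measurable_cong_sets[OF sets_pair_measure_cong[OF sets_lborel sets_trace_measure] refl])
  have int: "AE w in lborel. integrable trace_measure (f w)"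
  proof -
    have "AE w in pair_weight. integrable trace_measure (\<lambda>z. F (w, z))"
      by (rule pwtr.AE_integrable_fst') (use F in \<open>simp add: reference_def\<close>)
    then show ?thesis unfolding AE_pair_weight by eventually_elim (simp add: fw)
  qed
  \<comment> \<open>Countably many levels with finitely many cells each, hence a single null
    set.\<close>
  have cells: "AE w in lborel. \<forall>N. \<forall>L\<in>c N ` space M. \<kappa> w (xcell N L) = (LINT z|trace_measure. indicator (xcell N L) z * f w z)"
    unfolding AE_all_countable f_def
    by (intro allI AE_finite_allI finite_range kernel_density_AE[OF F J] xcell_sets)
  have eq: "AE w in lborel. integrable trace_measure (f w) \<and>
        (\<forall>A\<in>sets M. \<kappa> w A = (LINT z|trace_measure. indicator A z * f w z))"
    using int cells by eventually_elim (use kernel_equals_density in blast)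
  have "f \<in> L2_L1 lborel trace_measure"
    unfolding L2_L1_def
  proof (intro CollectI conjI fm')
    define n where "n w = (\<integral>\<^sup>+z. ennreal (cmod (f w z)) \<partial>trace_measure)" for w
    have [measurable]: "n \<in> borel_measurable lborel"
      unfolding n_def using fm' by (intro trm.borel_measurable_nn_integral) (simp add: case_prod_beta')
    \<comment> \<open>Pulling a constant out of the integral requires a measurable integrand, which
      \<open>n\<close> is, whereas \<open>tvr\<close> is not known to be. The square of the constant
      4 from \<open>density_norm_bound\<close> is therefore placed on the side of
      \<open>n\<close>.\<close>
    have "ennreal (1/16) * (\<integral>\<^sup>+w. (n w)\<^sup>2 \<partial>lborel) = (\<integral>\<^sup>+w. ennreal (1/16) * (n w)\<^sup>2 \<partial>lborel)"
      by (rule nn_integral_cmult[symmetric]) measurable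
    also have "\<dots> \<le> (\<integral>\<^sup>+w. (ennreal (tvr w))\<^sup>2 \<partial>lborel)"
    proof (rule nn_integral_mono_AE, use eq in eventually_elim)
      case (elim w)
      have "n w = ennreal (LINT z|trace_measure. cmod (f w z))"
        unfolding n_def using elim by (intro nn_integral_eq_integral) auto
      also have "\<dots> \<le> ennreal (4 * tvr w)"
        using elim by (intro ennreal_leI density_norm_bound) auto
      finally have "(n w)\<^sup>2 \<le> (ennreal (4 * tvr w))\<^sup>2" by (rule power_mono) simp
      then have "ennreal (1/16) * (n w)\<^sup>2 \<le> ennreal (1/16) * (ennreal (4 * tvr w))\<^sup>2" by (rule mult_left_mono) simp
      also have "\<dots> = (ennreal (tvr w))\<^sup>2"
        by (simp add: tvr_def ennreal_power ennreal_mult'[symmetric] power_mult_distrib)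
      finally show ?case .
    qed
    also have "\<dots> < \<infinity>" by (rule tvr_finite)
    finally show "(\<integral>\<^sup>+w. (\<integral>\<^sup>+z. ennreal (cmod (f w z)) \<partial>trace_measure)\<^sup>2 \<partial>lborel) < \<infinity>"
      unfolding n_def[symmetric] by (auto simp: ennreal_mult_less_top)
  qed
  with fm' eq show ?thesis by blast
qed

text \<open>Indicators are covered by \<open>form_nonneg\<close>; sums and monotone limits lead to
  \<phi>. The inner integral \<open>I u\<close> is at most a multiple of \<open>n\<close>, the L1
  norm of \<open>f w\<close>, which is square integrable in \<open>w\<close>; hence the pairing with
  \<open>a\<close> passes to the limit.\<close>

lemma density_form_nonneg:
  assumes f: "f \<in> L2_L1 lborel trace_measure"
    and eq: "AE w in lborel. integrable trace_measure (f w) \<and>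
        (\<forall>A\<in>sets M. \<kappa> w A = (LINT z|trace_measure. indicator A z * f w z))"
    and \<rho>: "\<rho> \<in> L2 lborel"
    and \<phi>: "\<phi> \<in> borel_measurable M" "\<And>z. 0 \<le> \<phi> z" "\<And>z. z \<in> space M \<Longrightarrow> \<phi> z \<le> B"
  shows "(LINT w|lborel. LINT z|trace_measure. \<rho> (fst w) * cnj (\<rho> (snd w)) * of_real (\<phi> z) * f w z) \<in> \<real>\<^sub>\<ge>\<^sub>0"
proof -
  have fm [measurable]: "(\<lambda>(w, z). f w z) \<in> borel_measurable (lborel \<Otimes>\<^sub>M trace_measure)"
    using f by (simp add: L2_L1_def)
  define a where "a w = \<rho> (fst w) * cnj (\<rho> (snd w))" for w
  have aL: "a \<in> L2 lborel" unfolding a_def[abs_def] by (rule L2_tensor(1)[OF \<rho> L2_cnj[OF \<rho>]])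
  note [measurable] = L2_measurable[OF aL]
  define n where "n w = (LINT z|trace_measure. cmod (f w z))" for w
  have [measurable]: "n \<in> borel_measurable lborel" unfolding n_def by measurable
  have n0: "0 \<le> n w" for w unfolding n_def by (rule Bochner_Integration.integral_nonneg) simp
  have nL: "(\<lambda>w. complex_of_real (n w)) \<in> L2 lborel"
  proof (rule L2_nnI)
    have "(\<integral>\<^sup>+w. ennreal ((cmod (complex_of_real (n w)))\<^sup>2) \<partial>lborel) = (\<integral>\<^sup>+w. (\<integral>\<^sup>+z. ennreal (cmod (f w z)) \<partial>trace_measure)\<^sup>2 \<partial>lborel)"
    proof (rule nn_integral_cong_AE, use eq in eventually_elim)
      case (elim w)
      have "(\<integral>\<^sup>+z. ennreal (cmod (f w z)) \<partial>trace_measure) = ennreal (n w)"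
        unfolding n_def using elim by (intro nn_integral_eq_integral) auto
      then show ?case using n0[of w] by (simp add: ennreal_power)
    qed
    then show "(\<integral>\<^sup>+w. ennreal ((cmod (complex_of_real (n w)))\<^sup>2) \<partial>lborel) < \<infinity>"
      using f by (simp add: L2_L1_def)
  qed measurable
  define I where "I u w = (LINT z|trace_measure. of_real (u z) * f w z)" for u :: "'x \<Rightarrow> real" and w
  have Im: "I u \<in> borel_measurable lborel" if "u \<in> borel_measurable M" for u
  proof -
    have [measurable]: "u \<in> borel_measurable trace_measure"
      using that by (simp add: measurable_cong_sets[OF sets_trace_measure refl])
    show ?thesis unfolding I_def by measurable
  qed
  have int: "integrable trace_measure (\<lambda>z. of_real (u z) * f w z)" "cmod (I u w) \<le> b * n w"
    if w: "integrable trace_measure (f w)" and u: "u \<in> borel_measurable M" "\<And>z. 0 \<le> u z" "\<And>z. z \<in> space M \<Longrightarrow> u z \<le> b" for u w b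
  proof -
    have um [measurable]: "u \<in> borel_measurable trace_measure"
      using u(1) by (simp add: measurable_cong_sets[OF sets_trace_measure refl])
    have [measurable]: "f w \<in> borel_measurable trace_measure" using w by auto
    have le: "cmod (of_real (u z) * f w z) \<le> b * cmod (f w z)" if "z \<in> space M" for z
      using u(2,3)[of z] that by (simp add: norm_mult mult_right_mono)
    have "norm (b * cmod (f w z)) \<ge> cmod (of_real (u z) * f w z)" if "z \<in> space M" for z
      using le[OF that] by simp
    then show i: "integrable trace_measure (\<lambda>z. of_real (u z) * f w z)"
      by (intro Bochner_Integration.integrable_bound[OF integrable_mult_right[OF integrable_norm[OF w], of b]]) auto
    have "cmod (I u w) \<le> (LINT z|trace_measure. cmod (of_real (u z) * f w z))"
      unfolding I_def by (rule integral_norm_bound)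
    also have "\<dots> \<le> (LINT z|trace_measure. b * cmod (f w z))"
      by (rule integral_mono) (use i w le in auto)
    finally show "cmod (I u w) \<le> b * n w" by (simp add: n_def)
  qed
  have IL: "I u \<in> L2 lborel" if u: "u \<in> borel_measurable M" "\<And>z. 0 \<le> u z" "\<And>z. z \<in> space M \<Longrightarrow> u z \<le> b" for u b
  proof (rule L2_bound[where c=b, OF nL Im[OF u(1)]])
    show "AE w in lborel. cmod (I u w) \<le> b * cmod (complex_of_real (n w))"
      using eq by eventually_elim (use int(2)[OF _ u] n0 in auto)
  qed
  \<comment> \<open>The induction visits functions that need not be bounded, so boundedness, which
    makes \<open>I u\<close> square integrable, is carried along as a premise. Summands and
    approximants inherit it because they are non-negative and lie below the given function.\<close>
  have "(\<exists>b. \<forall>z\<in>space M. \<phi> z \<le> b) \<longrightarrow> (LINT w|lborel. a w * I \<phi> w) \<in> \<real>\<^sub>\<ge>\<^sub>0"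
    using \<phi>(1,2)
  proof (induction rule: borel_measurable_induct_real)
    case (set A)
    have "(LINT w|lborel. a w * I (indicator A) w) = form a A"
      unfolding form_def
    proof (rule integral_cong_AE)
      show "AE w in lborel. a w * I (indicator A) w = a w * \<kappa> w A"
        using eq
      proof eventually_elim
        case (elim w)
        have "I (indicator A) w = (LINT z|trace_measure. indicator A z * f w z)"
          unfolding I_def by (intro Bochner_Integration.integral_cong refl) (simp add: indicator_def)
        then show ?case using elim set by simp
      qed
    qed (use Im[of "indicator A"] set meas in \<open>auto simp: borel_measurable_indicator\<close>)
    also have "\<dots> \<in> \<real>\<^sub>\<ge>\<^sub>0" unfolding a_def[abs_def] by (rule form_nonneg[OF \<rho> set])
    finally show ?case by blast
  next
    case (mult u x)
    show ?case
    proof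
      assume "\<exists>b. \<forall>z\<in>space M. x * u z \<le> b"
      then obtain b where b: "\<And>z. z \<in> space M \<Longrightarrow> x * u z \<le> b" by blast
      have Ix: "I (\<lambda>z. x * u z) = (\<lambda>w. of_real x * I u w)"
        unfolding I_def by (simp add: mult.assoc)
      have e: "(LINT w|lborel. a w * I (\<lambda>z. x * u z) w) = of_real x * (LINT w|lborel. a w * I u w)"
        unfolding Ix by (simp add: mult.left_commute)
      show "(LINT w|lborel. a w * I (\<lambda>z. x * u z) w) \<in> \<real>\<^sub>\<ge>\<^sub>0"
      proof (cases "x = 0")
        case False
        then have "x > 0" using mult.hyps(1) by simp
        then have "\<forall>z\<in>space M. u z \<le> b / x" using b by (auto simp: pos_le_divide_eq mult.commute)
        then show ?thesis using mult.IH mult.hyps(1) unfolding e by (auto intro!: nonneg_Reals_mult_I)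
      next
        case True
        then show ?thesis unfolding e by simp
      qed
    qed
  next
    case (add u v)
    show ?case
    proof
      assume "\<exists>b. \<forall>z\<in>space M. v z + u z \<le> b"
      then obtain b where b: "\<And>z. z \<in> space M \<Longrightarrow> v z + u z \<le> b" by blast
      have ub: "u z \<le> b" "v z \<le> b" if "z \<in> space M" for z
        using b[OF that] add.hyps(2,4)[of z] by linarith+
      have "(LINT w|lborel. a w * I (\<lambda>z. v z + u z) w) = (LINT w|lborel. a w * I v w + a w * I u w)"
      proof (rule integral_cong_AE)
        show "AE w in lborel. a w * I (\<lambda>z. v z + u z) w = a w * I v w + a w * I u w"
          using eq
        proof eventually_elim
          case (elim w)
          then have w: "integrable trace_measure (f w)" by simp
          show ?case
            unfolding I_def of_real_add distrib_right
            using int(1)[OF w add.hyps(3,4) ub(2)] int(1)[OF w add.hyps(1,2) ub(1)] by (simp add: distrib_left)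
        qed
      qed (use Im[OF add.hyps(1)] Im[OF add.hyps(3)] Im[of "\<lambda>z. v z + u z"] add in auto)
      also have "\<dots> = (LINT w|lborel. a w * I v w) + (LINT w|lborel. a w * I u w)"
        by (rule Bochner_Integration.integral_add)
          (rule L2_mult_integrable[OF aL IL[OF add.hyps(3,4) ub(2)]], simp,
           rule L2_mult_integrable[OF aL IL[OF add.hyps(1,2) ub(1)]], simp)
      also have "\<dots> \<in> \<real>\<^sub>\<ge>\<^sub>0"
        using add.IH ub by (intro nonneg_Reals_add_I) blast+
      finally show "(LINT w|lborel. a w * I (\<lambda>z. v z + u z) w) \<in> \<real>\<^sub>\<ge>\<^sub>0" .
    qed
  next
    case (seq U)
    show ?case
    proof
      assume "\<exists>b. \<forall>z\<in>space M. \<phi> z \<le> b"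
      then obtain b where b: "\<And>z. z \<in> space M \<Longrightarrow> \<phi> z \<le> b" by blast
      have Ub: "U i z \<le> b" if "z \<in> space M" for i z
      proof -
        have "incseq (\<lambda>i. U i z)" using seq.hyps(3) by (auto simp: incseq_def le_fun_def)
        from incseq_le[OF this seq.hyps(4)[OF that]] b[OF that] show ?thesis by (rule order_trans)
      qed
      have pos: "(LINT w|lborel. a w * I (U i) w) \<in> \<real>\<^sub>\<ge>\<^sub>0" for i using seq.IH[of i] Ub by blast
      have nb: "(\<lambda>w. of_real b * complex_of_real (n w)) \<in> L2 lborel" by (rule L2_cmult[OF nL])
      have "(\<lambda>i. l2n lborel (\<lambda>w. I (U i) w - I \<phi> w)) \<longlonglongrightarrow> 0"
      proof (rule l2_dominated(3)[OF Im[OF seq.hyps(1)] Im[OF \<phi>(1)] nb])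
        show "AE w in lborel. (\<lambda>i. I (U i) w) \<longlonglongrightarrow> I \<phi> w"
          using eq
        proof eventually_elim
          case (elim w)
          then have w: "integrable trace_measure (f w)" by simp
          show ?case unfolding I_def
          proof (rule integral_dominated_convergence[where w="\<lambda>z. b * cmod (f w z)"])
            show "AE z in trace_measure. (\<lambda>i. of_real (U i z) * f w z) \<longlonglongrightarrow> of_real (\<phi> z) * f w z"
              using seq.hyps(4) by (intro AE_I2 tendsto_intros) simp
            show "AE z in trace_measure. norm (of_real (U i z) * f w z) \<le> b * cmod (f w z)" for i
              using Ub[of _ i] seq.hyps(2)[of i] by (intro AE_I2) (simp add: norm_mult mult_right_mono)
          qed (use int(1)[OF w seq.hyps(1,2) Ub] int(1)[OF w \<phi>(1,2) b] w in auto)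
        qed
        show "AE w in lborel. cmod (I (U i) w) \<le> cmod (of_real b * complex_of_real (n w))" for i
          using eq
        proof eventually_elim
          case (elim w)
          then show ?case using int(2)[OF _ seq.hyps(1,2) Ub, of w i] n0[of w] abs_ge_self[of "b * n w"]
            by (simp add: norm_mult abs_mult)
        qed
      qed
      from l2ip_tendsto[OF IL[OF seq.hyps(1,2) Ub] IL[OF \<phi>(1,2) b] this L2_cnj[OF aL] L2_cnj[OF aL]]
      have lim: "(\<lambda>i. LINT w|lborel. a w * I (U i) w) \<longlonglongrightarrow> (LINT w|lborel. a w * I \<phi> w)"
        by (simp add: l2ip_def l2n_def mult.commute)
      show "(LINT w|lborel. a w * I \<phi> w) \<in> \<real>\<^sub>\<ge>\<^sub>0"
        by (rule closed_sequentially[OF closed_nonneg_Reals_complex pos lim])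
    qed
  qed
  then have "(LINT w|lborel. a w * I \<phi> w) \<in> \<real>\<^sub>\<ge>\<^sub>0" using \<phi>(3) by blast
  moreover have "(LINT z|trace_measure. \<rho> (fst w) * cnj (\<rho> (snd w)) * of_real (\<phi> z) * f w z) = a w * I \<phi> w" for w
    by (simp add: I_def a_def mult.assoc)
  ultimately show ?thesis by simp
qed

end

section \<open>Multiplier forms of square integrable functions of two variables\<close>

lemma l2n_mono:
  assumes g: "g \<in> L2 M" and f: "f \<in> borel_measurable M" and le: "\<And>x. cmod (f x) \<le> cmod (g x)"
  shows "l2n M f \<le> l2n M g"
proof -
  have fL: "f \<in> L2 M" by (rule L2_bound[where c=1, OF g f]) (use le in auto)
  show ?thesis unfolding l2n_def
    by (intro real_sqrt_le_mono integral_mono L2_integrable fL g power_mono le) simp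
qed

text \<open>A change on a null set can destroy Borel measurability, and the Bochner integral of a
  non-measurable function is 0 by convention; there is no third value.\<close>

lemma integral_AE_eq_cases:
  fixes f g :: "'a \<Rightarrow> complex"
  assumes "AE x in M. f x = g x" "g \<in> borel_measurable M"
  shows "integral\<^sup>L M f = integral\<^sup>L M g \<or> integral\<^sup>L M f = 0"
proof (cases "f \<in> borel_measurable M")
  case True
  then show ?thesis using integral_cong_AE[OF True assms(2,1)] by simp
next
  case False
  then have "\<not> integrable M f" by auto
  then show ?thesis by (simp add: not_integrable_integral_eq)
qed

text \<open>On the null set of those \<open>p\<close> for which \<open>v (p, \<cdot>)\<close> is not square integrable the operator returns an
  arbitrary function. The outer integral then either has its expected value or, if this junk destroys
  measurability, is 0; both are non-negative and obey the same upper bound.\<close>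

lemma (in bounded_symbol) multiplier_form_bounds:
  fixes v :: "'p::euclidean_space \<times> 'a \<Rightarrow> complex" and \<phi> :: "'a \<Rightarrow> real"
  assumes v: "v \<in> L2 lborel" and \<phi> [measurable]: "\<phi> \<in> borel_measurable borel" and \<phi>1: "\<And>x. \<bar>\<phi> x\<bar> \<le> 1"
    and \<rho>: "\<rho> \<in> L2 lborel" and Q [measurable]: "Q \<in> sets borel" and \<rho>Q: "\<And>p. p \<notin> Q \<Longrightarrow> \<rho> p = 0"
  defines "T \<equiv> LINT (p, q)|lborel. LINT x|lborel. (\<rho> p * cnj (\<rho> q)) * A (\<lambda>y. of_real (\<phi> y) * v (p, y)) x
      * cnj (of_real (\<phi> x) * v (q, x))"
  shows "T \<in> \<real>\<^sub>\<ge>\<^sub>0" "Re T \<le> B * ((l2n lborel \<rho>)\<^sup>2 * (l2n lborel (\<lambda>z. indicator Q (fst z) * v z))\<^sup>2)"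
proof -
  have vm [measurable]: "v \<in> borel_measurable (borel \<Otimes>\<^sub>M borel)" using L2_measurable[OF v] by (simp add: borel_prod)
  define good where "good p \<longleftrightarrow> (\<integral>\<^sup>+x. ennreal ((cmod (v (p, x)))\<^sup>2) \<partial>lborel) < \<infinity>" for p
  have gm [measurable]: "Measurable.pred borel good" unfolding good_def by measurable
  have good_L2: "(\<lambda>x. v (p, x)) \<in> L2 lborel" if "good p" for p
    using that unfolding good_def by (intro L2_nnI) auto
  have AE_good: "AE p in lborel. good p"
  proof -
    have "(\<integral>\<^sup>+p. \<integral>\<^sup>+x. ennreal ((cmod (v (p, x)))\<^sup>2) \<partial>lborel \<partial>lborel) = (\<integral>\<^sup>+z. ennreal ((cmod (v z))\<^sup>2) \<partial>(lborel \<Otimes>\<^sub>M lborel))"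
      by (rule lborel.nn_integral_fst) measurable
    also have "\<dots> = ennreal ((l2n lborel v)\<^sup>2)" by (simp add: lborel_prod nn_integral_l2n[OF v])
    finally have "(\<integral>\<^sup>+p. \<integral>\<^sup>+x. ennreal ((cmod (v (p, x)))\<^sup>2) \<partial>lborel \<partial>lborel) \<noteq> \<infinity>" by simp
    from nn_integral_PInf_AE[OF _ this] show ?thesis
      by (auto simp: good_def less_top)
  qed
  have AE_pair: "AE w in lborel. good (fst w) \<and> good (snd w)"
    unfolding lborel_prod[symmetric]
  proof (rule lborel_pair.AE_pair_measure)
    show "{x \<in> space (lborel \<Otimes>\<^sub>M lborel). good (fst x) \<and> good (snd x)} \<in> sets (lborel \<Otimes>\<^sub>M lborel)" by measurable
    show "AE x in lborel. AE y in lborel. good (fst (x, y)) \<and> good (snd (x, y))"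
      using AE_good
    proof eventually_elim
      case (elim x)
      then show ?case using AE_good by simp
    qed
  qed
  \<comment> \<open>The factor \<open>s\<close> is taken as 1 for the full family and as the
    indicator of \<open>Q\<close> for a localized one. Sections that are not square integrable are
    replaced by 0, so that every section lies in L2.\<close>
  have family: "L2_family (\<lambda>z. if good (fst z) then s (fst z) * of_real (\<phi> (snd z)) * v z else 0)"
    if s [measurable]: "s \<in> borel_measurable borel" and s1: "\<And>p. cmod (s p) \<le> 1" for s :: "'p \<Rightarrow> complex"
  proof
    have le: "cmod (if good (fst z) then s (fst z) * of_real (\<phi> (snd z)) * v z else 0) \<le> cmod (v z)" for z
      using mult_mono[OF s1[of "fst z"] \<phi>1[of "snd z"]] by (auto simp: norm_mult intro!: mult_left_le_one_le)
    have "(\<lambda>z. if good (fst z) then s (fst z) * of_real (\<phi> (snd z)) * v z else 0) \<in> borel_measurable (borel \<Otimes>\<^sub>M borel)"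
      by measurable
    then show m: "(\<lambda>z. if good (fst z) then s (fst z) * of_real (\<phi> (snd z)) * v z else 0) \<in> borel_measurable borel"
      by (simp add: borel_prod)
    show "(\<lambda>z. if good (fst z) then s (fst z) * of_real (\<phi> (snd z)) * v z else 0) \<in> L2 lborel"
      by (rule L2_bound[where c=1, OF v]) (use m le in auto)
    fix p
    show "(\<lambda>x. if good (fst (p, x)) then s (fst (p, x)) * of_real (\<phi> (snd (p, x))) * v (p, x) else 0) \<in> L2 lborel"
    proof (cases "good p")
      case True
      show ?thesis
        by (rule L2_bound[where c=1, OF good_L2[OF True]]) (use True le[of "(p, _)"] in auto)
    qed simp
  qed
  define g where "g = (\<lambda>z. if good (fst z) then 1 * of_real (\<phi> (snd z)) * v z else 0)"
  have gF: "L2_family g" unfolding g_def by (rule family) auto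
  interpret g: L2_family g by (rule gF)
  let ?G = "g.average \<rho>"
  let ?K = "\<lambda>w. \<rho> (fst w) * cnj (\<rho> (snd w)) * l2ip lborel (A (\<lambda>x. g (fst w, x))) (\<lambda>x. g (snd w, x))"
  have Km: "?K \<in> borel_measurable lborel"
  proof -
    note [measurable] = L2_measurable[OF \<rho>, simplified] kernel_measurable[OF g.g_meas g.section_L2]
    have "(\<lambda>(p, q). \<rho> p * cnj (\<rho> q) * l2ip lborel (A (\<lambda>x. g (p, x))) (\<lambda>x. g (q, x))) \<in> borel_measurable (borel \<Otimes>\<^sub>M borel)"
      by measurable
    then show ?thesis by (simp add: borel_prod case_prod_beta')
  qed
  have val: "integral\<^sup>L lborel ?K = l2ip lborel (A ?G) ?G"
    using kernel_average[OF gF \<rho>] by (simp add: case_prod_beta')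
  have "T = integral\<^sup>L lborel ?K \<or> T = 0"
    unfolding T_def
  proof (rule integral_AE_eq_cases[OF _ Km], use AE_pair in eventually_elim)
    case (elim w)
    obtain p q where w: "w = (p, q)" by (cases w)
    have gp: "(\<lambda>x. g (p, x)) = (\<lambda>y. of_real (\<phi> y) * v (p, y))" "(\<lambda>x. g (q, x)) = (\<lambda>y. of_real (\<phi> y) * v (q, y))"
      using elim by (auto simp: g_def w)
    have "(LINT x|lborel. (\<rho> p * cnj (\<rho> q)) * A (\<lambda>x. g (p, x)) x * cnj (g (q, x))) = ?K (p, q)"
      by (simp add: l2ip_def mult.assoc)
    then show ?case unfolding w gp by (simp add: g_def elim[unfolded w, simplified])
  qed
  then have T: "T = l2ip lborel (A ?G) ?G \<or> T = 0" by (simp only: val)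
  have GL: "?G \<in> L2 lborel" by (rule g.average_L2[OF \<rho>])
  show "T \<in> \<real>\<^sub>\<ge>\<^sub>0" using T A_nonneg[OF GL] by auto
  \<comment> \<open>\<rho> vanishes off \<open>Q\<close>, so cutting the family to \<open>Q\<close>
    leaves the average unchanged while only the norm of \<open>v\<close> over \<open>Q\<close>
    enters the bound. Over disjoint sets such bounds can be summed, as in
    \<open>limit_trace\<close>.\<close>
  define g' where "g' = (\<lambda>z. if good (fst z) then indicator Q (fst z) * of_real (\<phi> (snd z)) * v z else 0)"
  have gF': "L2_family g'" unfolding g'_def by (rule family) (auto simp: indicator_def)
  interpret g': L2_family g' by (rule gF')
  have "?G = g'.average \<rho>"
    unfolding g.average_def g'.average_def fun_eq_iff
    using \<rho>Q by (intro allI Bochner_Integration.integral_cong refl) (auto simp: g_def g'_def indicator_def)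
  then have "l2n lborel ?G \<le> l2n lborel \<rho> * l2n lborel g'" using g'.average_L2(2)[OF \<rho>] by simp
  also have "\<dots> \<le> l2n lborel \<rho> * l2n lborel (\<lambda>z. indicator Q (fst z) * v z)"
  proof (intro mult_left_mono l2n_mono)
    have "(\<lambda>z. indicator Q (fst z) * v z) \<in> borel_measurable (borel \<Otimes>\<^sub>M borel)" by measurable
    then have "(\<lambda>z. indicator Q (fst z) * v z) \<in> borel_measurable lborel" by (simp add: borel_prod)
    then show "(\<lambda>z. indicator Q (fst z) * v z) \<in> L2 lborel"
      by (rule L2_bound[where c=1, OF v]) (auto simp: indicator_def)
    show "cmod (g' z) \<le> cmod (indicator Q (fst z) * v z)" for z
      using \<phi>1[of "snd z"] by (auto simp: g'_def indicator_def norm_mult intro!: mult_left_le_one_le)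
  qed (use g'.g_meas in auto)
  finally have le: "l2n lborel ?G \<le> l2n lborel \<rho> * l2n lborel (\<lambda>z. indicator Q (fst z) * v z)" .
  have "Re (l2ip lborel (A ?G) ?G) \<le> B * l2n lborel ?G * l2n lborel ?G"
    using complex_Re_le_cmod A_bound[OF GL GL] by (rule order_trans)
  also have "\<dots> = B * (l2n lborel ?G)\<^sup>2" by (simp add: power2_eq_square)
  also have "\<dots> \<le> B * (l2n lborel \<rho> * l2n lborel (\<lambda>z. indicator Q (fst z) * v z))\<^sup>2"
    by (intro mult_left_mono power_mono le B_nonneg) simp
  finally have "Re (l2ip lborel (A ?G) ?G) \<le> B * ((l2n lborel \<rho>)\<^sup>2 * (l2n lborel (\<lambda>z. indicator Q (fst z) * v z))\<^sup>2)"
    by (simp add: power_mult_distrib)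
  then show "Re T \<le> B * ((l2n lborel \<rho>)\<^sup>2 * (l2n lborel (\<lambda>z. indicator Q (fst z) * v z))\<^sup>2)"
    using T B_nonneg by auto
qed

section \<open>The anisotropic surface\<close>

text \<open>\<open>anis_l\<close> is a \<open>LEAST\<close>, about which nothing is known before a
  witness exists; the Archimedean property applied to the smallest \<open>\<alpha> k\<close>
  provides one.\<close>

lemma anis_exponent_pos:
  fixes \<alpha> :: "'d::finite \<Rightarrow> real"
  assumes "\<And>k. \<alpha> k > 0"
  shows "0 < real (anis_l \<alpha>) * \<alpha> k"
proof -
  define a where "a = Min (range \<alpha>)"
  have a: "0 < a" "\<And>k. a \<le> \<alpha> k" using assms by (auto simp: a_def)
  obtain l :: nat where l: "real CARD('d) / a < real l" using reals_Archimedean2 by blast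
  have "real CARD('d) / a > 0" using a by simp
  then have "l > 0" using l by (metis of_nat_0_less_iff order_less_trans)
  moreover have "real l * \<alpha> k > real CARD('d)" for k
  proof -
    have "real CARD('d) < real l * a" using l a by (simp add: divide_less_eq)
    also have "\<dots> \<le> real l * \<alpha> k" using a by (intro mult_left_mono) auto
    finally show ?thesis .
  qed
  ultimately have "\<exists>l. l > 0 \<and> (\<forall>k. real l * \<alpha> k > real CARD('d))" by blast
  from LeastI_ex[OF this] have "anis_l \<alpha> > 0" by (simp add: anis_l_def)
  then show ?thesis using assms by simp
qed

lemma anis_gauge_continuous:
  assumes "\<And>k. \<alpha> k > 0"
  shows "continuous_on UNIV (anis_gauge \<alpha>)"
  unfolding anis_gauge_def
  using anis_exponent_pos[of \<alpha>, OF assms] by (intro continuous_intros continuous_on_powr') auto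

text \<open>A coordinate above 1 in modulus alone pushes the gauge above 1, as all exponents are
  positive. Compactness is the reason why a cut-off in \<open>x\<close> alone makes a product test
  function vanish at infinity (\<open>test_C0\<close>).\<close>

lemma anis_P_compact:
  assumes "\<And>k. \<alpha> k > 0"
  shows "compact (anis_P \<alpha>)"
  unfolding compact_eq_bounded_closed
proof
  show "closed (anis_P \<alpha>)"
    unfolding anis_P_def by (rule closed_Collect_eq[OF anis_gauge_continuous[OF assms] continuous_on_const])
  have "norm \<xi> \<le> real CARD('a)" if "\<xi> \<in> anis_P \<alpha>" for \<xi> :: "real ^ 'a"
  proof -
    have "\<bar>\<xi> $ k\<bar> \<le> 1" for k
    proof (rule ccontr)
      assume "\<not> \<bar>\<xi> $ k\<bar> \<le> 1"
      then have "1 < \<bar>\<xi> $ k\<bar> powr (real (anis_l \<alpha>) * \<alpha> k)"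
        using anis_exponent_pos[of \<alpha>, OF assms] by (intro gr_one_powr) auto
      also have "\<dots> \<le> anis_gauge \<alpha> \<xi>"
        unfolding anis_gauge_def by (rule member_le_sum) auto
      finally show False using that by (simp add: anis_P_def)
    qed
    then have "(\<Sum>k\<in>UNIV. \<bar>\<xi> $ k\<bar>) \<le> (\<Sum>k\<in>(UNIV::'a set). 1)" by (intro sum_mono)
    then show ?thesis using norm_le_l1_cart[of \<xi>] by simp
  qed
  then show "bounded (anis_P \<alpha>)" by (auto simp: bounded_iff)
qed

text \<open>Borel measurability is what a symbol has to provide, and it holds across the origin,
  where the projection has its default value.\<close>

lemma anis_proj_measurable:
  assumes "\<And>k. \<alpha> k > 0"
  shows "anis_proj \<alpha> \<in> borel_measurable borel"
proof (subst borel_measurable_euclidean_space, intro ballI)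
  have [measurable]: "anis_gauge \<alpha> \<in> borel_measurable borel"
    using anis_gauge_continuous[OF assms] by (rule borel_measurable_continuous_onI)
  have [measurable]: "(\<lambda>\<xi>::real ^ 'a. \<xi> $ k) \<in> borel_measurable borel" for k
    by (intro borel_measurable_continuous_onI continuous_intros)
  fix b :: "real ^ 'a" assume "b \<in> Basis"
  then obtain k where b: "b = axis k 1" by (auto simp: Basis_vec_def)
  have "(\<lambda>\<xi>. anis_proj \<alpha> \<xi> \<bullet> b) = (\<lambda>\<xi>. \<xi> $ k * anis_gauge \<alpha> \<xi> powr (- 1 / (real (anis_l \<alpha>) * \<alpha> k)))"
    by (simp add: b inner_axis anis_proj_def)
  also have "\<dots> \<in> borel_measurable borel" by measurable
  finally show "(\<lambda>\<xi>. anis_proj \<alpha> \<xi> \<bullet> b) \<in> borel_measurable borel" .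
qed

text \<open>Weak-star measurability speaks of integrals of continuous functions, from which cells
  are reached by pointwise limits. Unions of cells are stable under intersection, so a Dynkin
  argument extends measurability from cells to all measurable sets.\<close>

lemma (in coding) kernel_measurable:
  fixes \<kappa> :: "'w \<Rightarrow> 'a set \<Rightarrow> complex"
  assumes cm: "\<And>w. \<kappa> w \<in> complex_measures M"
    and cells: "\<And>N a. (\<lambda>w. \<kappa> w {y \<in> space M. c N y = a}) \<in> borel_measurable W" and A: "A \<in> sets M"
  shows "(\<lambda>w. \<kappa> w A) \<in> borel_measurable W"
proof -
  let ?G = "{{y \<in> space M. c N y \<in> R} |N R. True}"
  have "Int_stable ?G"
  proof (rule Int_stableI, safe)
    fix N R N' R'
    let ?S = "{y \<in> space M. c N y \<in> R} \<inter> {y \<in> space M. c N' y \<in> R'}"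
    \<comment> \<open>Unions of cells of the levels \<open>N\<close> and \<open>N'\<close> are both
      unions of cells of level \<open>max N N'\<close>, hence so is their intersection.\<close>
    have "?S = {y \<in> space M. c (max N N') y \<in> c (max N N') ` ?S}"
    proof (intro equalityI subsetI)
      fix y assume y: "y \<in> {y \<in> space M. c (max N N') y \<in> c (max N N') ` ?S}"
      then obtain z where z: "y \<in> space M" "z \<in> ?S" "c (max N N') y = c (max N N') z" by blast
      then have "c N y = c N z" "c N' y = c N' z"
        using refine[of N "max N N'" y z] refine[of N' "max N N'" y z] by auto
      then show "y \<in> ?S" using z by auto
    qed auto
    then show "\<exists>K S. ?S = {y \<in> space M. c K y \<in> S} \<and> True" by blast
  qed
  moreover have "?G \<subseteq> Pow (space M)" by auto
  ultimately show ?thesis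
    using A[unfolded generated]
  proof (induction rule: sigma_sets_induct_disjoint)
    case (basic A)
    then obtain N R where A: "A = {y \<in> space M. c N y \<in> R}" by blast
    have "\<kappa> w A = (\<Sum>a\<in>R \<inter> c N ` space M. \<kappa> w {y \<in> space M. c N y = a})" for w
      unfolding complex_eq_iff Re_sum Im_sum A
      using signed_cell_decomposition[OF signed_measure_Re_Im(1)[OF cm]] signed_cell_decomposition[OF signed_measure_Re_Im(2)[OF cm]]
      by simp
    then show ?case using cells by simp
  next
    case empty
    then show ?case using complex_measure_empty[OF cm] by simp
  next
    case (compl A)
    then have A: "A \<in> sets M" by (simp only: generated)
    have "\<kappa> w (space M - A) = \<kappa> w (space M) - \<kappa> w A" for w
    proof -
      have "\<kappa> w (A \<union> (space M - A)) = \<kappa> w A + \<kappa> w (space M - A)"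
        by (rule complex_measure_Un[OF cm]) (use A in auto)
      moreover have "A \<union> (space M - A) = space M" using sets.sets_into_space[OF A] by auto
      ultimately show ?thesis by simp
    qed
    moreover have "(\<lambda>w. \<kappa> w (space M)) \<in> borel_measurable W"
    proof -
      have "\<kappa> w (space M) = (\<Sum>a\<in>c 0 ` space M. \<kappa> w {y \<in> space M. c 0 y = a})" for w
        unfolding complex_eq_iff Re_sum Im_sum
        using signed_cell_decomposition[OF signed_measure_Re_Im(1)[OF cm], of w 0 UNIV]
          signed_cell_decomposition[OF signed_measure_Re_Im(2)[OF cm], of w 0 UNIV]
        by simp
      then show ?thesis using cells by simp
    qed
    ultimately show ?case using compl.IH by simp
  next
    case (union A)
    then have A: "A i \<in> sets M" for i by (auto simp only: generated)
    show ?case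
    proof (rule borel_measurable_LIMSEQ_metric)
      show "(\<lambda>w. \<Sum>i<n. \<kappa> w (A i)) \<in> borel_measurable W" for n
        using union by (intro borel_measurable_sum) auto
      show "(\<lambda>n. \<Sum>i<n. \<kappa> w (A i)) \<longlonglongrightarrow> \<kappa> w (\<Union>i. A i)" for w
        using complex_measure_sums[OF cm A union.hyps(1)] by (simp add: sums_def)
    qed
  qed
qed

section \<open>The limiting kernel\<close>

locale h_measure_limit =
  fixes \<alpha> :: "'d::finite \<Rightarrow> real"
    and u :: "nat \<Rightarrow> (real^'m::finite) \<times> (real^'d) \<Rightarrow> complex"
    and r :: "nat \<Rightarrow> nat"
    and \<mu> :: "(real^'m) \<times> (real^'m) \<Rightarrow> ((real^'d) \<times> (real^'d)) set \<Rightarrow> complex"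
  assumes alpha_pos: "\<And>k. \<alpha> k > 0"
    and weak: "weakly_null_L2 lborel u"
    and mu: "\<mu> \<in> L2_wstar lborel (UNIV \<times> anis_P \<alpha>)"
    and lim: "\<And>v \<phi>\<^sub>1 \<phi>\<^sub>2 \<psi>.
      \<lbrakk>v \<in> L2c lborel; \<phi>\<^sub>1 \<in> C0 UNIV; \<phi>\<^sub>2 \<in> C0 UNIV; continuous_on (anis_P \<alpha>) \<psi>\<rbrakk> \<Longrightarrow>
      (\<lambda>n. LINT (p, q)|lborel. LINT x|lborel.
             v (p, q) * fourier_multiplier (\<psi> \<circ> anis_proj \<alpha>) (\<lambda>y. \<phi>\<^sub>1 y * u (r n) (p, y)) x
               * cnj (\<phi>\<^sub>2 x * u (r n) (q, x)))
      \<longlonglongrightarrow> (LINT (p, q)|lborel. v (p, q) *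
             cm_integral (borel_on (UNIV \<times> anis_P \<alpha>)) (\<mu> (p, q))
               (\<lambda>(x, \<xi>). \<phi>\<^sub>1 x * cnj (\<phi>\<^sub>2 x) * \<psi> \<xi>))"
begin

definition X :: "((real^'d) \<times> (real^'d)) set" where
  "X = UNIV \<times> anis_P \<alpha>"

abbreviation M :: "((real^'d) \<times> (real^'d)) measure" where
  "M \<equiv> borel_on X"

definition code :: "nat \<Rightarrow> (real^'d) \<times> (real^'d) \<Rightarrow> nat set \<times> nat set" where
  "code N z = (bits N (fst z), bits N (snd z))"

text \<open>Kept in the literal shape of the integrand in \<open>lim\<close>, conjugation of a real
  number included; \<open>test_eq\<close> is the simplified form for estimates.\<close>

definition test :: "(real^'d \<Rightarrow> real) \<Rightarrow> (real^'d \<Rightarrow> real) \<Rightarrow> (real^'d) \<times> (real^'d) \<Rightarrow> complex" where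
  "test \<phi> \<psi> = (\<lambda>(x, \<xi>). of_real (\<phi> x) * cnj (of_real (\<phi> x)) * of_real (\<psi> \<xi>))"

lemma space_M: "space M = X"
  by (simp add: space_restrict_space)

lemma cm: "\<mu> w \<in> complex_measures M"
  using mu by (cases w) (simp add: L2_wstar_def X_def)

sublocale cx: coding M code
proof -
  have "coding (restrict_space (borel \<Otimes>\<^sub>M borel) X) code"
    using coding_restrict[OF coding_prod[OF coding_bits coding_bits]] unfolding code_def[abs_def] .
  then show "coding M code" by (simp only: borel_prod)
qed

lemma test_eq: "test \<phi> \<psi> z = of_real ((\<phi> (fst z))\<^sup>2 * \<psi> (snd z))"
  by (simp add: test_def case_prod_beta' power2_eq_square)

lemma test_norm:
  assumes "\<And>x. 0 \<le> \<phi> x" "\<And>x. \<phi> x \<le> 1" "\<And>x. 0 \<le> \<psi> x" "\<And>x. \<psi> x \<le> 1"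
  shows "cmod (test \<phi> \<psi> z) \<le> 1"
proof -
  have "(\<phi> (fst z))\<^sup>2 * \<psi> (snd z) \<le> 1" by (intro mult_le_one power_le_one assms)
  then show ?thesis unfolding test_eq norm_of_real using assms(3) by simp
qed

lemma test_continuous:
  assumes "continuous_on UNIV \<phi>" "continuous_on UNIV \<psi>"
  shows "continuous_on UNIV (test \<phi> \<psi>)"
  unfolding test_eq[abs_def]
  by (intro continuous_intros continuous_on_compose2[OF assms(1)] continuous_on_compose2[OF assms(2)]) auto

lemma test_measurable:
  assumes "continuous_on UNIV \<phi>" "continuous_on UNIV \<psi>"
  shows "test \<phi> \<psi> \<in> borel_measurable M"
  by (rule measurable_restrict_space1[OF borel_measurable_continuous_onI[OF test_continuous[OF assms]]])

lemma test_C0: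
  assumes \<phi>: "continuous_on UNIV \<phi>" "\<And>x. norm x > R \<Longrightarrow> \<phi> x = 0" and \<psi>: "continuous_on UNIV \<psi>"
  shows "test \<phi> \<psi> \<in> C0 X"
proof -
  have K: "compact (cball (0::real^'d) R \<times> anis_P \<alpha>)" "cball 0 R \<times> anis_P \<alpha> \<subseteq> X"
    using compact_Times[OF compact_cball[of 0 R] anis_P_compact[of \<alpha>, OF alpha_pos]] by (auto simp: X_def)
  have "norm (test \<phi> \<psi> z) < e" if "e > 0" "z \<in> X - cball 0 R \<times> anis_P \<alpha>" for z e
    using that \<phi>(2)[of "fst z"] by (cases "norm (fst z) > R") (auto simp: X_def test_eq)
  then show ?thesis
    using K continuous_on_subset[OF test_continuous[OF \<phi>(1) \<psi>]] unfolding C0_def by blast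
qed

lemma test_integral_measurable:
  assumes "continuous_on UNIV \<phi>" "\<And>x. norm x > R \<Longrightarrow> \<phi> x = 0" "continuous_on UNIV \<psi>"
  shows "(\<lambda>w. cm_integral M (\<mu> w) (test \<phi> \<psi>)) \<in> borel_measurable lborel"
  using mu test_C0[OF assms] by (simp add: L2_wstar_def X_def)

lemma test_integral_bound:
  assumes "continuous_on UNIV \<phi>" "continuous_on UNIV \<psi>" "\<And>x. 0 \<le> \<phi> x" "\<And>x. \<phi> x \<le> 1" "\<And>x. 0 \<le> \<psi> x" "\<And>x. \<psi> x \<le> 1"
  shows "cmod (cm_integral M (\<mu> w) (test \<phi> \<psi>)) \<le> 4 * enn2real (total_variation M (\<mu> w))"
  using cm_integral_bound[OF cm test_measurable[OF assms(1,2)], of 1 w] test_norm[OF assms(3-6)] by simp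

lemma test_integral_tendsto:
  assumes f: "\<And>n. continuous_on UNIV (f n)" "\<And>n x. 0 \<le> f n x" "\<And>n x. f n x \<le> 1"
      "\<And>x. (\<lambda>n. f n x) \<longlonglongrightarrow> indicator {x. bits N x = I} x"
    and g: "\<And>n. continuous_on UNIV (g n)" "\<And>n x. 0 \<le> g n x" "\<And>n x. g n x \<le> 1"
      "\<And>x. (\<lambda>n. g n x) \<longlonglongrightarrow> indicator {x. bits N' x = K} x"
    and A: "A = {z \<in> space M. bits N (fst z) = I \<and> bits N' (snd z) = K}" and Am: "A \<in> sets M"
  shows "(\<lambda>n. cm_integral M (\<mu> w) (test (f n) (g n))) \<longlonglongrightarrow> \<mu> w A"
proof -
  have "(\<lambda>n. cm_integral M (\<mu> w) (test (f n) (g n))) \<longlonglongrightarrow> cm_integral M (\<mu> w) (indicator A)"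
  proof (rule cm_integral_tendsto[OF cm test_measurable[OF f(1) g(1)], where B=1])
    show "indicator A \<in> borel_measurable M" using Am by simp
    show "cmod (test (f n) (g n) z) \<le> 1" for n z
      by (rule test_norm[OF f(2,3) g(2,3)])
    fix z assume z: "z \<in> space M"
    have "(\<lambda>n. test (f n) (g n) z) \<longlonglongrightarrow>
        of_real ((indicator {x. bits N x = I} (fst z))\<^sup>2 * indicator {x. bits N' x = K} (snd z))"
      unfolding test_eq by (intro tendsto_intros f(4) g(4))
    also have "complex_of_real ((indicator {x. bits N x = I} (fst z))\<^sup>2 * indicator {x. bits N' x = K} (snd z)) = indicator A z"
      using z by (auto simp: A indicator_def)
    finally show "(\<lambda>n. test (f n) (g n) z) \<longlonglongrightarrow> indicator A z" .
  qed
  then show ?thesis by (simp add: cm_integral_indicator[OF cm Am])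
qed

lemma cell_approx:
  obtains f g where
    "\<And>n. continuous_on UNIV (f n)" "\<And>n x. 0 \<le> f n x" "\<And>n x. f n x \<le> 1" "\<And>n x. norm x > real n \<Longrightarrow> f n x = 0"
    "\<And>n. continuous_on UNIV (g n)" "\<And>n x. 0 \<le> g n x" "\<And>n x. g n x \<le> 1"
    "\<And>w. (\<lambda>n. cm_integral M (\<mu> w) (test (f n) (g n))) \<longlonglongrightarrow> \<mu> w {z \<in> space M. code N z = a}"
proof -
  obtain f :: "nat \<Rightarrow> real^'d \<Rightarrow> real" where f: "\<And>n. continuous_on UNIV (f n)" "\<And>n x. 0 \<le> f n x" "\<And>n x. f n x \<le> 1"
      "\<And>n x. norm x > real n \<Longrightarrow> f n x = 0" "\<And>x. (\<lambda>n. f n x) \<longlonglongrightarrow> indicator {x. bits N x = fst a} x"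
    apply (rule bits_cell_approx[where N=N and I="fst a" and 'a="real^'d"])
    subgoal premises p for f by (rule that[OF p(2-)])
    done
  obtain g :: "nat \<Rightarrow> real^'d \<Rightarrow> real" where g: "\<And>n. continuous_on UNIV (g n)" "\<And>n x. 0 \<le> g n x" "\<And>n x. g n x \<le> 1"
      "\<And>n x. norm x > real n \<Longrightarrow> g n x = 0" "\<And>x. (\<lambda>n. g n x) \<longlonglongrightarrow> indicator {x. bits N x = snd a} x"
    apply (rule bits_cell_approx[where N=N and I="snd a" and 'a="real^'d"])
    subgoal premises p for f by (rule that[OF p(2-)])
    done
  have A: "{z \<in> space M. code N z = a} = {z \<in> space M. bits N (fst z) = fst a \<and> bits N (snd z) = snd a}"
    by (auto simp: code_def)
  show ?thesis
    by (rule that[OF f(1-4) g(1-3) test_integral_tendsto[OF f(1,2,3,5) g(1,2,3,5) A cx.cell_sets1]])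
qed

sublocale mk: measure_kernel lborel M \<mu>
proof
  show "\<mu> w \<in> complex_measures M" for w by (rule cm)
  show "(\<integral>\<^sup>+w. (total_variation M (\<mu> w))\<^sup>2 \<partial>lborel) < \<infinity>" using mu by (simp add: L2_wstar_def X_def)
  show "(\<lambda>w. \<mu> w A) \<in> borel_measurable lborel" if A: "A \<in> sets M" for A
  proof (rule cx.kernel_measurable[OF cm _ A])
    fix N a
    obtain f g where fg: "\<And>n. continuous_on UNIV (f n)" "\<And>n x. norm x > real n \<Longrightarrow> f n x = 0"
        "\<And>n. continuous_on UNIV (g n)"
        "\<And>w. (\<lambda>n. cm_integral M (\<mu> w) (test (f n) (g n))) \<longlonglongrightarrow> \<mu> w {z \<in> space M. code N z = a}"
      apply (rule cell_approx[of N a])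
      subgoal premises p for f g by (rule that[OF p(2,5,6,9)])
      done
    show "(\<lambda>w. \<mu> w {z \<in> space M. code N z = a}) \<in> borel_measurable lborel"
      by (rule borel_measurable_LIMSEQ_metric[OF test_integral_measurable[OF fg(1,2,3)] fg(4)])
  qed
qed

section \<open>Positivity and trace bound in the limit\<close>

definition hform :: "(real^'m \<Rightarrow> complex) \<Rightarrow> (real^'d \<Rightarrow> real) \<Rightarrow> (real^'d \<Rightarrow> real) \<Rightarrow> nat \<Rightarrow> complex" where
  "hform \<rho> \<phi> \<psi> n = (LINT (p, q)|lborel. LINT x|lborel. (\<rho> p * cnj (\<rho> q)) *
      fourier_multiplier (\<lambda>\<xi>. of_real (\<psi> (anis_proj \<alpha> \<xi>))) (\<lambda>y. of_real (\<phi> y) * u (r n) (p, y)) x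
      * cnj (of_real (\<phi> x) * u (r n) (q, x)))"

definition hlimit :: "(real^'m \<Rightarrow> complex) \<Rightarrow> (real^'d \<Rightarrow> real) \<Rightarrow> (real^'d \<Rightarrow> real) \<Rightarrow> complex" where
  "hlimit \<rho> \<phi> \<psi> = (LINT w|lborel. \<rho> (fst w) * cnj (\<rho> (snd w)) * cm_integral M (\<mu> w) (test \<phi> \<psi>))"

lemma hform_tendsto:
  assumes \<rho>: "\<rho> \<in> L2 lborel" "\<And>p. norm p > R \<Longrightarrow> \<rho> p = 0"
    and \<phi>: "continuous_on UNIV \<phi>" "\<And>x. norm x > S \<Longrightarrow> \<phi> x = 0" and \<psi>: "continuous_on UNIV \<psi>"
  shows "hform \<rho> \<phi> \<psi> \<longlonglongrightarrow> hlimit \<rho> \<phi> \<psi>"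
proof -
  define v where "v w = \<rho> (fst w) * cnj (\<rho> (snd w))" for w
  have "v \<in> L2c lborel"
    unfolding L2c_def
  proof (intro CollectI conjI exI[of _ "cball 0 R \<times> cball 0 R"])
    show "v \<in> L2 lborel" unfolding v_def[abs_def] by (rule L2_tensor(1)[OF \<rho>(1) L2_cnj[OF \<rho>(1)]])
    show "AE w in lborel. w \<notin> cball 0 R \<times> cball 0 R \<longrightarrow> v w = 0"
      using \<rho>(2) by (auto simp: v_def mem_Times_iff not_le)
  qed (auto intro: compact_Times)
  moreover have "(\<lambda>x. complex_of_real (\<phi> x)) \<in> C0 UNIV"
    unfolding C0_def
  proof (intro CollectI conjI allI impI)
    show "continuous_on UNIV (\<lambda>x. complex_of_real (\<phi> x))" by (intro continuous_intros \<phi>)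
    fix e :: real assume "e > 0"
    then show "\<exists>K. compact K \<and> K \<subseteq> UNIV \<and> (\<forall>x\<in>UNIV - K. norm (complex_of_real (\<phi> x)) < e)"
      using \<phi>(2) by (intro exI[of _ "cball 0 S"]) (auto simp: not_le)
  qed
  moreover have "continuous_on (anis_P \<alpha>) (\<lambda>\<xi>. complex_of_real (\<psi> \<xi>))"
    by (intro continuous_intros continuous_on_subset[OF \<psi>]) auto
  ultimately show ?thesis
    using lim[of v "\<lambda>x. complex_of_real (\<phi> x)" "\<lambda>x. complex_of_real (\<phi> x)" "\<lambda>\<xi>. complex_of_real (\<psi> \<xi>)"]
    by (simp add: hform_def[abs_def] hlimit_def v_def comp_def X_def test_def case_prod_beta')
qed

lemma u_bounded: "\<exists>C\<ge>0. \<forall>n. u n \<in> L2 lborel \<and> l2n lborel (u n) \<le> C"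
proof -
  obtain C where C: "\<And>n. l2n lborel (u n) \<le> C" using weakly_null_bounded[OF weak] by blast
  moreover have "0 \<le> C" using C[of 0] l2n_nonneg order_trans by blast
  ultimately show ?thesis using weak by (auto simp: weakly_null_L2_def)
qed

lemma symbol:
  assumes "continuous_on UNIV \<psi>" "\<And>x. 0 \<le> \<psi> x" "\<And>x. \<psi> x \<le> 1"
  shows "bounded_symbol (\<lambda>\<xi>. \<psi> (anis_proj \<alpha> \<xi>)) 1"
proof
  show "(\<lambda>\<xi>. \<psi> (anis_proj \<alpha> \<xi>)) \<in> borel_measurable borel"
    by (rule measurable_compose[OF anis_proj_measurable[of \<alpha>, OF alpha_pos] borel_measurable_continuous_onI[OF assms(1)]])
qed (use assms in auto)

text \<open>Every member of the sequence is non-negative by \<open>multiplier_form_bounds\<close>,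
  since the same \<phi> stands on both sides and the weight is \<rho> tensor its conjugate. The
  non-negative reals are closed.\<close>

lemma limit_nonneg:
  assumes \<rho>: "\<rho> \<in> L2 lborel" "\<And>p. norm p > R \<Longrightarrow> \<rho> p = 0"
    and \<phi>: "continuous_on UNIV \<phi>" "\<And>x. norm x > S \<Longrightarrow> \<phi> x = 0" "\<And>x. 0 \<le> \<phi> x" "\<And>x. \<phi> x \<le> 1"
    and \<psi>: "continuous_on UNIV \<psi>" "\<And>x. 0 \<le> \<psi> x" "\<And>x. \<psi> x \<le> 1"
  shows "hlimit \<rho> \<phi> \<psi> \<in> \<real>\<^sub>\<ge>\<^sub>0"
proof (rule closed_sequentially[OF closed_nonneg_Reals_complex _ hform_tendsto[OF \<rho> \<phi>(1,2) \<psi>(1)]])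
  interpret bounded_symbol "\<lambda>\<xi>. \<psi> (anis_proj \<alpha> \<xi>)" 1 by (rule symbol[OF \<psi>])
  show "hform \<rho> \<phi> \<psi> n \<in> \<real>\<^sub>\<ge>\<^sub>0" for n
    unfolding hform_def
    by (rule multiplier_form_bounds(1)[where Q=UNIV, OF _ borel_measurable_continuous_onI[OF \<phi>(1)] _ \<rho>(1)])
      (use u_bounded \<phi> in auto)
qed

text \<open>The symbol is constant 1, and \<open>\<rho> i\<close> sees only the part of
  \<open>u (r n)\<close> over \<open>Q i\<close>. The sets \<open>Q i\<close> are disjoint, so the
  squared norms of these parts add up to at most that of \<open>u (r n)\<close>. \<open>d i\<close>
  may exceed the squared norm of \<open>\<rho> i\<close>, because \<open>form_trace\<close>
  truncates the functions but keeps the full norms as denominators.\<close>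

lemma limit_trace:
  assumes "finite I"
    and \<rho>: "\<And>i. i \<in> I \<Longrightarrow> \<rho> i \<in> L2 lborel" "\<And>i p. i \<in> I \<Longrightarrow> norm p > R \<Longrightarrow> \<rho> i p = 0"
    and Q: "\<And>i. i \<in> I \<Longrightarrow> Q i \<in> sets borel" "disjoint_family_on Q I" "\<And>i p. i \<in> I \<Longrightarrow> p \<notin> Q i \<Longrightarrow> \<rho> i p = 0"
    and d: "\<And>i. i \<in> I \<Longrightarrow> (l2n lborel (\<rho> i))\<^sup>2 \<le> d i"
    and \<phi>: "continuous_on UNIV \<phi>" "\<And>x. norm x > S \<Longrightarrow> \<phi> x = 0" "\<And>x. 0 \<le> \<phi> x" "\<And>x. \<phi> x \<le> 1"
    and C: "0 \<le> C" "\<And>n. u n \<in> L2 lborel" "\<And>n. l2n lborel (u n) \<le> C"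
  shows "(\<Sum>i\<in>I. Re (hlimit (\<rho> i) \<phi> (\<lambda>_. 1)) / d i) \<le> C\<^sup>2"
proof (rule LIMSEQ_le_const2)
  show "(\<lambda>n. \<Sum>i\<in>I. Re (hform (\<rho> i) \<phi> (\<lambda>_. 1) n) / d i) \<longlonglongrightarrow> (\<Sum>i\<in>I. Re (hlimit (\<rho> i) \<phi> (\<lambda>_. 1)) / d i)"
    unfolding divide_inverse
    by (intro tendsto_sum tendsto_mult_right tendsto_Re hform_tendsto[where R=R and S=S] \<rho> \<phi>) auto
  interpret bounded_symbol "\<lambda>\<xi>. (\<lambda>_. 1) (anis_proj \<alpha> \<xi>)" 1 by (rule symbol) auto
  have "(\<Sum>i\<in>I. Re (hform (\<rho> i) \<phi> (\<lambda>_. 1) n) / d i) \<le> C\<^sup>2" for n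
  proof -
    define y where "y i = (l2n lborel (\<lambda>z. indicator (Q i) (fst z) * u (r n) z))\<^sup>2" for i
    have y0: "0 \<le> y i" for i by (simp add: y_def)
    have "Re (hform (\<rho> i) \<phi> (\<lambda>_. 1) n) / d i \<le> y i" if i: "i \<in> I" for i
    proof -
      have d0: "0 \<le> d i" using d[OF i] zero_le_power2 order_trans by blast
      have "Re (hform (\<rho> i) \<phi> (\<lambda>_. 1) n) \<le> 1 * ((l2n lborel (\<rho> i))\<^sup>2 * y i)"
        unfolding hform_def y_def
        by (rule multiplier_form_bounds(2)[OF C(2) borel_measurable_continuous_onI[OF \<phi>(1)] _ \<rho>(1)[OF i] Q(1)[OF i] Q(3)[OF i]])
          (use \<phi> in auto)
      also have "\<dots> \<le> d i * y i" using d[OF i] y0[of i] by (simp add: mult_right_mono)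
      finally have le: "Re (hform (\<rho> i) \<phi> (\<lambda>_. 1) n) \<le> d i * y i" .
      show ?thesis
      proof (cases "d i = 0")
        case False
        then show ?thesis using le d0 by (simp add: pos_divide_le_eq mult.commute)
      qed (simp add: y0)
    qed
    then have "(\<Sum>i\<in>I. Re (hform (\<rho> i) \<phi> (\<lambda>_. 1) n) / d i) \<le> (\<Sum>i\<in>I. y i)" by (rule sum_mono)
    also have "\<dots> \<le> (l2n lborel (u (r n)))\<^sup>2"
    proof -
      note um [measurable] = L2_measurable[OF C(2)[of "r n"], simplified]
      have fm [measurable]: "(fst :: (real^'m) \<times> (real^'d) \<Rightarrow> _) \<in> borel_measurable borel"
        by (intro borel_measurable_continuous_onI continuous_intros)
      have iL: "(\<lambda>z. indicator (Q i) (fst z) * u (r n) z) \<in> L2 lborel" if i: "i \<in> I" for i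
      proof (rule L2_bound[where c=1, OF C(2)[of "r n"]])
        have [measurable]: "Q i \<in> sets borel" by (rule Q(1)[OF i])
        show "(\<lambda>z. indicator (Q i) (fst z) * u (r n) z) \<in> borel_measurable lborel" by simp
      qed (auto simp: indicator_def)
      have "(\<Sum>i\<in>I. y i) = (LINT z|lborel. (\<Sum>i\<in>I. (cmod (indicator (Q i) (fst z) * u (r n) z))\<^sup>2))"
        unfolding y_def l2n_sq by (rule Bochner_Integration.integral_sum[symmetric]) (rule L2_integrable[OF iL])
      also have "\<dots> \<le> (LINT z|lborel. (cmod (u (r n) z))\<^sup>2)"
      proof (rule integral_mono)
        show "integrable lborel (\<lambda>z. \<Sum>i\<in>I. (cmod (indicator (Q i) (fst z) * u (r n) z))\<^sup>2)"
          by (intro Bochner_Integration.integrable_sum L2_integrable iL)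
        show "integrable lborel (\<lambda>z. (cmod (u (r n) z))\<^sup>2)" by (rule L2_integrable[OF C(2)])
        fix z :: "(real^'m) \<times> (real^'d)"
        have "(\<Sum>i\<in>I. (cmod (indicator (Q i) (fst z) * u (r n) z))\<^sup>2) = (\<Sum>i\<in>I. indicator (Q i) (fst z) * (cmod (u (r n) z))\<^sup>2)"
          by (intro sum.cong refl) (auto simp: indicator_def)
        also have "\<dots> = indicator (\<Union>i\<in>I. Q i) (fst z) * (cmod (u (r n) z))\<^sup>2"
          unfolding sum_distrib_right[symmetric] using Q(2) \<open>finite I\<close> by (subst indicator_UN_disjoint) auto
        also have "\<dots> \<le> (cmod (u (r n) z))\<^sup>2" by (auto simp: indicator_def)
        finally show "(\<Sum>i\<in>I. (cmod (indicator (Q i) (fst z) * u (r n) z))\<^sup>2) \<le> (cmod (u (r n) z))\<^sup>2" .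
      qed
      finally show ?thesis by (simp add: l2n_sq)
    qed
    also have "\<dots> \<le> C\<^sup>2" by (intro power_mono C) simp
    finally show ?thesis .
  qed
  then show "\<exists>N. \<forall>n\<ge>N. (\<Sum>i\<in>I. Re (hform (\<rho> i) \<phi> (\<lambda>_. 1) n) / d i) \<le> C\<^sup>2" by blast
qed

text \<open>The convergence hypothesis speaks of compactly supported \<open>v\<close>, whereas the
  forms are wanted for all square integrable \<rho>.\<close>

definition cut :: "(real^'m \<Rightarrow> complex) \<Rightarrow> nat \<Rightarrow> real^'m \<Rightarrow> complex" where
  "cut \<rho> j p = \<rho> p * indicator (cball 0 (real j)) p"

lemma cut_L2:
  assumes "\<rho> \<in> L2 lborel"
  shows "cut \<rho> j \<in> L2 lborel" "(l2n lborel (cut \<rho> j))\<^sup>2 \<le> (l2n lborel \<rho>)\<^sup>2" "norm p > real j \<Longrightarrow> cut \<rho> j p = 0"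
proof -
  show L: "cut \<rho> j \<in> L2 lborel"
    using L2_ball_truncate(2)[OF assms, of j] by (simp add: cut_def[abs_def] ball_truncate_def[abs_def])
  have "l2n lborel (cut \<rho> j) \<le> l2n lborel \<rho>"
    by (rule l2n_mono[OF assms L2_measurable[OF L]]) (auto simp: cut_def indicator_def)
  then show "(l2n lborel (cut \<rho> j))\<^sup>2 \<le> (l2n lborel \<rho>)\<^sup>2" by (rule power_mono) simp
  show "norm p > real j \<Longrightarrow> cut \<rho> j p = 0" by (simp add: cut_def)
qed

text \<open>One index governs both the truncation of \<rho> and the approximation of the set. The
  truncation is shifted to the factor \<open>b n\<close> beside the kernel, so that the L2 factor
  stays fixed and the total variation dominates; the constant 4 is that of
  \<open>test_integral_bound\<close>.\<close>

lemma limit_cut_tendsto: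
  assumes \<rho>: "\<rho> \<in> L2 lborel"
    and f: "\<And>n. continuous_on UNIV (f n)" "\<And>n x. norm x > real n \<Longrightarrow> f n x = 0" "\<And>n x. 0 \<le> f n x" "\<And>n x. f n x \<le> 1"
    and g: "\<And>n. continuous_on UNIV (g n)" "\<And>n x. 0 \<le> g n x" "\<And>n x. g n x \<le> 1"
    and l: "\<And>w. (\<lambda>n. cm_integral M (\<mu> w) (test (f n) (g n))) \<longlonglongrightarrow> \<mu> w A"
  shows "(\<lambda>n. hlimit (cut \<rho> n) (f n) (g n)) \<longlonglongrightarrow> mk.form (\<lambda>w. \<rho> (fst w) * cnj (\<rho> (snd w))) A"
proof -
  define b where "b n w = (indicator (cball 0 (real n)) (fst w) * indicator (cball 0 (real n)) (snd w) :: complex)"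
    for n :: nat and w :: "(real^'m) \<times> (real^'m)"
  have b1: "cmod (b n w) \<le> 1" for n w by (auto simp: b_def indicator_def)
  have [measurable]: "b n \<in> borel_measurable borel" for n
  proof -
    have [measurable]: "cball (0::real^'m) (real n) \<in> sets borel" by simp
    have "b n \<in> borel_measurable (borel \<Otimes>\<^sub>M borel)" unfolding b_def by measurable
    then show ?thesis by (simp add: borel_prod)
  qed
  have "(\<lambda>n. LINT w|lborel. \<rho> (fst w) * cnj (\<rho> (snd w)) * (b n w * cm_integral M (\<mu> w) (test (f n) (g n)))) \<longlonglongrightarrow>
      (LINT w|lborel. \<rho> (fst w) * cnj (\<rho> (snd w)) * \<mu> w A)"
  proof (rule dominated_by_lower_integral(3)[where c=4, OF _ _ _ mk.tvr_finite])
    show "(\<lambda>w. b n w * cm_integral M (\<mu> w) (test (f n) (g n))) \<in> borel_measurable lborel" for n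
      using test_integral_measurable[OF f(1,2) g(1), of n n] by measurable
    show "cmod (b n w * cm_integral M (\<mu> w) (test (f n) (g n))) \<le> 4 * mk.tvr w" for n w
    proof -
      have "cmod (b n w * cm_integral M (\<mu> w) (test (f n) (g n))) \<le> cmod (cm_integral M (\<mu> w) (test (f n) (g n)))"
        unfolding norm_mult by (rule mult_left_le_one_le) (use b1 in auto)
      also have "\<dots> \<le> 4 * mk.tvr w"
        unfolding mk.tvr_def by (intro test_integral_bound f g)
      finally show ?thesis .
    qed
    show "(\<lambda>n. b n w * cm_integral M (\<mu> w) (test (f n) (g n))) \<longlonglongrightarrow> \<mu> w A" for w
    proof -
      obtain k where k: "max (norm (fst w)) (norm (snd w)) \<le> real k" using real_arch_simple by blast
      have "(\<lambda>n. b n w) \<longlonglongrightarrow> 1"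
        by (intro tendsto_eventually eventually_sequentiallyI[of k]) (use k in \<open>auto simp: b_def indicator_def\<close>)
      from tendsto_mult[OF this l[of w]] show ?thesis by simp
    qed
    show "(\<lambda>w. \<rho> (fst w) * cnj (\<rho> (snd w))) \<in> L2 lborel" by (rule L2_tensor(1)[OF \<rho> L2_cnj[OF \<rho>]])
  qed simp
  moreover have "(LINT w|lborel. \<rho> (fst w) * cnj (\<rho> (snd w)) * (b n w * cm_integral M (\<mu> w) (test (f n) (g n)))) = hlimit (cut \<rho> n) (f n) (g n)" for n
    unfolding hlimit_def by (intro Bochner_Integration.integral_cong refl) (auto simp: b_def cut_def indicator_def)
  ultimately show ?thesis by (simp add: mk.form_def)
qed

text \<open>Cells are limits of the test functions of \<open>limit_nonneg\<close>. On general sets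
  the real part is non-negative and the imaginary part zero, because both are signed measures
  determined in this respect by cells.\<close>

lemma form_nonneg:
  assumes \<rho>: "\<rho> \<in> L2 lborel" and A: "A \<in> sets M"
  shows "mk.form (\<lambda>w. \<rho> (fst w) * cnj (\<rho> (snd w))) A \<in> \<real>\<^sub>\<ge>\<^sub>0"
proof -
  define a where "a w = \<rho> (fst w) * cnj (\<rho> (snd w))" for w
  have aL: "a \<in> L2 lborel" unfolding a_def[abs_def] by (rule L2_tensor(1)[OF \<rho> L2_cnj[OF \<rho>]])
  have cell: "mk.form a {z \<in> space M. code N z = b} \<in> \<real>\<^sub>\<ge>\<^sub>0" for N b
  proof -
    obtain f g where f: "\<And>n. continuous_on UNIV (f n)" "\<And>n x. 0 \<le> f n x" "\<And>n x. f n x \<le> 1" "\<And>n x. norm x > real n \<Longrightarrow> f n x = 0"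
      and g: "\<And>n. continuous_on UNIV (g n)" "\<And>n x. 0 \<le> g n x" "\<And>n x. g n x \<le> 1"
      and l: "\<And>w. (\<lambda>n. cm_integral M (\<mu> w) (test (f n) (g n))) \<longlonglongrightarrow> \<mu> w {z \<in> space M. code N z = b}"
      apply (rule cell_approx[of N b])
      subgoal premises p for f g by (rule that[OF p(2-)])
      done
    show ?thesis unfolding a_def[abs_def]
      by (rule closed_sequentially[OF closed_nonneg_Reals_complex _ limit_cut_tendsto[OF \<rho> f(1,4,2,3) g l]])
        (rule limit_nonneg[OF cut_L2(1,3)[OF \<rho>] f(1,4,2,3) g])
  qed
  have "0 \<le> Re (mk.form a A)"
    by (rule cx.signed_measure_nonneg[OF mk.form_signed(1)[OF aL] _ A])
      (use cell in \<open>simp add: complex_nonneg_Reals_iff\<close>)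
  moreover have "Im (mk.form a A) = 0"
    by (rule cx.signed_measure_zero[OF mk.form_signed(2)[OF aL] _ A])
      (use cell in \<open>simp add: complex_nonneg_Reals_iff\<close>)
  ultimately show ?thesis unfolding a_def[abs_def] by (simp add: complex_nonneg_Reals_iff)
qed

text \<open>The weight is restricted to the cells of one level, which are disjoint;
  \<open>limit_trace\<close> bounds the truncated sums, and the bound survives the limit. Symbol 1
  and cut-offs tending to 1 lead to the whole space as the set in the form.\<close>

lemma form_trace:
  assumes \<omega>: "(\<lambda>p. complex_of_real (\<omega> p)) \<in> L2 lborel"
    and C: "0 \<le> C" "\<And>n. u n \<in> L2 lborel" "\<And>n. l2n lborel (u n) \<le> C"
  shows "(\<Sum>I\<in>Pow {..<N}. Re (mk.form (\<lambda>w. of_real (\<omega> (fst w) * indicator (bit_cell N I) (fst w)) *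
        of_real (\<omega> (snd w) * indicator (bit_cell N I) (snd w))) (space M)) /
        (l2n lborel (\<lambda>p. complex_of_real (\<omega> p * indicator (bit_cell N I) p)))\<^sup>2) \<le> C\<^sup>2"
proof -
  define \<rho> where "\<rho> I p = complex_of_real (\<omega> p * indicator (bit_cell N I) p)" for I :: "nat set" and p
  have \<rho>L: "\<rho> I \<in> L2 lborel" for I
  proof (rule L2_bound[where c=1, OF \<omega>])
    have "(\<lambda>p. complex_of_real (\<omega> p) * indicator (bit_cell N I) p) \<in> borel_measurable lborel"
      using L2_measurable[OF \<omega>] bit_cell_sets[of N I] by (intro borel_measurable_times borel_measurable_indicator) auto
    moreover have "(\<lambda>p. complex_of_real (\<omega> p) * indicator (bit_cell N I) p) = \<rho> I"
      by (auto simp: \<rho>_def indicator_def fun_eq_iff)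
    ultimately show "\<rho> I \<in> borel_measurable lborel" by simp
  qed (auto simp: \<rho>_def indicator_def)
  obtain f :: "nat \<Rightarrow> real^'d \<Rightarrow> real" where f: "\<And>n. continuous_on UNIV (f n)" "\<And>n x. 0 \<le> f n x" "\<And>n x. f n x \<le> 1"
      "\<And>n x. norm x > real n \<Longrightarrow> f n x = 0"
    and fl: "\<And>x. (\<lambda>n. f n x) \<longlonglongrightarrow> indicator {x. bits 0 x = {}} x"
    apply (rule bits_cell_approx[where N=0 and I="{}" and 'a="real^'d"])
    subgoal premises p for f by (rule that[OF p(2-)])
    done
  \<comment> \<open>At level 0 no generator is consulted, so the label \<open>{}\<close> belongs to
    every point, and the functions \<open>f n\<close> are compactly supported with limit 1.\<close>
  have sp: "space M = {z \<in> space M. bits 0 (fst z) = {} \<and> bits 0 (snd z) = {}}" by (simp add: bits_def)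
  have l: "(\<lambda>n. cm_integral M (\<mu> w) (test (f n) (\<lambda>_. 1))) \<longlonglongrightarrow> \<mu> w (space M)" for w
    by (rule test_integral_tendsto[OF f(1,2,3) fl _ _ _ _ sp]) (auto simp: bits_def)
  have "(\<lambda>n. \<Sum>I\<in>Pow {..<N}. Re (hlimit (cut (\<rho> I) n) (f n) (\<lambda>_. 1)) / (l2n lborel (\<rho> I))\<^sup>2) \<longlonglongrightarrow>
      (\<Sum>I\<in>Pow {..<N}. Re (mk.form (\<lambda>w. \<rho> I (fst w) * cnj (\<rho> I (snd w))) (space M)) / (l2n lborel (\<rho> I))\<^sup>2)"
    unfolding divide_inverse
    by (intro tendsto_sum tendsto_mult_right tendsto_Re limit_cut_tendsto \<rho>L f l) auto
  then have "(\<Sum>I\<in>Pow {..<N}. Re (mk.form (\<lambda>w. \<rho> I (fst w) * cnj (\<rho> I (snd w))) (space M)) / (l2n lborel (\<rho> I))\<^sup>2) \<le> C\<^sup>2"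
  proof (rule LIMSEQ_le_const2, intro exI allI impI)
    fix n :: nat
    show "(\<Sum>I\<in>Pow {..<N}. Re (hlimit (cut (\<rho> I) n) (f n) (\<lambda>_. 1)) / (l2n lborel (\<rho> I))\<^sup>2) \<le> C\<^sup>2"
    proof (rule limit_trace[where R="real n" and S="real n" and Q="bit_cell N"])
      show "disjoint_family_on (bit_cell N) (Pow {..<N})" by (auto simp: disjoint_family_on_def bit_cell_def)
      show "cut (\<rho> I) n p = 0" if "p \<notin> bit_cell N I" for I p using that by (simp add: cut_def \<rho>_def)
    qed (use cut_L2[OF \<rho>L] f C in auto)
  qed
  then show ?thesis by (simp add: \<rho>_def[abs_def])
qed

end

theorem proposition12:
  fixes \<alpha> :: "'d::finite \<Rightarrow> real"
    and u :: "nat \<Rightarrow> (real^'m::finite) \<times> (real^'d) \<Rightarrow> complex"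
    and r :: "nat \<Rightarrow> nat"
    and \<mu> :: "(real^'m) \<times> (real^'m) \<Rightarrow> ((real^'d) \<times> (real^'d)) set \<Rightarrow> complex"
  assumes alpha_pos: "\<And>k. \<alpha> k > 0"
    and weak: "weakly_null_L2 lborel u"
    and subseq: "strict_mono r"
    and mu: "\<mu> \<in> L2_wstar lborel (UNIV \<times> anis_P \<alpha>)"
    and lim: "\<And>v \<phi>\<^sub>1 \<phi>\<^sub>2 \<psi>.
      \<lbrakk>v \<in> L2c lborel; \<phi>\<^sub>1 \<in> C0 UNIV; \<phi>\<^sub>2 \<in> C0 UNIV; continuous_on (anis_P \<alpha>) \<psi>\<rbrakk> \<Longrightarrow>
      (\<lambda>n. LINT (p, q)|lborel. LINT x|lborel.
             v (p, q) * fourier_multiplier (\<psi> \<circ> anis_proj \<alpha>) (\<lambda>y. \<phi>\<^sub>1 y * u (r n) (p, y)) x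
               * cnj (\<phi>\<^sub>2 x * u (r n) (q, x)))
      \<longlonglongrightarrow> (LINT (p, q)|lborel. v (p, q) *
             cm_integral (borel_on (UNIV \<times> anis_P \<alpha>)) (\<mu> (p, q))
               (\<lambda>(x, \<xi>). \<phi>\<^sub>1 x * cnj (\<phi>\<^sub>2 x) * \<psi> \<xi>))"
  shows "\<exists>(\<nu> :: ((real^'d) \<times> (real^'d)) measure)
          (f :: (real^'m) \<times> (real^'m) \<Rightarrow> (real^'d) \<times> (real^'d) \<Rightarrow> complex).
      sets \<nu> = sets (borel_on (UNIV \<times> anis_P \<alpha>)) \<and> finite_measure \<nu> \<and>
      f \<in> L2_L1 lborel \<nu> \<and>
      (AE (p, q) in lborel. \<forall>A\<in>sets \<nu>. \<mu> (p, q) A = (LINT z:A|\<nu>. f (p, q) z)) \<and>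
      (\<forall>\<rho>\<in>L2c lborel. \<forall>\<phi> :: (real^'d) \<times> (real^'d) \<Rightarrow> real.
         \<phi> \<in> C0 (UNIV \<times> anis_P \<alpha>) \<longrightarrow> (\<forall>z\<in>UNIV \<times> anis_P \<alpha>. \<phi> z \<ge> 0) \<longrightarrow>
         (LINT (p, q)|lborel. LINT z|\<nu>.
            \<rho> p * cnj (\<rho> q) * of_real (\<phi> z) * f (p, q) z) \<in> \<real>\<^sub>\<ge>\<^sub>0)"
proof -
  interpret h_measure_limit \<alpha> u r \<mu>
    by (unfold_locales) (fact alpha_pos weak mu lim)+
  obtain C where C: "0 \<le> C" "\<And>n. u n \<in> L2 lborel" "\<And>n. l2n lborel (u n) \<le> C"
    using u_bounded by blast
  \<comment> \<open>Any everywhere positive integrable function will do: its square root is a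
    positive weight in L2.\<close>
  obtain h :: "real^'m \<Rightarrow> ennreal" where h: "h \<in> borel_measurable lborel" "integral\<^sup>N lborel h \<noteq> \<infinity>"
      "\<And>p. 0 < h p" "\<And>p. h p < \<infinity>"
    using sigma_finite_measure.Ex_finite_integrable_function[OF sigma_finite_lborel] by auto
  define \<omega> where "\<omega> p = sqrt (enn2real (h p))" for p
  have \<omega>m: "\<omega> \<in> borel_measurable borel" unfolding \<omega>_def using h(1) by simp
  have \<omega>pos: "0 < \<omega> p" for p
    using h(3,4)[of p] by (simp add: \<omega>_def enn2real_positive_iff)
  have \<omega>L: "(\<lambda>p. complex_of_real (\<omega> p)) \<in> L2 lborel"
  proof (rule L2_nnI)
    have "ennreal ((cmod (complex_of_real (\<omega> p)))\<^sup>2) = h p" for p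
      using h(4)[of p] by (simp add: \<omega>_def)
    then show "(\<integral>\<^sup>+p. ennreal ((cmod (complex_of_real (\<omega> p)))\<^sup>2) \<partial>lborel) < \<infinity>"
      using h(2) by (simp add: less_top)
  qed (use \<omega>m in simp)
  interpret K: psd_kernel M \<mu> code \<omega> "C\<^sup>2"
    by unfold_locales (fact \<omega>m \<omega>pos \<omega>L form_nonneg form_trace[OF \<omega>L C])+
  obtain f where f: "f \<in> L2_L1 lborel K.trace_measure"
    and eq: "AE w in lborel. integrable K.trace_measure (f w) \<and>
        (\<forall>A\<in>sets M. \<mu> w A = (LINT z|K.trace_measure. indicator A z * f w z))"
    using K.kernel_factorization by blast
  have sp: "space K.trace_measure = X" by (simp add: space_M)
  have AE: "AE (p, q) in lborel. \<forall>A\<in>sets K.trace_measure. \<mu> (p, q) A = (LINT z:A|K.trace_measure. f (p, q) z)"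
    using eq
  proof eventually_elim
    case (elim w)
    have "(LINT z:A|K.trace_measure. f w z) = (LINT z|K.trace_measure. indicator A z * f w z)" for A
      unfolding set_lebesgue_integral_def
      by (intro Bochner_Integration.integral_cong refl) (simp add: indicator_def)
    then show ?case using elim by (cases w) simp
  qed
  have pos: "(LINT (p, q)|lborel. LINT z|K.trace_measure. \<rho> p * cnj (\<rho> q) * of_real (\<phi> z) * f (p, q) z) \<in> \<real>\<^sub>\<ge>\<^sub>0"
    if \<rho>: "\<rho> \<in> L2c lborel" and \<phi>: "\<phi> \<in> C0 (UNIV \<times> anis_P \<alpha>)" "\<forall>z\<in>UNIV \<times> anis_P \<alpha>. \<phi> z \<ge> 0"
    for \<rho> and \<phi> :: "(real^'d) \<times> (real^'d) \<Rightarrow> real"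
  proof -
    have \<phi>c: "continuous_on X \<phi>" and \<phi>K: "\<exists>K. compact K \<and> K \<subseteq> X \<and> (\<forall>x\<in>X - K. norm (\<phi> x) < 1)"
      using \<phi>(1) by (auto simp: C0_def X_def)
    obtain K where K: "compact K" "K \<subseteq> X" "\<And>x. x \<in> X - K \<Longrightarrow> norm (\<phi> x) < 1" using \<phi>K by blast
    have "compact (\<phi> ` K)" by (intro compact_continuous_image continuous_on_subset[OF \<phi>c] K)
    then obtain B where B: "\<And>x. x \<in> K \<Longrightarrow> norm (\<phi> x) \<le> B"
      using compact_imp_bounded by (force simp: bounded_iff)
    \<comment> \<open>\<phi> is arbitrary off \<open>X\<close>, but
      \<open>density_form_nonneg\<close> asks for a function that is non-negative everywhere; the
      integrals see only \<open>X\<close>.\<close>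
    define \<phi>' where "\<phi>' z = (if z \<in> X then \<phi> z else 0)" for z
    have m: "\<phi>' \<in> borel_measurable M"
    proof -
      have "\<phi> \<in> borel_measurable M" by (rule borel_measurable_continuous_on_restrict[OF \<phi>c])
      then show ?thesis by (rule measurable_cong[THEN iffD1, rotated]) (simp add: \<phi>'_def space_M)
    qed
    have "(LINT w|lborel. LINT z|K.trace_measure. \<rho> (fst w) * cnj (\<rho> (snd w)) * of_real (\<phi>' z) * f w z) \<in> \<real>\<^sub>\<ge>\<^sub>0"
    proof (rule K.density_form_nonneg[OF f eq _ m])
      show "\<rho> \<in> L2 lborel" using \<rho> by (simp add: L2c_def)
      show "0 \<le> \<phi>' z" for z using \<phi>(2) by (cases z) (auto simp: \<phi>'_def X_def)
      \<comment> \<open>\<open>B\<close> bounds \<phi> on the compact set \<open>K\<close>, and 1 is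
        the threshold with which \<open>K\<close> was chosen.\<close>
      show "\<phi>' z \<le> max B 1" if "z \<in> space M" for z
        using B[of z] K(3)[of z] that by (cases "z \<in> K") (auto simp: \<phi>'_def space_M)
    qed
    also have "(LINT w|lborel. LINT z|K.trace_measure. \<rho> (fst w) * cnj (\<rho> (snd w)) * of_real (\<phi>' z) * f w z) =
        (LINT (p, q)|lborel. LINT z|K.trace_measure. \<rho> p * cnj (\<rho> q) * of_real (\<phi> z) * f (p, q) z)"
      unfolding case_prod_beta'
      by (intro Bochner_Integration.integral_cong refl) (simp add: sp space_M \<phi>'_def)
    finally show ?thesis .
  qed
  show ?thesis
  proof (intro exI[of _ K.trace_measure] exI[of _ f] conjI ballI allI impI)
    show "sets K.trace_measure = sets (borel_on (UNIV \<times> anis_P \<alpha>))" using K.sets_trace_measure unfolding X_def .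
  qed (fact K.trm.finite_measure_axioms f AE pos)+
qed

end
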